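(* Let $M$ be a biconservative hypersurface in $\mathbb H^4\subset\mathbb E^5_1$ with three distinct principal curvatures, whose mean curvature $H$ has nowhere vanishing gradient. Then $M$ is locally (i.e. a neighbourhood of each of its points is) congruent to one of the following four hypersurfaces. (1) A hypersurface in $\mathbb H^4$ given by $$x(s,t,u)=\left(\alpha_1(s),\alpha_2(s)\cos t,\alpha_2(s)\sin t,\alpha_3(s)\cos u,\alpha_3(s)\sin u\right)$$ for a smooth, arc-length parametrized curve $\alpha=(\alpha_1,\alpha_2,\alpha_3):(a,b)\to\mathbb H^2(-1)$. (2) A hypersurface in $\mathbb H^4$ given by $$x(s,t,u)=\left(\alpha_1(s)\cosh u,\alpha_1(s)\sinh u,\alpha_2(s)\cos t,\alpha_2(s)\sin t,\alpha_3(s)\right)$$ for a smooth, arc-length parametrized curve $\alpha=(\alpha_1,\alpha_2,\alpha_3):(a,b)\to\mathbb H^2(-1)$. (3) A hypersurface in $\mathbb H^4$ given by $$x(s,t,u)=\left(\frac{aA(s)^2+a}{s}+asu^2+\frac{s}{4a},\;su,\;A(s)\cos t,\;A(s)\sin t,\;\frac{aA(s)^2+a}{s}+asu^2-\frac{s}{4a}\right)$$ for a smooth function $A$ and a non-zero constant $a$. (4) A hypersurface in $\mathbb H^4$ given by $$x(s,t,u)=\left(\frac{aA(s)^2}{s}+as(t^2+u^2)+\frac{s}{4a}+\frac{a}{s},\;st,\;su,\;A(s),\;\frac{aA(s)^2}{s}+as(t^2+u^2)-\frac{s}{4a}+\frac{a}{s}\right)$$ for a smooth function $A$ and a non-zero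 constant $a$.
   Context: $\mathbb E^m_1$ denotes $\mathbb R^m$ with the metric $-dx_1^2+dx_2^2+\dots+dx_m^2$, and $\mathbb H^n=\mathbb H^n(-1)=\{x\in\mathbb E^{n+1}_1:\langle x,x\rangle=-1\}$. Hypersurfaces are smooth and connected. For an oriented hypersurface $M^3\subset\mathbb H^4$ with unit normal $N$, the shape operator is $S(X)=-\widetilde\nabla_XN$ ($\widetilde\nabla$ the Levi-Civita connection of $\mathbb H^4$), the principal curvatures are the eigenvalues of $S$, and the mean curvature $H$ is defined by $3H=\operatorname{tr}S$. $M$ is biconservative if the tangential part of the bitension field of its immersion vanishes; equivalently, $S(\nabla H)+\frac{3H}{2}\nabla H=0$. *)

theory Defs
  imports "HOL-Analysis.Analysis"
begin

lemma vector_5 [simp]: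
  "(vector [a,b,c,d,e] :: ('a::zero)^5) $ 1 = a"
  "(vector [a,b,c,d,e] :: ('a::zero)^5) $ 2 = b"
  "(vector [a,b,c,d,e] :: ('a::zero)^5) $ 3 = c"
  "(vector [a,b,c,d,e] :: ('a::zero)^5) $ 4 = d"
  "(vector [a,b,c,d,e] :: ('a::zero)^5) $ 5 = e"
  unfolding vector_def by simp_all


section \<open>Smooth maps\<close>

text \<open>Meaningful for open \<open>U\<close> only: all derivatives are two-sided.\<close>

fun Ck_on :: "nat \<Rightarrow> 'a::euclidean_space set \<Rightarrow> ('a \<Rightarrow> 'b::real_normed_vector) \<Rightarrow> bool" where
  "Ck_on 0 U g \<longleftrightarrow> continuous_on U g"
| "Ck_on (Suc k) U g \<longleftrightarrow> (\<forall>q\<in>U. g differentiable (at q)) \<and>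
     (\<forall>v. Ck_on k U (\<lambda>q. frechet_derivative g (at q) v))"

definition smooth_on :: "'a::euclidean_space set \<Rightarrow> ('a \<Rightarrow> 'b::real_normed_vector) \<Rightarrow> bool" where
  "smooth_on U g \<longleftrightarrow> (\<forall>k. Ck_on k U g)"


section \<open>Minkowski space and hyperbolic space\<close>

definition lorentz :: "(real, 'n::{finite,one}) vec \<Rightarrow> (real, 'n) vec \<Rightarrow> real" where
  "lorentz x y = - (x $ 1 * y $ 1) + (\<Sum>i \<in> UNIV - {1}. x $ i * y $ i)"

text \<open>Both sheets of the hyperboloid are kept. For a connected hypersurface
  this makes no difference up to congruence, since \<open>x \<mapsto> - x\<close> is a Lorentz isometry.\<close>

definition hyp_space :: "(real, 'n::{finite,one}) vec set" where
  "hyp_space = {x. lorentz x x = -1}"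

definition lorentz_isometry :: "(real^5 \<Rightarrow> real^5) \<Rightarrow> bool" where
  "lorentz_isometry T \<longleftrightarrow> linear T \<and> (\<forall>x y. lorentz (T x) (T y) = lorentz x y)"


section \<open>Geometry of a parametrized hypersurface of hyperbolic 4-space\<close>

text \<open>Below \<open>F\<close> is an immersion of an open subset of \<open>\<real>\<^sup>3\<close> into hyperbolic space inside \<open>\<real>\<^sup>5\<close>.
  Tangent vectors of the hypersurface at \<open>q\<close> are represented by their coordinate
  vectors \<open>w\<close> in \<open>\<real>\<^sup>3\<close>, i.e. \<open>w\<close> stands for \<open>dF\<^sub>q(w)\<close>.\<close>

abbreviation partial :: "3 \<Rightarrow> (real^3 \<Rightarrow> 'b::real_normed_vector) \<Rightarrow> real^3 \<Rightarrow> 'b" where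
  "partial i G q \<equiv> frechet_derivative G (at q) (axis i 1)"

text \<open>The Levi-Civita connection of hyperbolic space applied to a vector field \<open>V\<close> along \<open>F\<close>:
  the flat derivative projected to the tangent space of hyperbolic space at \<open>F q\<close>,
  whose unit normal is the (timelike) position vector.\<close>

definition hcov :: "(real^3 \<Rightarrow> real^5) \<Rightarrow> real^3 \<Rightarrow> (real^3 \<Rightarrow> real^5) \<Rightarrow> real^3 \<Rightarrow> real^5" where
  "hcov F w V q = frechet_derivative V (at q) w
     + lorentz (frechet_derivative V (at q) w) (F q) *\<^sub>R F q"

text \<open>Curvature tensor \<open>R(X,Y)Z = \<nabla>\<^sub>X\<nabla>\<^sub>YZ - \<nabla>\<^sub>Y\<nabla>\<^sub>XZ - \<nabla>\<^bsub>[X,Y]\<^esub>Z\<close>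
  of hyperbolic space of curvature \<open>-1\<close>.\<close>

definition hcurv :: "real^5 \<Rightarrow> real^5 \<Rightarrow> real^5 \<Rightarrow> real^5" where
  "hcurv X Y Z = lorentz X Z *\<^sub>R Y - lorentz Y Z *\<^sub>R X"

definition metric :: "(real^3 \<Rightarrow> real^5) \<Rightarrow> real^3 \<Rightarrow> real^3^3" where
  "metric F q = (\<chi> i j. lorentz (partial i F q) (partial j F q))"

definition metric_inv :: "(real^3 \<Rightarrow> real^5) \<Rightarrow> real^3 \<Rightarrow> real^3^3" where
  "metric_inv F q = matrix_inv (metric F q)"

text \<open>\<open>christoffel F k i j\<close> is \<open>\<Gamma>\<^sup>k\<^sub>i\<^sub>j\<close> of the induced metric.\<close>

definition christoffel :: "(real^3 \<Rightarrow> real^5) \<Rightarrow> 3 \<Rightarrow> 3 \<Rightarrow> 3 \<Rightarrow> real^3 \<Rightarrow> real" where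
  "christoffel F k i j q = (1/2) * (\<Sum>l\<in>UNIV. metric_inv F q $ k $ l *
     (partial i (\<lambda>r. metric F r $ j $ l) q + partial j (\<lambda>r. metric F r $ i $ l) q
      - partial l (\<lambda>r. metric F r $ i $ j) q))"

definition gradient :: "(real^3 \<Rightarrow> real^5) \<Rightarrow> (real^3 \<Rightarrow> real) \<Rightarrow> real^3 \<Rightarrow> real^3" where
  "gradient F h q = (\<chi> i. \<Sum>j\<in>UNIV. metric_inv F q $ i $ j * partial j h q)"

text \<open>Tension field: the trace of the second fundamental form \<open>\<nabla>dF\<close> of the map \<open>F\<close>.\<close>

definition tension :: "(real^3 \<Rightarrow> real^5) \<Rightarrow> real^3 \<Rightarrow> real^5" where
  "tension F q = (\<Sum>i\<in>UNIV. \<Sum>j\<in>UNIV. metric_inv F q $ i $ j *\<^sub>R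
     (hcov F (axis i 1) (partial j F) q
      - (\<Sum>k\<in>UNIV. christoffel F k i j q *\<^sub>R partial k F q)))"

text \<open>Rough Laplacian \<open>tr (\<nabla>\<nabla> - \<nabla>\<^sub>\<nabla>)\<close> on vector fields along \<open>F\<close>.\<close>

definition rough_laplacian :: "(real^3 \<Rightarrow> real^5) \<Rightarrow> (real^3 \<Rightarrow> real^5) \<Rightarrow> real^3 \<Rightarrow> real^5" where
  "rough_laplacian F V q = (\<Sum>i\<in>UNIV. \<Sum>j\<in>UNIV. metric_inv F q $ i $ j *\<^sub>R
     (hcov F (axis i 1) (hcov F (axis j 1) V) q
      - (\<Sum>k\<in>UNIV. christoffel F k i j q *\<^sub>R hcov F (axis k 1) V q)))"

text \<open>\<open>\<tau>\<^sub>2 = tr (\<nabla>\<nabla> - \<nabla>\<^sub>\<nabla>) \<tau> - tr R(dF, \<tau>) dF\<close>.\<close>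

definition bitension :: "(real^3 \<Rightarrow> real^5) \<Rightarrow> real^3 \<Rightarrow> real^5" where
  "bitension F q = rough_laplacian F (tension F) q
     - (\<Sum>i\<in>UNIV. \<Sum>j\<in>UNIV. metric_inv F q $ i $ j *\<^sub>R
          hcurv (partial i F q) (tension F q) (partial j F q))"

text \<open>Orthogonal projection of an ambient vector to the tangent space \<open>dF\<^sub>q(\<real>\<^sup>3)\<close>.\<close>

definition tangential_part :: "(real^3 \<Rightarrow> real^5) \<Rightarrow> real^3 \<Rightarrow> real^5 \<Rightarrow> real^5" where
  "tangential_part F q v = (\<Sum>i\<in>UNIV. \<Sum>j\<in>UNIV.
     (metric_inv F q $ i $ j * lorentz v (partial i F q)) *\<^sub>R partial j F q)"

definition unit_normal_at :: "(real^3 \<Rightarrow> real^5) \<Rightarrow> real^3 \<Rightarrow> real^5 \<Rightarrow> bool" where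
  "unit_normal_at F q n \<longleftrightarrow> lorentz n n = 1 \<and> lorentz n (F q) = 0 \<and>
     (\<forall>w. lorentz n (frechet_derivative F (at q) w) = 0)"

text \<open>The shape operator \<open>dF(S w) = - \<nabla>\<^sub>w n\<close>. For an immersion \<open>F\<close> and a smooth unit normal field
  \<open>n\<close> the description determines a unique vector, because \<open>\<nabla>\<^sub>w n\<close> is tangent.\<close>

definition shape_op ::
  "(real^3 \<Rightarrow> real^5) \<Rightarrow> (real^3 \<Rightarrow> real^5) \<Rightarrow> real^3 \<Rightarrow> real^3 \<Rightarrow> real^3" where
  "shape_op F n q w = (THE z. frechet_derivative F (at q) z = - hcov F w n q)"

definition principal_curvatures ::
  "(real^3 \<Rightarrow> real^5) \<Rightarrow> (real^3 \<Rightarrow> real^5) \<Rightarrow> real^3 \<Rightarrow> real set" where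
  "principal_curvatures F n q = {k. \<exists>w. w \<noteq> 0 \<and> shape_op F n q w = k *\<^sub>R w}"

definition mean_curvature ::
  "(real^3 \<Rightarrow> real^5) \<Rightarrow> (real^3 \<Rightarrow> real^5) \<Rightarrow> real^3 \<Rightarrow> real" where
  "mean_curvature F n q = trace (matrix (shape_op F n q)) / 3"


section \<open>Hypersurfaces\<close>

text \<open>An immersed hypersurface is a topological space \<open>X\<close> with a map \<open>f\<close> that is a smooth immersion
  in suitable local parametrizations of \<open>X\<close> by open subsets of \<open>\<real>\<^sup>3\<close>. No atlas needs to
  be specified: since \<open>f \<circ> \<phi>\<close> is an immersion, the change between any two local parametrizations in
  the sense below is automatically smooth, so they form the (only) smooth structure on \<open>X\<close>
  for which \<open>f\<close> is a smooth immersion.\<close>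

definition local_param ::
  "'a topology \<Rightarrow> ('a \<Rightarrow> real^5) \<Rightarrow> (real^3) set \<Rightarrow> (real^3 \<Rightarrow> 'a) \<Rightarrow> bool" where
  "local_param X f U \<phi> \<longleftrightarrow> open U \<and> openin X (\<phi> ` U) \<and> embedding_map (top_of_set U) X \<phi> \<and>
     smooth_on U (f \<circ> \<phi>) \<and> (\<forall>q\<in>U. inj (frechet_derivative (f \<circ> \<phi>) (at q)))"

definition oriented_hypersurface ::
  "'a topology \<Rightarrow> ('a \<Rightarrow> real^5) \<Rightarrow> ('a \<Rightarrow> real^5) \<Rightarrow> bool" where
  "oriented_hypersurface X f N \<longleftrightarrow>
     connected_space X \<and> Hausdorff_space X \<and> second_countable X \<and>
     f ` topspace X \<subseteq> hyp_space \<and>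
     (\<forall>p\<in>topspace X. \<exists>U \<phi>. local_param X f U \<phi> \<and> p \<in> \<phi> ` U) \<and>
     (\<forall>U \<phi>. local_param X f U \<phi> \<longrightarrow>
        smooth_on U (N \<circ> \<phi>) \<and> (\<forall>q\<in>U. unit_normal_at (f \<circ> \<phi>) q (N (\<phi> q))))"

definition biconservative :: "'a topology \<Rightarrow> ('a \<Rightarrow> real^5) \<Rightarrow> bool" where
  "biconservative X f \<longleftrightarrow> (\<forall>U \<phi>. local_param X f U \<phi> \<longrightarrow>
     (\<forall>q\<in>U. tangential_part (f \<circ> \<phi>) q (bitension (f \<circ> \<phi>) q) = 0))"

definition three_distinct_principal_curvatures ::
  "'a topology \<Rightarrow> ('a \<Rightarrow> real^5) \<Rightarrow> ('a \<Rightarrow> real^5) \<Rightarrow> bool" where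
  "three_distinct_principal_curvatures X f N \<longleftrightarrow> (\<forall>U \<phi>. local_param X f U \<phi> \<longrightarrow>
     (\<forall>q\<in>U. card (principal_curvatures (f \<circ> \<phi>) (N \<circ> \<phi>) q) = 3))"

definition mean_curvature_grad_nonvanishing ::
  "'a topology \<Rightarrow> ('a \<Rightarrow> real^5) \<Rightarrow> ('a \<Rightarrow> real^5) \<Rightarrow> bool" where
  "mean_curvature_grad_nonvanishing X f N \<longleftrightarrow> (\<forall>U \<phi>. local_param X f U \<phi> \<longrightarrow>
     (\<forall>q\<in>U. gradient (f \<circ> \<phi>) (mean_curvature (f \<circ> \<phi>) (N \<circ> \<phi>)) q \<noteq> 0))"

text \<open>A neighbourhood of \<open>p\<close> is congruent to an open piece of the hypersurface parametrized
  by \<open>x(s,t,u)\<close>, \<open>s \<in> I\<close>: some local parametrization around \<open>p\<close>, defined on an open set \<open>U\<close> of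
  parameters \<open>(s,t,u)\<close>, turns \<open>f\<close> into \<open>T \<circ> x\<close> for an ambient isometry \<open>T\<close>.
  In particular \<open>x\<close> is itself an immersion on \<open>U\<close>.\<close>

definition locally_congruent_at ::
  "'a topology \<Rightarrow> ('a \<Rightarrow> real^5) \<Rightarrow> 'a \<Rightarrow> (real \<Rightarrow> real \<Rightarrow> real \<Rightarrow> real^5) \<Rightarrow> real set \<Rightarrow> bool" where
  "locally_congruent_at X f p x I \<longleftrightarrow> (\<exists>U \<phi> T. local_param X f U \<phi> \<and> p \<in> \<phi> ` U \<and>
     (\<forall>q\<in>U. q $ 1 \<in> I) \<and> lorentz_isometry T \<and>
     (\<forall>q\<in>U. f (\<phi> q) = T (x (q $ 1) (q $ 2) (q $ 3))))"


section \<open>The four families\<close>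

definition arc_length_curve_H2 :: "real set \<Rightarrow> (real \<Rightarrow> real^3) \<Rightarrow> bool" where
  "arc_length_curve_H2 I \<alpha> \<longleftrightarrow> smooth_on I \<alpha> \<and> (\<forall>s\<in>I. \<alpha> s \<in> hyp_space \<and>
     lorentz (vector_derivative \<alpha> (at s)) (vector_derivative \<alpha> (at s)) = 1)"

definition family1 :: "(real \<Rightarrow> real^3) \<Rightarrow> real \<Rightarrow> real \<Rightarrow> real \<Rightarrow> real^5" where
  "family1 \<alpha> s t u = vector
     [\<alpha> s $ 1, \<alpha> s $ 2 * cos t, \<alpha> s $ 2 * sin t, \<alpha> s $ 3 * cos u, \<alpha> s $ 3 * sin u]"

definition family2 :: "(real \<Rightarrow> real^3) \<Rightarrow> real \<Rightarrow> real \<Rightarrow> real \<Rightarrow> real^5" where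
  "family2 \<alpha> s t u = vector
     [\<alpha> s $ 1 * cosh u, \<alpha> s $ 1 * sinh u, \<alpha> s $ 2 * cos t, \<alpha> s $ 2 * sin t, \<alpha> s $ 3]"

definition family3 :: "real \<Rightarrow> (real \<Rightarrow> real) \<Rightarrow> real \<Rightarrow> real \<Rightarrow> real \<Rightarrow> real^5" where
  "family3 a A s t u = vector
     [(a * (A s)\<^sup>2 + a) / s + a * s * u\<^sup>2 + s / (4 * a),
      s * u,
      A s * cos t,
      A s * sin t,
      (a * (A s)\<^sup>2 + a) / s + a * s * u\<^sup>2 - s / (4 * a)]"

definition family4 :: "real \<Rightarrow> (real \<Rightarrow> real) \<Rightarrow> real \<Rightarrow> real \<Rightarrow> real \<Rightarrow> real^5" where
  "family4 a A s t u = vector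
     [a * (A s)\<^sup>2 / s + a * s * (t\<^sup>2 + u\<^sup>2) + s / (4 * a) + a / s,
      s * t,
      s * u,
      A s,
      a * (A s)\<^sup>2 / s + a * s * (t\<^sup>2 + u\<^sup>2) - s / (4 * a) + a / s]"

end

theory Submission
  imports Defs
begin

text \<open>For a biconservative hypersurface the gradient of the mean curvature \<open>H\<close> is a principal direction
  \<open>e\<^sub>1\<close> with \<open>k\<^sub>1 = - 3H/2\<close>, so that \<open>k\<^sub>2 + k\<^sub>3 = - 3 k\<^sub>1\<close>, and \<open>k\<^sub>1\<close> is constant along \<open>e\<^sub>2, e\<^sub>3\<close>.
  The Codazzi and Gauss equations reduce the connection to four functions \<open>p, q, a, b\<close>, where \<open>a, b\<close> are
  the coefficients of the connection in the plane of \<open>e\<^sub>2, e\<^sub>3\<close>. Differentiating \<open>k\<^sub>2 + k\<^sub>3 = - 3 k\<^sub>1\<close>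
  twice along \<open>e\<^sub>1\<close> and twice along \<open>e\<^sub>3\<close> gives
  \<open>a k\<^sub>1 (k\<^sub>2 - k\<^sub>3) ((k\<^sub>2 - k\<^sub>3)\<^sup>2 + 5 (p - q)\<^sup>2) = 0\<close>, whence \<open>a = 0\<close>, and \<open>b = 0\<close> by symmetry.
  Then the plane spanned by \<open>e\<^sub>i\<close> and the derivative \<open>\<xi>\<^sub>i\<close> of \<open>e\<^sub>i\<close> along itself is constant in \<open>\<real>\<^sup>5\<close> for \<open>i = 2, 3\<close>, the two planes are
  orthogonal, and the position vector moves in them on circles, hyperbolas or parabolas according to the
  sign of \<open>c\<^sub>i = \<langle>\<xi>\<^sub>i, \<xi>\<^sub>i\<rangle>\<close>. Since \<open>c\<^sub>2 + c\<^sub>3 > 0\<close>, only the first three families occur: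
  in the fourth one two principal curvatures coincide.\<close>

section \<open>Smooth maps\<close>

text \<open>The elimination works because \<open>e 2\<close> and \<open>e 3\<close> annihilate not
  only \<open>k 1\<close> but all its iterated derivatives along \<open>e 1\<close>. Hence each
  \<open>e 1\<close>-derivative of \<open>k 2 + k 3 = -3 * k 1\<close>, differentiated along
  \<open>e 3\<close>, is an algebraic identity with the factor \<open>a\<close>: the first fixes the
  \<open>e 3\<close>-derivative of \<open>q\<close>, the second says \<open>a * K = 0\<close>. On
  the open set where \<open>a\<close> is nonzero, \<open>K = 0\<close> can be differentiated once
  more; the last factor of the outcome is a positive sum of squares, so \<open>k 1\<close> vanishes
  there, against the assumption on the gradient of \<open>H\<close>. The integration needs
  coordinates although the frame fields do not commute. Along \<open>e 1\<close> the vector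
  \<open>\<xi> i\<close> is only rescaled, at the rate \<open>- r i\<close>. A positive function
  \<open>m\<close> with the opposite rate compensates this, and it also makes the coframe form of
  \<open>e i\<close>, divided by \<open>m\<close>, closed. The potential of that form is the angle,
  and the free initial value of \<open>m\<close> normalises the constant \<open>c i * m^2\<close> to
  1, -1 or 0. Congruence is then shown by comparing Lorentz products with one fixed orthonormal
  basis built at the base point.\<close>

abbreviation fd :: "('a::real_normed_vector \<Rightarrow> 'b::real_normed_vector) \<Rightarrow> 'a \<Rightarrow> 'a \<Rightarrow> 'b" where
  "fd g x \<equiv> frechet_derivative g (at x)"

lemma fd_eqI: "(g has_derivative g') (at x) \<Longrightarrow> fd g x = g'"
  using frechet_derivative_at by metis

lemma has_fd: "g differentiable (at x) \<Longrightarrow> (g has_derivative fd g x) (at x)"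
  using frechet_derivative_works by blast

lemma fd_cong:
  assumes "open U" "x \<in> U" "\<And>y. y \<in> U \<Longrightarrow> f y = g y"
  shows "f differentiable (at x) \<longleftrightarrow> g differentiable (at x)" "fd f x = fd g x"
proof -
  have *: "f differentiable (at x) \<Longrightarrow> g differentiable (at x)"
    if "\<And>y. y \<in> U \<Longrightarrow> f y = g y" for f g :: "'a \<Rightarrow> 'b"
    using that assms(1,2) unfolding differentiable_def
    by (meson has_derivative_transform_within_open)
  show d: "f differentiable (at x) \<longleftrightarrow> g differentiable (at x)"
    using *[of f g] *[of g f] assms(3) by auto
  have "(f has_derivative D) (at x) \<longleftrightarrow> (g has_derivative D) (at x)" for D
    using assms has_derivative_transform_within_open[of f D x UNIV U g]
      has_derivative_transform_within_open[of g D x UNIV U f] by auto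
  then show "fd f x = fd g x"
    unfolding frechet_derivative_def by auto
qed

lemma Ck_on_cong:
  assumes "open U" "\<And>x. x \<in> U \<Longrightarrow> f x = g x"
  shows "Ck_on k U f \<longleftrightarrow> Ck_on k U g"
  using assms(2)
proof (induction k arbitrary: f g)
  case 0
  then show ?case by (simp cong: continuous_on_cong)
next
  case (Suc k)
  have "Ck_on k U (\<lambda>q. fd f q v) \<longleftrightarrow> Ck_on k U (\<lambda>q. fd g q v)" for v
    using Suc.prems by (intro Suc.IH) (metis fd_cong(2) assms(1))
  moreover have "f differentiable (at x) \<longleftrightarrow> g differentiable (at x)" if "x \<in> U" for x
    using fd_cong(1) assms(1) that Suc.prems by blast
  ultimately show ?case by simp
qed

lemma Ck_on_SucD: "Ck_on (Suc k) U g \<Longrightarrow> Ck_on k U g"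
proof (induction k arbitrary: g)
  case 0
  then show ?case
    by (auto intro!: continuous_at_imp_continuous_on differentiable_imp_continuous_within)
next
  case (Suc k)
  then show ?case by (metis Ck_on.simps(2))
qed

lemma Ck_on_subset: "Ck_on k U g \<Longrightarrow> V \<subseteq> U \<Longrightarrow> Ck_on k V g"
  by (induction k arbitrary: g) (auto intro: continuous_on_subset)

section \<open>Closure properties of C^k and smooth maps\<close>

lemma Ck_on_const: "Ck_on k U (\<lambda>_. c)"
  by (induction k arbitrary: c) auto

text \<open>Lets an explicit derivative formula stand in for \<open>frechet_derivative\<close>,
  which is a choice operator. The closure lemmas for C^k maps below are inductions on
  \<open>k\<close> through this rule.\<close>

lemma Ck_on_SucI:
  assumes "open U" "\<And>x. x \<in> U \<Longrightarrow> (f has_derivative f' x) (at x)"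
    and "\<And>v. Ck_on k U (\<lambda>x. f' x v)"
  shows "Ck_on (Suc k) U f"
proof -
  have "Ck_on k U (\<lambda>q. fd f q v)" for v
    using assms(3)[of v] Ck_on_cong[OF assms(1), of "\<lambda>q. fd f q v" "\<lambda>x. f' x v"] fd_eqI[OF assms(2)]
    by simp
  moreover have "f differentiable (at q)" if "q \<in> U" for q
    using assms(2)[OF that] by (auto simp: differentiable_def)
  ultimately show ?thesis by simp
qed

lemma Ck_on_bounded_linear:
  assumes "bounded_linear L" "open U" "Ck_on k U g"
  shows "Ck_on k U (\<lambda>x. L (g x))"
  using assms(3)
proof (induction k arbitrary: g)
  case 0
  then show ?case by (simp add: bounded_linear.continuous_on[OF assms(1)])
next
  case (Suc k)
  show ?case
    by (rule Ck_on_SucI[OF assms(2), where f'="\<lambda>x v. L (fd g x v)"])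
      (use Suc in \<open>auto intro!: bounded_linear.has_derivative[OF assms(1)] has_fd\<close>)
qed

lemma Ck_on_add:
  assumes "open U" "Ck_on k U f" "Ck_on k U g"
  shows "Ck_on k U (\<lambda>x. f x + g x)"
  using assms(2,3)
proof (induction k arbitrary: f g)
  case 0
  then show ?case by (simp add: continuous_on_add)
next
  case (Suc k)
  show ?case
    by (rule Ck_on_SucI[OF assms(1), where f'="\<lambda>x v. fd f x v + fd g x v"])
      (use Suc in \<open>auto intro!: has_derivative_add has_fd\<close>)
qed

lemma Ck_on_bilinear:
  assumes "bounded_bilinear B" "open U" "Ck_on k U f" "Ck_on k U g"
  shows "Ck_on k U (\<lambda>x. B (f x) (g x))"
  using assms(3,4)
proof (induction k arbitrary: f g)
  case 0
  then show ?case by (simp add: bounded_bilinear.continuous_on[OF assms(1)])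
next
  case (Suc k)
  show ?case
  proof (rule Ck_on_SucI[OF assms(2), where f'="\<lambda>x v. B (f x) (fd g x v) + B (fd f x v) (g x)"])
    show "Ck_on k U (\<lambda>x. B (f x) (fd g x v) + B (fd f x v) (g x))" for v
      using Suc Ck_on_SucD[OF Suc.prems(1)] Ck_on_SucD[OF Suc.prems(2)]
      by (intro Ck_on_add[OF assms(2)]) auto
  qed (use Suc in \<open>auto intro!: bounded_bilinear.FDERIV[OF assms(1)] has_fd\<close>)
qed

text \<open>The derivative of 1/f is a product of 1/f with itself and f', so the induction
  hypothesis on 1/f itself suffices. The square root is treated in the same way.\<close>

lemma Ck_on_inverse:
  fixes f :: "'a::euclidean_space \<Rightarrow> real"
  assumes "open U" "Ck_on k U f" "\<And>x. x \<in> U \<Longrightarrow> f x \<noteq> 0"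
  shows "Ck_on k U (\<lambda>x. inverse (f x))"
  using assms(2)
proof (induction k)
  case 0
  then show ?case using assms(3) by (simp add: continuous_on_inverse)
next
  case (Suc k)
  show ?case
  proof (rule Ck_on_SucI[OF assms(1), where f'="\<lambda>x v. - (inverse (f x) * fd f x v * inverse (f x))"])
    show "Ck_on k U (\<lambda>x. - (inverse (f x) * fd f x v * inverse (f x)))" for v
      using Suc Ck_on_SucD[OF Suc.prems]
      by (intro Ck_on_bounded_linear[OF bounded_linear_minus[OF bounded_linear_ident]]
          Ck_on_bilinear[OF bounded_bilinear_mult] assms(1)) auto
  qed (use Suc assms(3) in \<open>auto intro!: Deriv.has_derivative_inverse has_fd\<close>)
qed

lemma Ck_on_sqrt:
  fixes f :: "'a::euclidean_space \<Rightarrow> real"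
  assumes "open U" "Ck_on k U f" "\<And>x. x \<in> U \<Longrightarrow> f x > 0"
  shows "Ck_on k U (\<lambda>x. sqrt (f x))"
  using assms(2)
proof (induction k)
  case 0
  then show ?case by (simp add: continuous_on_real_sqrt)
next
  case (Suc k)
  show ?case
  proof (rule Ck_on_SucI[OF assms(1), where f'="\<lambda>x v. (1/2) * (inverse (sqrt (f x)) * fd f x v)"])
    show "Ck_on k U (\<lambda>x. (1/2) * (inverse (sqrt (f x)) * fd f x v))" for v
      using Suc Ck_on_SucD[OF Suc.prems] assms(3)
      by (intro Ck_on_bilinear[OF bounded_bilinear_mult] assms(1) Ck_on_const Ck_on_inverse) force+
    fix x assume x: "x \<in> U"
    then have "(f has_derivative fd f x) (at x)" using Suc by (auto intro: has_fd)
    then show "((\<lambda>x. sqrt (f x)) has_derivative (\<lambda>v. (1/2) * (inverse (sqrt (f x)) * fd f x v))) (at x)"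
      using assms(3)[OF x] by (auto intro!: derivative_eq_intros simp: field_simps)
  qed
qed

lemma smooth_on_cong:
  assumes "open U" "\<And>x. x \<in> U \<Longrightarrow> f x = g x"
  shows "smooth_on U f \<longleftrightarrow> smooth_on U g"
  using Ck_on_cong[OF assms] by (simp add: smooth_on_def)

lemma smooth_on_subset: "smooth_on U g \<Longrightarrow> V \<subseteq> U \<Longrightarrow> smooth_on V g"
  by (meson Ck_on_subset smooth_on_def)

lemma smooth_on_differentiable: "smooth_on U g \<Longrightarrow> x \<in> U \<Longrightarrow> g differentiable (at x)"
  using Ck_on.simps(2) unfolding smooth_on_def by blast

lemma smooth_on_has_fd: "smooth_on U g \<Longrightarrow> x \<in> U \<Longrightarrow> (g has_derivative fd g x) (at x)"
  using has_fd smooth_on_differentiable by blast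

lemma smooth_on_continuous: "smooth_on U g \<Longrightarrow> continuous_on U g"
  using Ck_on.simps(1) unfolding smooth_on_def by blast

lemma smooth_on_fd_const: "smooth_on U g \<Longrightarrow> smooth_on U (\<lambda>x. fd g x v)"
  using Ck_on.simps(2) unfolding smooth_on_def by blast

lemma smooth_on_const: "smooth_on U (\<lambda>_. c)"
  by (simp add: smooth_on_def Ck_on_const)

lemma smooth_on_bounded_linear:
  "bounded_linear L \<Longrightarrow> open U \<Longrightarrow> smooth_on U g \<Longrightarrow> smooth_on U (\<lambda>x. L (g x))"
  by (simp add: smooth_on_def Ck_on_bounded_linear)

lemma smooth_on_add: "open U \<Longrightarrow> smooth_on U f \<Longrightarrow> smooth_on U g \<Longrightarrow> smooth_on U (\<lambda>x. f x + g x)"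
  by (simp add: smooth_on_def Ck_on_add)

lemma smooth_on_bilinear:
  "bounded_bilinear B \<Longrightarrow> open U \<Longrightarrow> smooth_on U f \<Longrightarrow> smooth_on U g \<Longrightarrow> smooth_on U (\<lambda>x. B (f x) (g x))"
  by (simp add: smooth_on_def Ck_on_bilinear)

lemma smooth_on_scaleR: "open U \<Longrightarrow> smooth_on U f \<Longrightarrow> smooth_on U g \<Longrightarrow> smooth_on U (\<lambda>x. f x *\<^sub>R g x)"
  by (rule smooth_on_bilinear[OF bounded_bilinear_scaleR])

lemma smooth_on_mult:
  fixes f g :: "'a::euclidean_space \<Rightarrow> real"
  shows "open U \<Longrightarrow> smooth_on U f \<Longrightarrow> smooth_on U g \<Longrightarrow> smooth_on U (\<lambda>x. f x * g x)"
  by (rule smooth_on_bilinear[OF bounded_bilinear_mult])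

lemma smooth_on_inner: "open U \<Longrightarrow> smooth_on U f \<Longrightarrow> smooth_on U g \<Longrightarrow> smooth_on U (\<lambda>x. f x \<bullet> g x)"
  by (rule smooth_on_bilinear[OF bounded_bilinear_inner])

lemma smooth_on_minus: "open U \<Longrightarrow> smooth_on U f \<Longrightarrow> smooth_on U (\<lambda>x. - f x)"
  by (rule smooth_on_bounded_linear[OF bounded_linear_minus[OF bounded_linear_ident]])

lemma smooth_on_diff: "open U \<Longrightarrow> smooth_on U f \<Longrightarrow> smooth_on U g \<Longrightarrow> smooth_on U (\<lambda>x. f x - g x)"
  using smooth_on_add[of U f "\<lambda>x. - g x"] smooth_on_minus[of U g] by simp

lemma smooth_on_sum:
  "open U \<Longrightarrow> (\<And>i. i \<in> I \<Longrightarrow> smooth_on U (f i)) \<Longrightarrow> smooth_on U (\<lambda>x. \<Sum>i\<in>I. f i x)"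
  by (induction I rule: infinite_finite_induct) (auto intro: smooth_on_const smooth_on_add)

lemma smooth_on_prod:
  fixes f :: "'i \<Rightarrow> 'a::euclidean_space \<Rightarrow> real"
  shows "open U \<Longrightarrow> (\<And>i. i \<in> I \<Longrightarrow> smooth_on U (f i)) \<Longrightarrow> smooth_on U (\<lambda>x. \<Prod>i\<in>I. f i x)"
  by (induction I rule: infinite_finite_induct) (auto intro: smooth_on_const smooth_on_mult)

lemma smooth_on_inverse:
  fixes f :: "'a::euclidean_space \<Rightarrow> real"
  shows "open U \<Longrightarrow> smooth_on U f \<Longrightarrow> (\<And>x. x \<in> U \<Longrightarrow> f x \<noteq> 0) \<Longrightarrow> smooth_on U (\<lambda>x. inverse (f x))"
  by (simp add: smooth_on_def Ck_on_inverse)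

lemma smooth_on_divide:
  fixes f :: "'a::euclidean_space \<Rightarrow> real"
  shows "open U \<Longrightarrow> smooth_on U f \<Longrightarrow> smooth_on U g \<Longrightarrow> (\<And>x. x \<in> U \<Longrightarrow> g x \<noteq> 0)
    \<Longrightarrow> smooth_on U (\<lambda>x. f x / g x)"
  unfolding divide_inverse by (intro smooth_on_mult smooth_on_inverse)

lemma smooth_on_sqrt:
  fixes f :: "'a::euclidean_space \<Rightarrow> real"
  shows "open U \<Longrightarrow> smooth_on U f \<Longrightarrow> (\<And>x. x \<in> U \<Longrightarrow> f x > 0) \<Longrightarrow> smooth_on U (\<lambda>x. sqrt (f x))"
  by (simp add: smooth_on_def Ck_on_sqrt)

lemma smooth_on_power:
  fixes f :: "'a::euclidean_space \<Rightarrow> real"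
  shows "open U \<Longrightarrow> smooth_on U f \<Longrightarrow> smooth_on U (\<lambda>x. f x ^ n)"
  by (induction n) (auto intro: smooth_on_const smooth_on_mult)

lemma smooth_on_vec_nth: "open U \<Longrightarrow> smooth_on U g \<Longrightarrow> smooth_on U (\<lambda>x. g x $ i)"
  by (rule smooth_on_bounded_linear[OF bounded_linear_vec_nth])

lemma smooth_on_vec_lambda:
  fixes g :: "'a::euclidean_space \<Rightarrow> 'n::finite \<Rightarrow> real"
  assumes "open U" "\<And>i. smooth_on U (\<lambda>x. g x i)"
  shows "smooth_on U (\<lambda>x. \<chi> i. g x i)"
proof -
  have "(\<lambda>x. \<chi> i. g x i) = (\<lambda>x. \<Sum>i\<in>UNIV. g x i *\<^sub>R axis i 1)"
    by (auto simp: vec_eq_iff axis_def if_distrib cong: if_cong)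
  then show ?thesis
    using assms by (auto intro!: smooth_on_sum smooth_on_scaleR smooth_on_const)
qed

lemma fd_linear: "g differentiable (at x) \<Longrightarrow> linear (fd g x)"
  by (rule linear_frechet_derivative)

lemma fd_eq_sum_Basis:
  fixes g :: "'a::euclidean_space \<Rightarrow> 'b::real_normed_vector"
  assumes "g differentiable (at x)"
  shows "fd g x w = (\<Sum>b\<in>Basis. (w \<bullet> b) *\<^sub>R fd g x b)"
proof -
  interpret linear "fd g x" using fd_linear[OF assms] .
  have "fd g x w = fd g x (\<Sum>b\<in>Basis. (w \<bullet> b) *\<^sub>R b)" by (simp add: euclidean_representation)
  then show ?thesis by (simp add: sum scale)
qed

lemma fd_eq_sum_axis:
  fixes g :: "real^'n \<Rightarrow> 'b::real_normed_vector"
  assumes "g differentiable (at x)"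
  shows "fd g x w = (\<Sum>i\<in>UNIV. (w $ i) *\<^sub>R fd g x (axis i 1))"
proof -
  interpret linear "fd g x" using fd_linear[OF assms] .
  have "fd g x w = fd g x (\<Sum>i\<in>UNIV. (w $ i) *\<^sub>R axis i 1)"
    using basis_expansion[of w] by (simp add: scalar_mult_eq_scaleR)
  then show ?thesis by (simp add: sum scale)
qed

text \<open>Smoothness is defined through derivatives in constant directions; a varying direction is
  expanded in a fixed basis.\<close>

lemma smooth_on_fd:
  assumes "open U" "smooth_on U g" "smooth_on U w"
  shows "smooth_on U (\<lambda>x. fd g x (w x))"
proof -
  have "smooth_on U (\<lambda>x. \<Sum>b\<in>Basis. (w x \<bullet> b) *\<^sub>R fd g x b)"
    by (intro smooth_on_sum smooth_on_scaleR smooth_on_inner smooth_on_const smooth_on_fd_const assms)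
  moreover have "fd g x (w x) = (\<Sum>b\<in>Basis. (w x \<bullet> b) *\<^sub>R fd g x b)" if "x \<in> U" for x
    by (rule fd_eq_sum_Basis[OF smooth_on_differentiable[OF assms(2) that]])
  ultimately show ?thesis
    by (subst smooth_on_cong[OF assms(1)]) auto
qed

lemma smooth_onI_fd:
  assumes "open U" "\<And>x. x \<in> U \<Longrightarrow> (g has_derivative g' x) (at x)" "\<And>v. smooth_on U (\<lambda>x. g' x v)"
  shows "smooth_on U g"
proof -
  have "Ck_on (Suc k) U g" for k
    using assms by (intro Ck_on_SucI) (auto simp: smooth_on_def)
  then show ?thesis
    unfolding smooth_on_def using Ck_on_SucD[of _ U g] by iprover
qed

section \<open>Symmetry of second derivatives\<close>

lemma second_difference_mvt:
  fixes g :: "'a::euclidean_space \<Rightarrow> real"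
  assumes "smooth_on U g" "s > 0"
    and in_U: "\<And>\<tau> \<sigma>. 0 \<le> \<tau> \<Longrightarrow> \<tau> \<le> s \<Longrightarrow> 0 \<le> \<sigma> \<Longrightarrow> \<sigma> \<le> s \<Longrightarrow> x + \<tau> *\<^sub>R u + \<sigma> *\<^sub>R v \<in> U"
  shows "\<exists>\<tau> \<sigma>. 0 < \<tau> \<and> \<tau> < s \<and> 0 < \<sigma> \<and> \<sigma> < s \<and>
    g (x + s *\<^sub>R u + s *\<^sub>R v) - g (x + s *\<^sub>R u) - g (x + s *\<^sub>R v) + g x
      = s * (s * fd (\<lambda>y. fd g y u) (x + \<tau> *\<^sub>R u + \<sigma> *\<^sub>R v) v)"
proof -
  have line: "((\<lambda>\<tau>. h (c + \<tau> *\<^sub>R w)) has_real_derivative fd h (c + \<tau> *\<^sub>R w) w) (at \<tau>)"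
    if "smooth_on U h" "c + \<tau> *\<^sub>R w \<in> U" for h :: "'a \<Rightarrow> real" and c w \<tau>
  proof -
    have "((\<lambda>\<tau>. h (c + \<tau> *\<^sub>R w)) has_derivative (\<lambda>r. fd h (c + \<tau> *\<^sub>R w) (r *\<^sub>R w))) (at \<tau>)"
    proof (rule has_derivative_compose[of "\<lambda>\<tau>. c + \<tau> *\<^sub>R w" "\<lambda>r. r *\<^sub>R w"])
      show "((\<lambda>\<tau>. c + \<tau> *\<^sub>R w) has_derivative (\<lambda>r. r *\<^sub>R w)) (at \<tau>)"
        by (auto intro!: derivative_eq_intros)
    qed (rule smooth_on_has_fd[OF that])
    moreover have "fd h (c + \<tau> *\<^sub>R w) (r *\<^sub>R w) = fd h (c + \<tau> *\<^sub>R w) w * r" for r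
      using linear_scale[OF fd_linear[OF smooth_on_differentiable[OF that]]] by simp
    ultimately show ?thesis
      by (simp add: has_field_derivative_def)
  qed
  have in0: "x + \<tau> *\<^sub>R u \<in> U" if "0 \<le> \<tau>" "\<tau> \<le> s" for \<tau>
    using in_U[of \<tau> 0] that \<open>s > 0\<close> by simp
  let ?\<phi> = "\<lambda>\<tau>. g (x + s *\<^sub>R v + \<tau> *\<^sub>R u) - g (x + \<tau> *\<^sub>R u)"
  let ?\<phi>' = "\<lambda>\<tau>. fd g (x + s *\<^sub>R v + \<tau> *\<^sub>R u) u - fd g (x + \<tau> *\<^sub>R u) u"
  have "(?\<phi> has_real_derivative ?\<phi>' \<tau>) (at \<tau>)" if "0 \<le> \<tau>" "\<tau> \<le> s" for \<tau>
    using that in_U[of \<tau> s] in0 \<open>s > 0\<close> by (intro DERIV_diff line assms(1)) (auto simp: algebra_simps)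
  then obtain \<tau> where \<tau>: "0 < \<tau>" "\<tau> < s" "?\<phi> s - ?\<phi> 0 = (s - 0) * ?\<phi>' \<tau>"
    using MVT2[of 0 s ?\<phi> ?\<phi>'] \<open>s > 0\<close> by auto
  let ?\<chi> = "\<lambda>\<sigma>. fd g ((x + \<tau> *\<^sub>R u) + \<sigma> *\<^sub>R v) u"
  let ?\<chi>' = "\<lambda>\<sigma>. fd (\<lambda>y. fd g y u) ((x + \<tau> *\<^sub>R u) + \<sigma> *\<^sub>R v) v"
  have "(?\<chi> has_real_derivative ?\<chi>' \<sigma>) (at \<sigma>)" if "0 \<le> \<sigma>" "\<sigma> \<le> s" for \<sigma>
    using that in_U[of \<tau> \<sigma>] \<tau> by (intro line smooth_on_fd_const assms(1)) auto
  then obtain \<sigma> where \<sigma>: "0 < \<sigma>" "\<sigma> < s" "?\<chi> s - ?\<chi> 0 = (s - 0) * ?\<chi>' \<sigma>"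
    using MVT2[of 0 s ?\<chi> ?\<chi>'] \<open>s > 0\<close> by auto
  have "?\<phi>' \<tau> = s * ?\<chi>' \<sigma>"
    using \<sigma>(3) by (simp add: algebra_simps)
  with \<tau> \<sigma> show ?thesis
    by (intro exI[of _ \<tau>] exI[of _ \<sigma>]) (simp add: algebra_simps)
qed

text \<open>The second difference over a small parallelogram is symmetric in \<open>u\<close> and
  \<open>v\<close>. Two applications of the mean value theorem express it by either mixed derivative
  at a nearby point, and both are continuous.\<close>

lemma fd_fd_sym_real:
  fixes g :: "'a::euclidean_space \<Rightarrow> real"
  assumes "open U" "smooth_on U g" "x \<in> U"
  shows "fd (\<lambda>y. fd g y u) x v = fd (\<lambda>y. fd g y v) x u"
proof -
  let ?A = "\<lambda>y. fd (\<lambda>y. fd g y u) y v" and ?B = "\<lambda>y. fd (\<lambda>y. fd g y v) y u"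
  have cont: "isCont ?A x" "isCont ?B x"
    using assms smooth_on_continuous[OF smooth_on_fd_const[OF smooth_on_fd_const[OF assms(2)]]]
    by (auto simp: continuous_on_eq_continuous_at)
  have lim: "(?A \<longlongrightarrow> ?A x) (nhds x)" "(?B \<longlongrightarrow> ?B x) (nhds x)"
    using cont tendsto_at_iff_tendsto_nhds[of ?A x] tendsto_at_iff_tendsto_nhds[of ?B x]
    unfolding isCont_def by blast+
  have "dist (?A x) (?B x) < e" if "e > 0" for e
  proof -
    have "\<forall>\<^sub>F y in nhds x. dist (?A y) (?A x) < e/2 \<and> dist (?B y) (?B x) < e/2 \<and> y \<in> U"
      using lim that assms(1,3) by (intro eventually_conj tendstoD) (auto simp: eventually_nhds_in_open)
    then obtain r where r: "r > 0" "\<And>y. dist y x < r \<Longrightarrow> dist (?A y) (?A x) < e/2 \<and> dist (?B y) (?B x) < e/2 \<and> y \<in> U"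
      unfolding eventually_nhds_metric by auto
    \<comment> \<open>Small enough to keep the parallelogram inside the ball of radius
      \<open>r\<close>; the summand 1 avoids division by zero when \<open>u\<close> and
      \<open>v\<close> vanish.\<close>
    define s where "s = r / (2 * (norm u + norm v + 1))"
    have s: "s > 0" using r(1) by (simp add: s_def add_nonneg_pos)
    have near: "dist (x + \<tau> *\<^sub>R u + \<sigma> *\<^sub>R v) x < r" if "0 \<le> \<tau>" "\<tau> \<le> s" "0 \<le> \<sigma>" "\<sigma> \<le> s" for \<tau> \<sigma>
    proof -
      have "dist (x + \<tau> *\<^sub>R u + \<sigma> *\<^sub>R v) x \<le> norm (\<tau> *\<^sub>R u) + norm (\<sigma> *\<^sub>R v)"
        using norm_triangle_ineq[of "\<tau> *\<^sub>R u" "\<sigma> *\<^sub>R v"] by (simp add: dist_norm add.assoc)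
      also have "\<dots> \<le> s * (norm u + norm v)"
        using that by (simp add: distrib_left add_mono mult_right_mono)
      also have "\<dots> < 2 * s * (norm u + norm v + 1)"
      proof -
        have "0 \<le> s * norm u" "0 \<le> s * norm v" using s by simp_all
        then have "0 < s * norm u + (s * norm v + s * 2)" using s by linarith
        then show ?thesis by (simp add: algebra_simps)
      qed
      also have "\<dots> = r" unfolding s_def by (simp add: field_simps add_nonneg_eq_0_iff)
      finally show ?thesis .
    qed
    obtain \<tau> \<sigma> where 1: "0 < \<tau>" "\<tau> < s" "0 < \<sigma>" "\<sigma> < s"
      "g (x + s *\<^sub>R u + s *\<^sub>R v) - g (x + s *\<^sub>R u) - g (x + s *\<^sub>R v) + g x = s * (s * ?A (x + \<tau> *\<^sub>R u + \<sigma> *\<^sub>R v))"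
      using second_difference_mvt[OF assms(2) s, of x u v] near r(2) by blast
    have near': "dist (x + \<tau> *\<^sub>R v + \<sigma> *\<^sub>R u) x < r" if "0 \<le> \<tau>" "\<tau> \<le> s" "0 \<le> \<sigma>" "\<sigma> \<le> s" for \<tau> \<sigma>
      using near[OF that(3,4,1,2)] by (simp add: add_ac)
    obtain \<tau>' \<sigma>' where 2: "0 < \<tau>'" "\<tau>' < s" "0 < \<sigma>'" "\<sigma>' < s"
      "g (x + s *\<^sub>R v + s *\<^sub>R u) - g (x + s *\<^sub>R v) - g (x + s *\<^sub>R u) + g x = s * (s * ?B (x + \<tau>' *\<^sub>R v + \<sigma>' *\<^sub>R u))"
      using second_difference_mvt[OF assms(2) s, of x v u] near' r(2) by blast
    have "g (x + s *\<^sub>R v + s *\<^sub>R u) = g (x + s *\<^sub>R u + s *\<^sub>R v)" by (simp add: add_ac)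
    then have "s * (s * ?A (x + \<tau> *\<^sub>R u + \<sigma> *\<^sub>R v)) = s * (s * ?B (x + \<tau>' *\<^sub>R v + \<sigma>' *\<^sub>R u))"
      using 1(5) 2(5) by linarith
    then have "?A (x + \<tau> *\<^sub>R u + \<sigma> *\<^sub>R v) = ?B (x + \<tau>' *\<^sub>R v + \<sigma>' *\<^sub>R u)"
      using s by simp
    moreover have "dist (?A (x + \<tau> *\<^sub>R u + \<sigma> *\<^sub>R v)) (?A x) < e/2"
      using near[of \<tau> \<sigma>] r(2) 1(1-4) by force
    moreover have "dist (?B (x + \<tau>' *\<^sub>R v + \<sigma>' *\<^sub>R u)) (?B x) < e/2"
      using near'[of \<tau>' \<sigma>'] r(2) 2(1-4) by force
    ultimately show ?thesis using dist_triangle_half_r by metis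
  qed
  then have "dist (?A x) (?B x) \<le> 0"
    by (meson dense_ge less_imp_le)
  then show ?thesis by simp
qed

lemma fd_bounded_linear:
  assumes "bounded_linear L" "g differentiable (at x)"
  shows "fd (\<lambda>y. L (g y)) x v = L (fd g x v)"
  using fd_eqI[OF bounded_linear.has_derivative[OF assms(1) has_fd[OF assms(2)]]] by simp

lemma fd_fd_sym:
  fixes g :: "'a::euclidean_space \<Rightarrow> 'b::euclidean_space"
  assumes "open U" "smooth_on U g" "x \<in> U"
  shows "fd (\<lambda>y. fd g y u) x v = fd (\<lambda>y. fd g y v) x u"
proof (rule euclidean_eqI)
  fix b :: 'b
  have L: "bounded_linear (\<lambda>z::'b. z \<bullet> b)" by (rule bounded_linear_inner_left)
  have *: "fd (\<lambda>y. fd (\<lambda>z. g z \<bullet> b) y u) x v = fd (\<lambda>y. fd g y u) x v \<bullet> b" for u v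
  proof -
    have "fd (\<lambda>y. fd (\<lambda>z. g z \<bullet> b) y u) x = fd (\<lambda>y. fd g y u \<bullet> b) x"
      by (intro fd_cong(2)[OF assms(1,3)] fd_bounded_linear[OF L] smooth_on_differentiable[OF assms(2)])
    moreover have "fd (\<lambda>y. fd g y u \<bullet> b) x v = fd (\<lambda>y. fd g y u) x v \<bullet> b"
      by (intro fd_bounded_linear[OF L] smooth_on_differentiable[OF smooth_on_fd_const[OF assms(2)] assms(3)])
    ultimately show ?thesis by metis
  qed
  show "fd (\<lambda>y. fd g y u) x v \<bullet> b = fd (\<lambda>y. fd g y v) x u \<bullet> b"
    using fd_fd_sym_real[OF assms(1) smooth_on_bounded_linear[OF L assms(1,2)] assms(3), of u v]
    unfolding * .
qed

section \<open>Closed fields, local coordinates and Lorentzian linear algebra\<close>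

text \<open>Poincare lemma: the potential is the integral of \<open>A\<close> along the segment from
  a base point, which convexity keeps inside \<open>V\<close>.\<close>

lemma poincare_closed_field:
  fixes A :: "'a::euclidean_space \<Rightarrow> 'a"
  assumes "open V" "convex V" "smooth_on V A"
    and closed: "\<And>x u v. x \<in> V \<Longrightarrow> fd A x u \<bullet> v = fd A x v \<bullet> u"
  obtains \<phi> where "\<And>x. x \<in> V \<Longrightarrow> (\<phi> has_derivative (\<lambda>v. A x \<bullet> v)) (at x)"
proof (cases "V = {}")
  case True
  then show thesis using that[of "\<lambda>_. 0"] by blast
next
  case False
  then obtain x0 where x0: "x0 \<in> V" by blast
  define y where "y x t = x0 + t *\<^sub>R (x - x0)" for x and t :: real
  \<comment> \<open>This is the derivative in \<open>t\<close> of
    \<open>t *\<^sub>R A (y x t)\<close> and, by closedness, also the gradient in \<open>x\<close>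
    of the integrand of \<open>\<phi>\<close>. Integrating it over \<open>t\<close> therefore gives
    \<open>A x\<close> as the gradient of \<open>\<phi>\<close>.\<close>
  define h' where "h' x t = t *\<^sub>R fd A (y x t) (x - x0) + A (y x t)" for x and t :: real
  define \<phi> where "\<phi> x = integral (cbox 0 1) (\<lambda>t::real. A (y x t) \<bullet> (x - x0))" for x
  have yV: "y x t \<in> V" if "x \<in> V" "t \<in> cbox 0 1" for x t
    using convexD_alt[OF assms(2) x0 that(1), of t] that(2) by (simp add: y_def algebra_simps)
  have A': "(A has_derivative fd A z) (at z)" if "z \<in> V" for z
    using smooth_on_has_fd[OF assms(3) that] .
  have cont_y: "continuous_on (V \<times> cbox 0 1) (\<lambda>(x, t). y x t)"
    unfolding y_def by (auto simp: case_prod_unfold intro!: continuous_intros)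
  have im: "(\<lambda>(x, t). y x t) ` (V \<times> cbox 0 1) \<subseteq> V"
    using yV by auto
  have cA: "continuous_on (V \<times> cbox 0 1) (\<lambda>(x, t). A (y x t))"
    using continuous_on_compose2[OF smooth_on_continuous[OF assms(3)] cont_y im]
    by (simp add: case_prod_unfold)
  have cdA: "continuous_on (V \<times> cbox 0 1) (\<lambda>(x, t). fd A (y x t) b)" for b
    using continuous_on_compose2[OF smooth_on_continuous[OF smooth_on_fd_const[OF assms(3)]] cont_y im]
    by (simp add: case_prod_unfold)
  have ch: "continuous_on (V \<times> cbox 0 1) (\<lambda>(x, t). h' x t)"
  proof -
    have "continuous_on (V \<times> cbox 0 1) (\<lambda>(x, t). t *\<^sub>R (\<Sum>b\<in>Basis. ((x - x0) \<bullet> b) *\<^sub>R fd A (y x t) b) + A (y x t))"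
      using cA cdA by (auto simp: case_prod_unfold intro!: continuous_intros)
    moreover have "h' x t = t *\<^sub>R (\<Sum>b\<in>Basis. ((x - x0) \<bullet> b) *\<^sub>R fd A (y x t) b) + A (y x t)"
      if "x \<in> V" "t \<in> cbox 0 1" for x t
      using fd_eq_sum_Basis[OF smooth_on_differentiable[OF assms(3) yV[OF that]], of "x - x0"]
      by (simp add: h'_def)
    ultimately show ?thesis
      by (subst continuous_on_cong[OF refl, of _ _ "\<lambda>(x, t). t *\<^sub>R (\<Sum>b\<in>Basis. ((x - x0) \<bullet> b) *\<^sub>R fd A (y x t) b) + A (y x t)"])
        (auto simp: case_prod_unfold)
  qed
  have fx: "((\<lambda>x. A (y x t) \<bullet> (x - x0)) has_derivative blinfun_apply (blinfun_inner_left (h' x t))) (at x within V)"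
    if "x \<in> V" "t \<in> cbox 0 1" for x t
  proof -
    have "((\<lambda>x. y x t) has_derivative (\<lambda>v. t *\<^sub>R v)) (at x)"
      unfolding y_def by (auto intro!: derivative_eq_intros)
    then have "((\<lambda>x. A (y x t)) has_derivative (\<lambda>v. fd A (y x t) (t *\<^sub>R v))) (at x)"
      by (rule has_derivative_compose) (rule A'[OF yV[OF that]])
    then have "((\<lambda>x. A (y x t) \<bullet> (x - x0)) has_derivative
        (\<lambda>v. A (y x t) \<bullet> v + fd A (y x t) (t *\<^sub>R v) \<bullet> (x - x0))) (at x)"
      by (rule has_derivative_eq_rhs[OF has_derivative_inner]) (auto intro!: derivative_eq_intros)
    moreover have "fd A (y x t) (t *\<^sub>R v) \<bullet> (x - x0) = t * (fd A (y x t) (x - x0) \<bullet> v)" for v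
      using closed[OF yV[OF that], of "t *\<^sub>R v"] by simp
    ultimately have "((\<lambda>x. A (y x t) \<bullet> (x - x0)) has_derivative blinfun_apply (blinfun_inner_left (h' x t))) (at x)"
      by (simp add: h'_def inner_add_right inner_commute add.commute)
    then show ?thesis by (rule has_derivative_at_withinI)
  qed
  have int_h': "(h' x has_integral A x) (cbox 0 1)" if "x \<in> V" for x
  proof -
    have "((\<lambda>t. t *\<^sub>R A (y x t)) has_vector_derivative h' x t) (at t within {0..1})" if "t \<in> {0..1}" for t
    proof -
      have t: "t \<in> cbox 0 1" using that by simp
      have "(y x has_derivative (\<lambda>r. r *\<^sub>R (x - x0))) (at t)"
        unfolding y_def by (auto intro!: derivative_eq_intros)
      then have "((\<lambda>t. A (y x t)) has_derivative (\<lambda>r. fd A (y x t) (r *\<^sub>R (x - x0)))) (at t)"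
        by (rule has_derivative_compose) (rule A'[OF yV[OF \<open>x \<in> V\<close> t]])
      then have "((\<lambda>t. t *\<^sub>R A (y x t)) has_derivative
          (\<lambda>r. t *\<^sub>R fd A (y x t) (r *\<^sub>R (x - x0)) + r *\<^sub>R A (y x t))) (at t)"
        by (rule has_derivative_scaleR[OF has_derivative_ident])
      moreover have "(\<lambda>r. t *\<^sub>R fd A (y x t) (r *\<^sub>R (x - x0)) + r *\<^sub>R A (y x t)) = (\<lambda>r. r *\<^sub>R h' x t)"
        using linear_scale[OF fd_linear[OF smooth_on_differentiable[OF assms(3) yV[OF \<open>x \<in> V\<close> t]]]]
        by (simp add: h'_def scaleR_add_right mult.commute)
      ultimately have "((\<lambda>t. t *\<^sub>R A (y x t)) has_derivative (\<lambda>r. r *\<^sub>R h' x t)) (at t)" by simp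
      then show ?thesis
        unfolding has_vector_derivative_def by (rule has_derivative_at_withinI)
    qed
    from fundamental_theorem_of_calculus[OF _ this] show ?thesis
      by (simp add: y_def)
  qed
  have "(\<phi> has_derivative (\<lambda>v. A x \<bullet> v)) (at x)" if x: "x \<in> V" for x
  proof -
    have "((\<lambda>x. integral (cbox 0 1) (\<lambda>t. A (y x t) \<bullet> (x - x0))) has_derivative
        blinfun_apply (integral (cbox 0 1) (\<lambda>t. blinfun_inner_left (h' x t)))) (at x within V)"
    proof (rule leibniz_rule[OF fx _ _ x assms(2)])
      show "(\<lambda>t. A (y z t) \<bullet> (z - x0)) integrable_on cbox 0 1" if "z \<in> V" for z
      proof (rule integrable_continuous)
        have 1: "continuous_on (cbox 0 1) (\<lambda>t. (z, t))" by (intro continuous_intros)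
        have 2: "(\<lambda>t. (z, t)) ` cbox 0 1 \<subseteq> V \<times> cbox 0 1" using that by auto
        have "continuous_on (cbox 0 1) (\<lambda>t. A (y z t))"
          using continuous_on_compose2[OF cA 1 2] by simp
        then show "continuous_on (cbox 0 1) (\<lambda>t. A (y z t) \<bullet> (z - x0))"
          by (intro continuous_intros)
      qed
      show "continuous_on (V \<times> cbox 0 1) (\<lambda>(x, t). blinfun_inner_left (h' x t))"
        using ch bounded_linear.continuous_on[OF bounded_linear_blinfun_inner_left]
        by (auto simp: case_prod_unfold)
    qed auto
    moreover have "integral (cbox 0 1) (\<lambda>t. blinfun_inner_left (h' x t)) = blinfun_inner_left (A x)"
      using has_integral_linear[OF int_h'[OF x] bounded_linear_blinfun_inner_left]
      by (auto simp: o_def intro: integral_unique)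
    ultimately show ?thesis
      unfolding \<phi>_def using at_within_open[OF x assms(1)] by (simp add: inner_commute)
  qed
  then show thesis by (rule that)
qed

text \<open>The inverse function theorem with the target shrunk to a box, so that the first
  coordinate ranges over an interval and the slices where it is fixed are convex.\<close>

lemma local_coordinates_box:
  fixes \<Psi> :: "real^'n \<Rightarrow> real^'n"
  assumes "open V" "smooth_on V \<Psi>" "q0 \<in> V" "\<And>q. q \<in> V \<Longrightarrow> inj (fd \<Psi> q)"
  obtains a b \<psi> where "\<Psi> q0 \<in> box a b" "\<psi> ` box a b \<subseteq> V" "open (\<psi> ` box a b)"
    "homeomorphism (\<psi> ` box a b) (box a b) \<Psi> \<psi>" "\<psi> (\<Psi> q0) = q0"
    "\<And>y. y \<in> box a b \<Longrightarrow> (\<psi> has_derivative inv (fd \<Psi> (\<psi> y))) (at y)"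
proof -
  have lin: "linear (fd \<Psi> q)" if "q \<in> V" for q
    by (rule fd_linear[OF smooth_on_differentiable[OF assms(2) that]])
  define D where "D q = Blinfun (fd \<Psi> q)" for q
  have D: "blinfun_apply (D q) = fd \<Psi> q" if "q \<in> V" for q
    unfolding D_def using lin[OF that] by (simp add: bounded_linear_Blinfun_apply linear_linear)
  have contD: "continuous_on V D"
  proof (rule continuous_on_blinfun_componentwise)
    fix i :: "real^'n"
    show "continuous_on V (\<lambda>q. D q i)"
      using smooth_on_continuous[OF smooth_on_fd_const[OF assms(2), of i]] D
      by (simp cong: continuous_on_cong)
  qed
  have bij: "bij (fd \<Psi> q0)"
    using linear_injective_imp_surjective[OF lin[OF assms(3)] assms(4)[OF assms(3)]] assms(3,4)
    by (simp add: bij_def)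
  obtain h where h: "linear h" "h \<circ> fd \<Psi> q0 = id"
    using linear_injective_left_inverse[OF lin[OF assms(3)] assms(4)[OF assms(3)]] by blast
  have inv: "Blinfun h o\<^sub>L D q0 = id_blinfun"
  proof (rule blinfun_eqI)
    fix v
    have "blinfun_apply (Blinfun h) = h"
      using h(1) by (simp add: bounded_linear_Blinfun_apply linear_linear)
    then show "blinfun_apply (Blinfun h o\<^sub>L D q0) v = blinfun_apply id_blinfun v"
      using D[OF assms(3)] h(2) by (simp add: pointfree_idE)
  qed
  have der: "(\<Psi> has_derivative blinfun_apply (D q)) (at q)" if "q \<in> V" for q
    using smooth_on_has_fd[OF assms(2) that] D[OF that] by simp
  obtain U' W g g' where W: "open U'" "U' \<subseteq> V" "q0 \<in> U'" "open W" "\<Psi> q0 \<in> W" "homeomorphism U' W \<Psi> g"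
    "\<And>y. y \<in> W \<Longrightarrow> (g has_derivative (g' y)) (at y)"
    "\<And>y. y \<in> W \<Longrightarrow> g' y = inv (blinfun_apply (D (g y)))"
    by (rule inverse_function_theorem[OF assms(1) der contD assms(3) inv]) blast+
  obtain a b where ab: "\<Psi> q0 \<in> box a b" "box a b \<subseteq> W"
    using open_contains_box[OF W(4,5)] by (metis mem_box(1) order.refl)
  have hom: "homeomorphism (g ` box a b) (box a b) \<Psi> g"
  proof (rule homeomorphismI)
    have sub: "g ` box a b \<subseteq> U'" using W(6) ab(2) by (auto simp: homeomorphism_def)
    show "continuous_on (g ` box a b) \<Psi>" "continuous_on (box a b) g"
      using W(6) ab(2) sub by (meson homeomorphism_def continuous_on_subset)+
  qed (use W(6) ab(2) in \<open>auto simp: homeomorphism_def subset_iff\<close>)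
  have "openin (top_of_set U') (U' \<inter> \<Psi> -` box a b)"
    using W(6) by (intro continuous_openin_preimage[of U' \<Psi> UNIV]) (auto simp: homeomorphism_def)
  moreover have "U' \<inter> \<Psi> -` box a b = g ` box a b"
    using W(6) ab(2) unfolding homeomorphism_def by force
  ultimately have op: "open (g ` box a b)"
    using W(1) by (metis openin_open_trans)
  have sub: "g ` box a b \<subseteq> U'" using W(6) ab(2) by (auto simp: homeomorphism_def)
  show thesis
  proof
    show "\<Psi> q0 \<in> box a b" by (rule ab)
    show "g ` box a b \<subseteq> V" using sub W(2) by blast
    show "g (\<Psi> q0) = q0" using W(3,6) by (auto simp: homeomorphism_def)
    fix y assume "y \<in> box a b"
    then show "(g has_derivative inv (fd \<Psi> (g y))) (at y)"
      using W(7,8)[of y] D sub ab(2) W(2) by (metis image_subset_iff subset_iff)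
  qed (use op hom in auto)
qed

section \<open>Linear algebra of the Lorentz form on R^5\<close>

lemma UNIV_5: "(UNIV :: 5 set) = {1, 2, 3, 4, 5}"
proof -
  have "x = 1 \<or> x = 2 \<or> x = 3 \<or> x = 4 \<or> x = 5" for x :: 5
  proof (induct x)
    case (of_int z)
    then have "z = 0 \<or> z = 1 \<or> z = 2 \<or> z = 3 \<or> z = 4" by fastforce
    then show ?case by auto
  qed
  then show ?thesis by auto
qed

lemma sum_5: "sum f (UNIV :: 5 set) = f 1 + f 2 + f 3 + f 4 + f 5"
  unfolding UNIV_5 by (simp add: ac_simps)

lemma forall_5: "(\<forall>i::5. P i) \<longleftrightarrow> P 1 \<and> P 2 \<and> P 3 \<and> P 4 \<and> P 5"
  using UNIV_5 by (metis UNIV_I insertE singletonD)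

lemma lorentz_5:
  "lorentz (x::real^5) y = - (x $ 1 * y $ 1) + x $ 2 * y $ 2 + x $ 3 * y $ 3 + x $ 4 * y $ 4 + x $ 5 * y $ 5"
proof -
  have "(UNIV :: 5 set) - {1} = {2, 3, 4, 5}" unfolding UNIV_5 by auto
  then show ?thesis by (simp add: lorentz_def)
qed

lemma lorentz_3:
  "lorentz (x::real^3) y = - (x $ 1 * y $ 1) + x $ 2 * y $ 2 + x $ 3 * y $ 3"
proof -
  have "(UNIV :: 3 set) - {1} = {2, 3}" unfolding UNIV_3 by auto
  then show ?thesis by (simp add: lorentz_def)
qed

interpretation lorentz: bounded_bilinear "lorentz :: real^5 \<Rightarrow> real^5 \<Rightarrow> real"
  by (subst bilinear_conv_bounded_bilinear[symmetric])
    (auto simp: bilinear_def lorentz_5 algebra_simps intro!: linearI)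

lemma lorentz_commute: "lorentz (x::real^5) y = lorentz y x"
  by (simp add: lorentz_5 mult.commute)

lemmas lorentz_simps = lorentz.add_left lorentz.add_right lorentz.diff_left lorentz.diff_right
  lorentz.scaleR_left lorentz.scaleR_right lorentz.minus_left lorentz.minus_right
  lorentz.zero_left lorentz.zero_right

lemma smooth_on_lorentz:
  fixes f g :: "'a::euclidean_space \<Rightarrow> real^5"
  shows "open U \<Longrightarrow> smooth_on U f \<Longrightarrow> smooth_on U g \<Longrightarrow> smooth_on U (\<lambda>x. lorentz (f x) (g x))"
  by (rule smooth_on_bilinear[OF lorentz.bounded_bilinear_axioms])

text \<open>Such bases are the images of the standard basis under Lorentz isometries; every
  congruence below is given by one.\<close>

definition lorentz_orthonormal :: "(5 \<Rightarrow> real^5) \<Rightarrow> bool" where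
  "lorentz_orthonormal b \<longleftrightarrow>
     (\<forall>i j. lorentz (b i) (b j) = (if i = j then (if i = 1 then -1 else 1) else 0))"

lemma lorentz_orthonormal_combination:
  assumes "lorentz_orthonormal b"
  shows "lorentz (\<Sum>i\<in>UNIV. x $ i *\<^sub>R b i) (\<Sum>i\<in>UNIV. y $ i *\<^sub>R b i) = lorentz x y"
    "lorentz (\<Sum>i\<in>UNIV. x $ i *\<^sub>R b i) (b j) = (if j = 1 then - (x $ 1) else x $ j)"
proof -
  have bb: "lorentz (b i) (b j) = (if i = j then (if i = 1 then -1 else 1) else 0)" for i j
    using assms by (auto simp: lorentz_orthonormal_def)
  show "lorentz (\<Sum>i\<in>UNIV. x $ i *\<^sub>R b i) (\<Sum>i\<in>UNIV. y $ i *\<^sub>R b i) = lorentz x y"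
    by (simp add: sum_5 lorentz_simps lorentz_5[of x y] bb)
  have "\<forall>j. lorentz (\<Sum>i\<in>UNIV. x $ i *\<^sub>R b i) (b j) = (if j = 1 then - (x $ 1) else x $ j)"
    unfolding forall_5 by (simp add: sum_5 lorentz_simps bb)
  then show "lorentz (\<Sum>i\<in>UNIV. x $ i *\<^sub>R b i) (b j) = (if j = 1 then - (x $ 1) else x $ j)" ..
qed

lemma lorentz_orthonormal_isometry:
  assumes "lorentz_orthonormal b"
  shows "lorentz_isometry (\<lambda>x. \<Sum>i\<in>UNIV. x $ i *\<^sub>R b i)"
  unfolding lorentz_isometry_def
proof (intro conjI allI linearI)
  show "lorentz (\<Sum>i\<in>UNIV. x $ i *\<^sub>R b i) (\<Sum>i\<in>UNIV. y $ i *\<^sub>R b i) = lorentz x y" for x y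
    by (rule lorentz_orthonormal_combination(1)[OF assms])
qed (simp_all add: sum.distrib scaleR_add_left scaleR_sum_right)

lemma lorentz_nondegenerate: "(\<And>y. lorentz (x::real^5) y = 0) \<Longrightarrow> x = 0"
proof -
  assume *: "\<And>y. lorentz x y = 0"
  have "\<forall>i. x $ i = 0"
    using *[of "axis 1 1"] *[of "axis 2 1"] *[of "axis 3 1"] *[of "axis 4 1"] *[of "axis 5 1"]
    unfolding forall_5 by (simp add: lorentz_5 axis_def)
  then show "x = 0" by (simp add: vec_eq_iff)
qed

text \<open>The map taking coefficients to combinations preserves the form, hence is injective by
  nondegeneracy and surjective by dimension.\<close>

lemma lorentz_orthonormal_expansion:
  assumes "lorentz_orthonormal b"
  shows "v = (\<Sum>i\<in>UNIV. ((if i = 1 then -1 else 1) * lorentz v (b i)) *\<^sub>R b i)"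
proof -
  let ?B = "\<lambda>x::real^5. \<Sum>i\<in>UNIV. x $ i *\<^sub>R b i"
  have lin: "linear ?B"
    using lorentz_orthonormal_isometry[OF assms] by (simp add: lorentz_isometry_def)
  have "x = 0" if "?B x = 0" for x
  proof (rule lorentz_nondegenerate)
    show "lorentz x y = 0" for y
      using lorentz_orthonormal_combination(1)[OF assms, of x y] unfolding that by (simp add: lorentz_simps)
  qed
  then have "inj ?B" using linear_injective_0[OF lin] by blast
  then have "surj ?B" using linear_injective_imp_surjective[OF lin] by simp
  then obtain x where x: "v = ?B x" by (rule surjE)
  have c: "(if i = 1 then -1 else 1) * lorentz v (b i) = x $ i" for i
    unfolding x lorentz_orthonormal_combination(2)[OF assms, of x i] by simp
  show ?thesis unfolding c by (rule x)
qed

lemma lorentz_orthonormal_eqI: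
  assumes "lorentz_orthonormal b" "\<And>i. lorentz v (b i) = lorentz w (b i)"
  shows "v = w"
proof -
  have "v = (\<Sum>i\<in>UNIV. ((if i = 1 then -1 else 1) * lorentz w (b i)) *\<^sub>R b i)"
    using lorentz_orthonormal_expansion[OF assms(1), of v] unfolding assms(2) .
  also have "\<dots> = w"
    by (rule lorentz_orthonormal_expansion[OF assms(1), symmetric])
  finally show ?thesis .
qed

text \<open>The complement of a timelike vector is positive definite: \<open>v $ 1\<close> is
  bounded by applying Cauchy-Schwarz to the spatial parts, here proved through the Lagrange
  identity. This makes the induced metric Riemannian.\<close>

lemma lorentz_spacelike:
  fixes f v :: "real^5"
  assumes "lorentz f f = -1" "lorentz v f = 0" "v \<noteq> 0"
  shows "lorentz v v > 0"
proof -
  define S where "S x y = x $ 2 * y $ 2 + x $ 3 * y $ 3 + x $ 4 * y $ 4 + x $ 5 * y $ 5" for x y :: "real^5"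
  have f: "S f f = (f $ 1)\<^sup>2 - 1" and v: "S v f = v $ 1 * f $ 1" and L: "lorentz v v = S v v - (v $ 1)\<^sup>2"
    using assms(1,2) unfolding S_def lorentz_5 power2_eq_square by linarith+
  have "S v v * S f f - (S v f)\<^sup>2 =
      (v$2*f$3 - v$3*f$2)\<^sup>2 + (v$2*f$4 - v$4*f$2)\<^sup>2 + (v$2*f$5 - v$5*f$2)\<^sup>2
      + (v$3*f$4 - v$4*f$3)\<^sup>2 + (v$3*f$5 - v$5*f$3)\<^sup>2 + (v$4*f$5 - v$5*f$4)\<^sup>2"
    unfolding S_def by (simp add: power2_eq_square algebra_simps)
  then have CS: "(S v f)\<^sup>2 \<le> S v v * S f f" by (smt (verit) zero_le_power2)
  have "S f f \<ge> 0" "S v v \<ge> 0" unfolding S_def by simp_all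
  have "(v $ 1)\<^sup>2 * (f $ 1)\<^sup>2 \<le> S v v * ((f $ 1)\<^sup>2 - 1)"
    using CS unfolding f v by (simp add: power_mult_distrib)
  then have *: "S v v \<le> lorentz v v * (f $ 1)\<^sup>2" unfolding L by (simp add: algebra_simps)
  show ?thesis
  proof (cases "S v v = 0")
    case False
    with \<open>S v v \<ge> 0\<close> * have "0 < lorentz v v * (f $ 1)\<^sup>2" by linarith
    then show ?thesis by (simp add: zero_less_mult_iff)
  next
    case True
    then have "v $ 2 = 0" "v $ 3 = 0" "v $ 4 = 0" "v $ 5 = 0"
      unfolding S_def by (smt (verit) not_square_less_zero mult_eq_0_iff)+
    moreover have "f $ 1 \<noteq> 0" using f \<open>S f f \<ge> 0\<close> by auto
    then have "v $ 1 = 0" using v True calculation by (simp add: S_def)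
    ultimately have "v = 0" by (simp add: vec_eq_iff forall_5)
    with assms(3) show ?thesis by simp
  qed
qed

section \<open>Principal frames\<close>

text \<open>Splits off the derivative of the direction field. The other term is a Hessian, symmetric
  in its directions, so it cancels in commutators.\<close>

lemma fd_fd_field:
  fixes g :: "'a::euclidean_space \<Rightarrow> 'b::real_normed_vector" and w :: "'a \<Rightarrow> 'a"
  assumes "open U" "smooth_on U g" "smooth_on U w" "x \<in> U"
  shows "fd (\<lambda>y. fd g y (w y)) x v = fd (\<lambda>y. fd g y (w x)) x v + fd g x (fd w x v)"
proof -
  have *: "fd (\<lambda>y. fd g y (w y)) x v = (\<Sum>b\<in>Basis. (w x \<bullet> b) *\<^sub>R fd (\<lambda>y. fd g y b) x v) + fd g x (fd w x v)"
    if "smooth_on U w" for w :: "'a \<Rightarrow> 'a"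
  proof -
    have "fd (\<lambda>y. fd g y (w y)) x = fd (\<lambda>y. \<Sum>b\<in>Basis. (w y \<bullet> b) *\<^sub>R fd g y b) x"
      by (intro fd_cong(2)[OF assms(1,4)] fd_eq_sum_Basis smooth_on_differentiable[OF assms(2)])
    also have "\<dots> = (\<lambda>v. \<Sum>b\<in>Basis. (w x \<bullet> b) *\<^sub>R fd (\<lambda>y. fd g y b) x v + (fd w x v \<bullet> b) *\<^sub>R fd g x b)"
      by (intro fd_eqI has_derivative_sum has_derivative_scaleR has_derivative_inner_left
          smooth_on_has_fd[OF that assms(4)] smooth_on_has_fd[OF smooth_on_fd_const[OF assms(2)] assms(4)])
    finally show ?thesis
      using fd_eq_sum_Basis[OF smooth_on_differentiable[OF assms(2,4)], of "fd w x v"]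
      by (simp add: sum.distrib)
  qed
  from *[OF assms(3)] *[OF smooth_on_const[of U "w x"]]
    linear_0[OF fd_linear[OF smooth_on_differentiable[OF assms(2,4)]]]
  show ?thesis by simp
qed

text \<open>What the frame computations use of a biconservative hypersurface. \<open>k_sum\<close>
  is the trace relation for \<open>k 1 = - 3H/2\<close>, the last three hypotheses say that the
  gradient of \<open>H\<close> is a nonzero multiple of \<open>e 1\<close>, and convexity serves the
  Poincare lemma and the constancy arguments.\<close>

locale principal_frame =
  fixes V :: "(real^3) set" and F N :: "real^3 \<Rightarrow> real^5"
    and e :: "3 \<Rightarrow> real^3 \<Rightarrow> real^3" and k :: "3 \<Rightarrow> real^3 \<Rightarrow> real"
  assumes open_V: "open V" and convex_V: "convex V"
    and smooth_F: "smooth_on V F" and smooth_N: "smooth_on V N"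
    and smooth_e: "\<And>i. smooth_on V (e i)" and smooth_k: "\<And>i. smooth_on V (k i)"
    and FF: "\<And>x. x \<in> V \<Longrightarrow> lorentz (F x) (F x) = -1"
    and NN: "\<And>x. x \<in> V \<Longrightarrow> lorentz (N x) (N x) = 1"
    and FN: "\<And>x. x \<in> V \<Longrightarrow> lorentz (F x) (N x) = 0"
    and frame_orthonormal: "\<And>x i j. x \<in> V \<Longrightarrow>
      lorentz (fd F x (e i x)) (fd F x (e j x)) = (if i = j then 1 else 0)"
    and frame_normal: "\<And>x i. x \<in> V \<Longrightarrow> lorentz (fd F x (e i x)) (N x) = 0"
    and frame_principal: "\<And>x i. x \<in> V \<Longrightarrow> fd N x (e i x) = - k i x *\<^sub>R fd F x (e i x)"
    and k_distinct: "\<And>x i j. x \<in> V \<Longrightarrow> i \<noteq> j \<Longrightarrow> k i x \<noteq> k j x"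
    and k_sum: "\<And>x. x \<in> V \<Longrightarrow> k 2 x + k 3 x = -3 * k 1 x"
    and k1_2: "\<And>x. x \<in> V \<Longrightarrow> fd (k 1) x (e 2 x) = 0"
    and k1_3: "\<And>x. x \<in> V \<Longrightarrow> fd (k 1) x (e 3 x) = 0"
    and k1_1: "\<And>x. x \<in> V \<Longrightarrow> fd (k 1) x (e 1 x) \<noteq> 0"
begin

definition D :: "3 \<Rightarrow> (real^3 \<Rightarrow> 'b::real_normed_vector) \<Rightarrow> real^3 \<Rightarrow> 'b" where
  "D i g x = fd g x (e i x)"

abbreviation E :: "3 \<Rightarrow> real^3 \<Rightarrow> real^5" where "E i \<equiv> D i F"

text \<open>The connection coefficients of the frame: as \<open>E l\<close> is tangent, the flat
  derivative gives the same product as the Levi-Civita connection of the hypersurface.\<close>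

definition \<omega> :: "3 \<Rightarrow> 3 \<Rightarrow> 3 \<Rightarrow> real^3 \<Rightarrow> real" where
  "\<omega> i j l x = lorentz (D i (E j) x) (E l x)"

lemma smooth_D: "smooth_on V g \<Longrightarrow> smooth_on V (D i g)"
  unfolding D_def[abs_def] by (intro smooth_on_fd open_V smooth_e)

lemmas smooth_rules = smooth_on_add[OF open_V] smooth_on_diff[OF open_V] smooth_on_minus[OF open_V]
  smooth_on_mult[OF open_V] smooth_on_scaleR[OF open_V] smooth_on_lorentz[OF open_V]
  smooth_on_power[OF open_V] smooth_on_const smooth_D smooth_F smooth_N smooth_k

lemma smooth_\<omega>: "smooth_on V (\<omega> i j l)"
  unfolding \<omega>_def[abs_def] by (intro smooth_rules)

lemma D_cong_open:
  assumes "open A" "x \<in> A" "\<And>y. y \<in> A \<Longrightarrow> f y = g y"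
  shows "D i f x = D i g x"
  unfolding D_def using fd_cong(2)[OF assms] by simp

lemma D_cong: "x \<in> V \<Longrightarrow> (\<And>y. y \<in> V \<Longrightarrow> f y = g y) \<Longrightarrow> D i f x = D i g x"
  by (rule D_cong_open[OF open_V])

lemma D_const: "D i (\<lambda>_. c) x = 0"
  by (simp add: D_def)

lemma D_eq_0: "x \<in> V \<Longrightarrow> (\<And>y. y \<in> V \<Longrightarrow> f y = c) \<Longrightarrow> D i f x = 0"
  using D_cong[of x f "\<lambda>_. c" i] by (simp add: D_const)

lemma has_D: "smooth_on V g \<Longrightarrow> x \<in> V \<Longrightarrow> (g has_derivative fd g x) (at x)"
  by (rule smooth_on_has_fd)

lemma D_add: "smooth_on V f \<Longrightarrow> smooth_on V g \<Longrightarrow> x \<in> V \<Longrightarrow> D i (\<lambda>x. f x + g x) x = D i f x + D i g x"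
  unfolding D_def by (subst fd_eqI[OF has_derivative_add[OF has_D has_D]]) auto

lemma D_diff: "smooth_on V f \<Longrightarrow> smooth_on V g \<Longrightarrow> x \<in> V \<Longrightarrow> D i (\<lambda>x. f x - g x) x = D i f x - D i g x"
  unfolding D_def by (subst fd_eqI[OF has_derivative_diff[OF has_D has_D]]) auto

lemma D_minus: "smooth_on V f \<Longrightarrow> x \<in> V \<Longrightarrow> D i (\<lambda>x. - f x) x = - D i f x"
  unfolding D_def by (subst fd_eqI[OF has_derivative_minus[OF has_D]]) auto

lemma D_bilinear:
  "bounded_bilinear B \<Longrightarrow> smooth_on V f \<Longrightarrow> smooth_on V g \<Longrightarrow> x \<in> V \<Longrightarrow>
    D i (\<lambda>x. B (f x) (g x)) x = B (f x) (D i g x) + B (D i f x) (g x)"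
  unfolding D_def by (subst fd_eqI[OF bounded_bilinear.FDERIV[OF _ has_D has_D]]) auto

lemmas D_scaleR = D_bilinear[OF bounded_bilinear_scaleR]
lemmas D_mult = D_bilinear[OF bounded_bilinear_mult]
lemmas D_lorentz = D_bilinear[OF lorentz.bounded_bilinear_axioms]

lemma D_power2:
  fixes f :: "real^3 \<Rightarrow> real"
  shows "smooth_on V f \<Longrightarrow> x \<in> V \<Longrightarrow> D i (\<lambda>x. (f x)\<^sup>2) x = 2 * f x * D i f x"
  using D_mult[of f f x i] by (simp add: power2_eq_square)

lemmas D_rules = D_add D_diff D_minus D_mult D_scaleR D_lorentz D_power2 D_const

lemma EE: "x \<in> V \<Longrightarrow> lorentz (E i x) (E j x) = (if i = j then 1 else 0)"
  using frame_orthonormal by (simp add: D_def)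

lemma EN: "x \<in> V \<Longrightarrow> lorentz (E i x) (N x) = 0"
  using frame_normal by (simp add: D_def)

lemma DN: "x \<in> V \<Longrightarrow> D i N x = - k i x *\<^sub>R E i x"
  using frame_principal by (simp add: D_def)

lemma EF:
  assumes "x \<in> V"
  shows "lorentz (E i x) (F x) = 0"
proof -
  have "D i (\<lambda>x. lorentz (F x) (F x)) x = 0"
    using assms FF by (rule D_eq_0)
  then show ?thesis
    using assms by (simp add: D_lorentz smooth_F lorentz_commute)
qed

lemma ambient_frame:
  assumes "x \<in> V"
  shows "lorentz_orthonormal (\<lambda>i. if i = 1 then F x else if i = 2 then N x else if i = 3 then E 1 x
    else if i = 4 then E 2 x else E 3 x)"
proof -
  note E = EE[OF assms] EN[OF assms] EF[OF assms] FF[OF assms] NN[OF assms] FN[OF assms]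
  have E': "lorentz (N x) (E i x) = 0" "lorentz (F x) (E i x) = 0" "lorentz (N x) (F x) = 0" for i
    using E(2)[of i] E(3)[of i] E(6) by (simp_all only: lorentz_commute)
  show ?thesis
    unfolding lorentz_orthonormal_def forall_5 by (simp add: E E')
qed

lemma decomposition:
  assumes "x \<in> V"
  shows "v = - lorentz v (F x) *\<^sub>R F x + lorentz v (N x) *\<^sub>R N x + (\<Sum>i\<in>UNIV. lorentz v (E i x) *\<^sub>R E i x)"
  using lorentz_orthonormal_expansion[OF ambient_frame[OF assms], of v] unfolding sum_5 sum_3
  by (simp add: add.assoc)

lemma frame_basis:
  assumes "x \<in> V"
  shows "w = (\<Sum>i\<in>UNIV. lorentz (fd F x w) (E i x) *\<^sub>R e i x)"
proof -
  let ?B = "\<lambda>c::real^3. \<Sum>i\<in>UNIV. c $ i *\<^sub>R e i x"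
  have linF: "linear (fd F x)"
    by (rule fd_linear[OF smooth_on_differentiable[OF smooth_F assms]])
  have lin: "linear ?B"
    by (intro linearI) (simp_all add: sum.distrib scaleR_add_left scaleR_sum_right)
  have "fd F x (?B c) = (\<Sum>i\<in>UNIV. c $ i *\<^sub>R E i x)" for c
    by (simp add: linear_sum[OF linF] linear_scale[OF linF] D_def)
  then have c: "lorentz (fd F x (?B c)) (E i x) = c $ i" for c i
    by (simp add: EE[OF assms] lorentz.sum_left lorentz_simps if_distrib cong: if_cong)
  have "c = 0" if "?B c = 0" for c
    unfolding vec_eq_iff using c[of c] linear_0[OF linF] that by (simp add: lorentz_simps)
  then have "inj ?B" using linear_injective_0[OF lin] by blast
  then have "surj ?B" using linear_injective_imp_surjective[OF lin] by simp
  then obtain c' where w: "w = ?B c'" by (rule surjE)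
  show ?thesis unfolding w c ..
qed

lemma fd_frame:
  assumes "smooth_on V g" "x \<in> V"
  shows "fd g x w = (\<Sum>i\<in>UNIV. lorentz (fd F x w) (E i x) *\<^sub>R D i g x)"
proof -
  have lin: "linear (fd g x)"
    by (rule fd_linear[OF smooth_on_differentiable[OF assms]])
  show ?thesis
    by (subst frame_basis[OF assms(2), of w])
      (simp add: linear_sum[OF lin] linear_scale[OF lin] D_def)
qed

text \<open>The difference is the derivative along the bracket of \<open>e i\<close> and
  \<open>e j\<close>; taking \<open>g = F\<close> identifies the components of the bracket, which is
  torsion-freeness.\<close>

lemma commutator:
  fixes g :: "real^3 \<Rightarrow> 'b::euclidean_space"
  assumes "smooth_on V g" "x \<in> V"
  shows "D i (D j g) x - D j (D i g) x = (\<Sum>l\<in>UNIV. (\<omega> i j l x - \<omega> j i l x) *\<^sub>R D l g x)"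
proof -
  define w where "w = fd (e j) x (e i x) - fd (e i) x (e j x)"
  have *: "D i (D j g) x - D j (D i g) x = fd g x w" if "smooth_on V g" for g :: "real^3 \<Rightarrow> 'c::euclidean_space"
    unfolding D_def w_def
    using fd_fd_field[OF open_V that smooth_e assms(2)] fd_fd_sym[OF open_V that assms(2)]
      linear_diff[OF fd_linear[OF smooth_on_differentiable[OF that assms(2)]]]
    by simp
  have "lorentz (fd F x w) (E l x) = \<omega> i j l x - \<omega> j i l x" for l
    by (simp add: *[OF smooth_F, symmetric] \<omega>_def lorentz_simps)
  then show ?thesis
    unfolding *[OF assms(1)] by (subst fd_frame[OF assms]) simp
qed

lemma \<omega>_skew:
  assumes "x \<in> V"
  shows "\<omega> i j l x = - \<omega> i l j x"
proof -
  have "D i (\<lambda>x. lorentz (E j x) (E l x)) x = 0"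
    using assms EE by (rule D_eq_0)
  then show ?thesis
    using assms by (simp add: D_lorentz smooth_rules \<omega>_def lorentz_commute add_eq_0_iff)
qed

lemma DE:
  assumes "x \<in> V"
  shows "D i (E j) x = (if i = j then k i x *\<^sub>R N x + F x else 0) + (\<Sum>l\<in>UNIV. \<omega> i j l x *\<^sub>R E l x)"
proof -
  have "D i (\<lambda>x. lorentz (E j x) (F x)) x = 0" "D i (\<lambda>x. lorentz (E j x) (N x)) x = 0"
    using assms EF EN by (intro D_eq_0; simp)+
  then have "lorentz (D i (E j) x) (F x) = (if i = j then -1 else 0)"
    "lorentz (D i (E j) x) (N x) = (if i = j then k i x else 0)"
    using assms by (auto simp: D_lorentz smooth_rules DN lorentz_simps EE split: if_splits)
  then show ?thesis
    by (subst decomposition[OF assms]) (simp add: \<omega>_def)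
qed

text \<open>The \<open>E l\<close>-component of the commutator formula for \<open>N\<close>, with
  the derivatives of \<open>N\<close> replaced by \<open>- k i *\<^sub>R E i\<close>.\<close>

lemma codazzi:
  assumes "x \<in> V"
  shows "(k l x - k j x) * \<omega> i j l x - (k l x - k i x) * \<omega> j i l x =
    (if j = l then D i (k j) x else 0) - (if i = l then D j (k i) x else 0)"
proof -
  have D2: "D i (D j N) x = - (D i (k j) x *\<^sub>R E j x) - k j x *\<^sub>R D i (E j) x" for i j
  proof -
    have "D i (D j N) x = D i (\<lambda>x. - k j x *\<^sub>R E j x) x"
      using DN by (intro D_cong[OF assms])
    then show ?thesis
      using assms by (simp add: D_scaleR D_minus smooth_rules)
  qed
  have "lorentz (D i (D j N) x - D j (D i N) x) (E l x) =
      (\<Sum>m\<in>UNIV. (\<omega> i j m x - \<omega> j i m x) * lorentz (D m N x) (E l x))"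
    by (simp add: commutator[OF smooth_N assms] lorentz.sum_left lorentz_simps)
  moreover have "lorentz (D m N x) (E l x) = (if m = l then - k l x else 0)" for m
    using assms by (simp add: DN EE lorentz_simps)
  ultimately have "lorentz (D i (D j N) x - D j (D i N) x) (E l x) = - (\<omega> i j l x - \<omega> j i l x) * k l x"
    by (simp add: if_distrib cong: if_cong) (simp add: algebra_simps)
  then show ?thesis
    unfolding D2 using assms by (auto simp: lorentz_simps EE \<omega>_def[symmetric] algebra_simps)
qed

section \<open>The surviving connection coefficients and the structure equations\<close>

definition "p = \<omega> 2 1 2"
definition "q = \<omega> 3 1 3"
text \<open>Up to sign, \<open>p\<close> and \<open>q\<close> are the principal curvatures of the
  level surfaces of \<open>k 1\<close> in the hypersurface, while \<open>a\<close> and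
  \<open>b\<close> are geodesic curvatures of the \<open>e 2\<close>- and \<open>e 3\<close>-curves
  inside these surfaces.\<close>

definition "a = \<omega> 2 2 3"
definition "b = \<omega> 3 3 2"

lemma smooth_coeffs: "smooth_on V p" "smooth_on V q" "smooth_on V a" "smooth_on V b"
  by (simp_all add: p_def q_def a_def b_def smooth_\<omega>)

context
  fixes x assumes x: "x \<in> V"
begin

lemma k_neq: "k 1 x \<noteq> k 2 x" "k 1 x \<noteq> k 3 x" "k 2 x \<noteq> k 3 x"
  using k_distinct[OF x] by simp_all

lemma Dk1: "D 2 (k 1) x = 0" "D 3 (k 1) x = 0" "D 1 (k 1) x \<noteq> 0"
  using k1_1 k1_2 k1_3 x by (simp_all add: D_def)

lemma \<omega>_diag: "\<omega> i j j x = 0"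
  using \<omega>_skew[OF x, of i j j] by simp

text \<open>Since \<open>k 1\<close> is constant along \<open>e 2\<close> and \<open>e 3\<close> but
  not along \<open>e 1\<close>, the bracket of \<open>e 2\<close> and \<open>e 3\<close> has no
  \<open>e 1\<close>-component. Codazzi relates the same two coefficients with the different weights
  \<open>k 1 - k 3\<close> and \<open>k 1 - k 2\<close>, so both vanish.\<close>

lemma \<omega>_mixed:
  "\<omega> 2 3 1 x = 0" "\<omega> 3 2 1 x = 0" "\<omega> 2 1 3 x = 0" "\<omega> 3 1 2 x = 0" "\<omega> 1 2 3 x = 0" "\<omega> 1 3 2 x = 0"
proof -
  have "D 2 (D 3 (k 1)) x = 0" "D 3 (D 2 (k 1)) x = 0"
    using k1_2 k1_3 by (intro D_eq_0[OF x]; simp add: D_def)+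
  with commutator[OF smooth_k x, of 2 3 1] have "\<omega> 2 3 1 x = \<omega> 3 2 1 x"
    using Dk1 by (simp add: sum_3)
  moreover have "(k 1 x - k 3 x) * \<omega> 2 3 1 x = (k 1 x - k 2 x) * \<omega> 3 2 1 x"
    using codazzi[OF x, of 1 3 2] by simp
  ultimately have "(k 2 x - k 3 x) * \<omega> 3 2 1 x = 0"
    by (simp add: algebra_simps)
  with k_neq show 321: "\<omega> 3 2 1 x = 0" by simp
  with \<open>\<omega> 2 3 1 x = \<omega> 3 2 1 x\<close> show 231: "\<omega> 2 3 1 x = 0" by simp
  show 213: "\<omega> 2 1 3 x = 0" and 312: "\<omega> 3 1 2 x = 0"
    using \<omega>_skew[OF x, of 2 1 3] \<omega>_skew[OF x, of 3 1 2] 231 321 by simp_all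
  have "(k 3 x - k 2 x) * \<omega> 1 2 3 x = 0"
    using codazzi[OF x, of 3 2 1] 213 by simp
  with k_neq show "\<omega> 1 2 3 x = 0" by simp
  with \<omega>_skew[OF x, of 1 3 2] show "\<omega> 1 3 2 x = 0" by simp
qed

text \<open>By Codazzi these coefficients are multiples of the derivatives of \<open>k 1\<close>
  along \<open>e 2\<close> and \<open>e 3\<close>; so the \<open>e 1\<close>-curves are geodesics of
  the hypersurface.\<close>

lemma \<omega>_geodesic: "\<omega> 1 1 2 x = 0" "\<omega> 1 1 3 x = 0" "\<omega> 1 2 1 x = 0" "\<omega> 1 3 1 x = 0"
proof -
  have "(k 1 x - k 2 x) * \<omega> 1 2 1 x = 0" "(k 1 x - k 3 x) * \<omega> 1 3 1 x = 0"
    using codazzi[OF x, of 1 2 1] codazzi[OF x, of 1 3 1] Dk1 by simp_all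
  with k_neq show "\<omega> 1 2 1 x = 0" "\<omega> 1 3 1 x = 0" by simp_all
  with \<omega>_skew[OF x, of 1 1 2] \<omega>_skew[OF x, of 1 1 3] show "\<omega> 1 1 2 x = 0" "\<omega> 1 1 3 x = 0" by simp_all
qed

lemma \<omega>_values:
  "\<omega> 2 1 2 x = p x" "\<omega> 2 2 1 x = - p x" "\<omega> 3 1 3 x = q x" "\<omega> 3 3 1 x = - q x"
  "\<omega> 2 2 3 x = a x" "\<omega> 2 3 2 x = - a x" "\<omega> 3 3 2 x = b x" "\<omega> 3 2 3 x = - b x"
  using \<omega>_skew[OF x, of 2 2 1] \<omega>_skew[OF x, of 3 3 1] \<omega>_skew[OF x, of 2 3 2] \<omega>_skew[OF x, of 3 2 3]
  by (simp_all add: p_def q_def a_def b_def)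

lemmas \<omega>_table = \<omega>_diag \<omega>_mixed \<omega>_geodesic \<omega>_values

lemma DE_table:
  "D 1 (E 1) x = k 1 x *\<^sub>R N x + F x" "D 1 (E 2) x = 0" "D 1 (E 3) x = 0"
  "D 2 (E 1) x = p x *\<^sub>R E 2 x"
  "D 2 (E 2) x = - p x *\<^sub>R E 1 x + a x *\<^sub>R E 3 x + k 2 x *\<^sub>R N x + F x"
  "D 2 (E 3) x = - a x *\<^sub>R E 2 x"
  "D 3 (E 1) x = q x *\<^sub>R E 3 x" "D 3 (E 2) x = - b x *\<^sub>R E 3 x"
  "D 3 (E 3) x = - q x *\<^sub>R E 1 x + b x *\<^sub>R E 2 x + k 3 x *\<^sub>R N x + F x"
  by (simp_all add: DE[OF x] sum_3 \<omega>_table algebra_simps)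

lemma Dk_table:
  "D 1 (k 2) x = p x * (k 1 x - k 2 x)" "D 1 (k 3) x = q x * (k 1 x - k 3 x)"
  "D 3 (k 2) x = a x * (k 2 x - k 3 x)" "D 2 (k 3) x = b x * (k 3 x - k 2 x)"
  using codazzi[OF x, of 2 2 1] codazzi[OF x, of 3 3 1] codazzi[OF x, of 2 3 2] codazzi[OF x, of 3 3 2]
  by (simp_all add: \<omega>_table algebra_simps)

lemma commutator_table:
  fixes g :: "real^3 \<Rightarrow> 'b::euclidean_space"
  assumes "smooth_on V g"
  shows "D 1 (D 2 g) x - D 2 (D 1 g) x = - p x *\<^sub>R D 2 g x"
    "D 1 (D 3 g) x - D 3 (D 1 g) x = - q x *\<^sub>R D 3 g x"
    "D 2 (D 3 g) x - D 3 (D 2 g) x = - a x *\<^sub>R D 2 g x + b x *\<^sub>R D 3 g x"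
  by (simp_all add: commutator[OF assms x] sum_3 \<omega>_table)

end

end

section \<open>Vanishing of the connection coefficients in the principal plane\<close>

text \<open>The last hypotheses are the derivatives along \<open>e\<^sub>3\<close> of \<open>second_trace_derivative\<close> and of \<open>K = 0\<close> below,
  with \<open>q3\<close> for the derivative of \<open>q\<close>.\<close>

lemma elimination_first:
  fixes k1 k2 k3 p q a L q3 :: real
  assumes sum: "k2 + k3 = -3 * k1"
    and L: "p * (k1 - k2) + q * (k1 - k3) = -3 * L"
    and q3: "q3 * (k1 - k3) = a * (p - q) * ((k2 - k3) - (k1 - k2))"
    and X: "(- (2 * p * (a * (p - q))) - k1 * (a * (k2 - k3))) * (k1 - k2) - (1 - p\<^sup>2 - k1 * k2) * (a * (k2 - k3))
      + a * (p - q) * (L - p * (k1 - k2)) + p * (- (a * (p - q)) * (k1 - k2) + p * (a * (k2 - k3)))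
      + (- (2 * q * q3) + k1 * (a * (k2 - k3))) * (k1 - k3) + (1 - q\<^sup>2 - k1 * k3) * (a * (k2 - k3))
      + q3 * (L - q * (k1 - k3)) + q * (- q3 * (k1 - k3) - q * (a * (k2 - k3))) = 0"
  shows "a * (k1 * (k2 - k3)\<^sup>2 * (k1 - k3) + (p - q)\<^sup>2 * (k1 + 4 * k2) * (k1 - k3) + L * (p - q) * (k2 - k3)) = 0"
    (is "?K = 0")
proof -
  let ?X0 = "(- (2 * p * (a * (p - q))) - k1 * (a * (k2 - k3))) * (k1 - k2) - (1 - p\<^sup>2 - k1 * k2) * (a * (k2 - k3))
      + a * (p - q) * (L - p * (k1 - k2)) + p * (- (a * (p - q)) * (k1 - k2) + p * (a * (k2 - k3)))
      + k1 * (a * (k2 - k3)) * (k1 - k3) + (1 - q\<^sup>2 - k1 * k3) * (a * (k2 - k3))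
      + q * (- q * (a * (k2 - k3)))"
  have k3: "k3 = -3 * k1 - k2"
    using sum by simp
  have L': "L = - (p * (k1 - k2) + q * (4 * k1 + k2)) / 3"
    using L unfolding k3 by (simp add: algebra_simps)
  have "?X0 + q3 * (L - 4 * q * (k1 - k3)) = 0"
    using X by (simp add: algebra_simps)
  \<comment> \<open>\<open>q3\<close> is only known through its product with \<open>k1 - k3\<close>,
    so the identity is multiplied by this factor before \<open>q3\<close> is eliminated.\<close>
  then have "(k1 - k3) * (?X0 + q3 * (L - 4 * q * (k1 - k3))) = 0" by simp
  then have "(k1 - k3) * ?X0 + q3 * (k1 - k3) * (L - 4 * q * (k1 - k3)) = 0"
    by (simp only: distrib_left mult_ac)
  then have "(k1 - k3) * ?X0 + a * (p - q) * ((k2 - k3) - (k1 - k2)) * (L - 4 * q * (k1 - k3)) = 0"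
    unfolding q3 .
  moreover have "(k1 - k3) * ?X0 + a * (p - q) * ((k2 - k3) - (k1 - k2)) * (L - 4 * q * (k1 - k3)) = 2 * ?K"
    unfolding L' k3 by (simp add: field_simps power2_eq_square)
  ultimately show ?thesis by simp
qed

text \<open>The derivative of \<open>K\<close> still contains \<open>L\<close> linearly, as does
  \<open>K\<close>; a suitable multiple of \<open>K = 0\<close> removes it and leaves a
  product.\<close>

lemma elimination_second:
  fixes k1 k2 k3 p q a L q3 :: real
  assumes sum: "k2 + k3 = -3 * k1"
    and q3: "q3 * (k1 - k3) = a * (p - q) * ((k2 - k3) - (k1 - k2))"
    and K: "k1 * (k2 - k3)\<^sup>2 * (k1 - k3) + (p - q)\<^sup>2 * (k1 + 4 * k2) * (k1 - k3) + L * (p - q) * (k2 - k3) = 0"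
      (is "?K = 0")
    and Y: "k1 * (4 * a * (k2 - k3)\<^sup>2) * (k1 - k3) + k1 * (k2 - k3)\<^sup>2 * (a * (k2 - k3))
      + 2 * (p - q) * (a * (p - q) - q3) * (k1 + 4 * k2) * (k1 - k3)
      + (p - q)\<^sup>2 * (4 * a * (k2 - k3)) * (k1 - k3) + (p - q)\<^sup>2 * (k1 + 4 * k2) * (a * (k2 - k3))
      + L * (a * (p - q) - q3) * (k2 - k3) + L * (p - q) * (2 * a * (k2 - k3)) = 0"
  shows "a * (k1 - k3) * (k2 - k3) * k1 * ((k2 - k3)\<^sup>2 + 5 * (p - q)\<^sup>2) = 0" (is "?G = 0")
proof -
  let ?Y0 = "k1 * (4 * a * (k2 - k3)\<^sup>2) * (k1 - k3) + k1 * (k2 - k3)\<^sup>2 * (a * (k2 - k3))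
      + 2 * (p - q) * (a * (p - q)) * (k1 + 4 * k2) * (k1 - k3)
      + (p - q)\<^sup>2 * (4 * a * (k2 - k3)) * (k1 - k3) + (p - q)\<^sup>2 * (k1 + 4 * k2) * (a * (k2 - k3))
      + L * (a * (p - q)) * (k2 - k3) + L * (p - q) * (2 * a * (k2 - k3))"
  let ?Y1 = "- (2 * (p - q) * (k1 + 4 * k2) * (k1 - k3)) - L * (k2 - k3)"
  have k3: "k3 = -3 * k1 - k2"
    using sum by simp
  have "?Y0 + q3 * ?Y1 = 0"
    using Y by (simp add: algebra_simps)
  then have "(k1 - k3) * (?Y0 + q3 * ?Y1) = 0" by simp
  then have "(k1 - k3) * ?Y0 + q3 * (k1 - k3) * ?Y1 = 0"
    by (simp only: distrib_left mult_ac)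
  then have "(k1 - k3) * ?Y0 + a * (p - q) * ((k2 - k3) - (k1 - k2)) * ?Y1 = 0"
    unfolding q3 .
  \<comment> \<open>The coefficient of \<open>L * a * (p - q) * (k2 - k3)\<close> on the left is
    \<open>4 * k1 - 2 * k2 - 2 * k3\<close>, that is \<open>10 * k1\<close> by the trace relation;
    this is the multiple of \<open>K\<close> to split off.\<close>
  moreover have "(k1 - k3) * ?Y0 + a * (p - q) * ((k2 - k3) - (k1 - k2)) * ?Y1 = 3 * ?G + 10 * k1 * a * ?K"
    unfolding k3 by (simp add: field_simps power2_eq_square)
  ultimately show ?thesis using K by simp
qed

context principal_frame
begin

text \<open>Components of the commutator formula for \<open>E 1\<close>: the first two are Riccati
  equations along \<open>e 1\<close>, the other two the Codazzi equations of the level surfaces of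
  \<open>k 1\<close>.\<close>

lemma Dp_table:
  assumes x: "x \<in> V"
  shows "D 1 p x = 1 - (p x)\<^sup>2 - k 1 x * k 2 x" "D 1 q x = 1 - (q x)\<^sup>2 - k 1 x * k 3 x"
    "D 3 p x = a x * (p x - q x)" "D 2 q x = b x * (q x - p x)"
proof -
  note rules = D_rules smooth_rules smooth_coeffs x DE_table[OF x] DN[OF x] Dk1(1,2)[OF x] lorentz_simps EE[OF x] EN[OF x] EF[OF x]
  have D1: "D i (D 1 (E 1)) x = D i (\<lambda>x. k 1 x *\<^sub>R N x + F x) x" for i
    by (intro D_cong[OF x] DE_table)
  have D2: "D i (D 2 (E 1)) x = D i (\<lambda>x. p x *\<^sub>R E 2 x) x" for i
    by (intro D_cong[OF x] DE_table)
  have D3: "D i (D 3 (E 1)) x = D i (\<lambda>x. q x *\<^sub>R E 3 x) x" for i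
    by (intro D_cong[OF x] DE_table)
  note comm = commutator_table[OF x smooth_D[OF smooth_F], of 1]
  have "lorentz (D 1 (D 2 (E 1)) x - D 2 (D 1 (E 1)) x) (E 2 x) = - (p x)\<^sup>2"
    unfolding comm by (simp add: rules power2_eq_square)
  then show "D 1 p x = 1 - (p x)\<^sup>2 - k 1 x * k 2 x"
    unfolding D1 D2 by (simp add: rules)
  have "lorentz (D 1 (D 3 (E 1)) x - D 3 (D 1 (E 1)) x) (E 3 x) = - (q x)\<^sup>2"
    unfolding comm by (simp add: rules power2_eq_square)
  then show "D 1 q x = 1 - (q x)\<^sup>2 - k 1 x * k 3 x"
    unfolding D1 D3 by (simp add: rules)
  have "lorentz (D 2 (D 3 (E 1)) x - D 3 (D 2 (E 1)) x) (E 2 x) = - a x * p x"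
    unfolding comm by (simp add: rules)
  then show "D 3 p x = a x * (p x - q x)"
    unfolding D2 D3 by (simp add: rules algebra_simps)
  have "lorentz (D 2 (D 3 (E 1)) x - D 3 (D 2 (E 1)) x) (E 3 x) = b x * q x"
    unfolding comm by (simp add: rules)
  then show "D 2 q x = b x * (q x - p x)"
    unfolding D2 D3 by (simp add: rules algebra_simps)
qed

definition "L = D 1 (k 1)"

lemma smooth_L: "smooth_on V L"
  unfolding L_def by (intro smooth_rules)

text \<open>The brackets of \<open>e 1\<close> with \<open>e 2\<close> and \<open>e 3\<close> are
  multiples of \<open>e 2\<close> and \<open>e 3\<close>, so constancy along the latter survives a
  derivative along \<open>e 1\<close>.\<close>

lemma transversal_D1:
  fixes g :: "real^3 \<Rightarrow> 'b::euclidean_space"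
  assumes "smooth_on V g" "\<And>y. y \<in> V \<Longrightarrow> D 2 g y = 0" "\<And>y. y \<in> V \<Longrightarrow> D 3 g y = 0" "x \<in> V"
  shows "D 2 (D 1 g) x = 0" "D 3 (D 1 g) x = 0"
  using commutator_table(1,2)[OF assms(4,1)] assms(2,3)[OF assms(4)]
    D_eq_0[OF assms(4) assms(2)] D_eq_0[OF assms(4) assms(3)] by simp_all

lemma L_transversal: "x \<in> V \<Longrightarrow> D 2 L x = 0" "x \<in> V \<Longrightarrow> D 3 L x = 0"
  unfolding L_def using transversal_D1[OF smooth_k Dk1(1,2)] by blast+

lemma trace_derivative:
  assumes x: "x \<in> V"
  shows "p x * (k 1 x - k 2 x) + q x * (k 1 x - k 3 x) = -3 * L x"
proof -
  have "D 1 (\<lambda>x. k 2 x + k 3 x) x = D 1 (\<lambda>x. -3 * k 1 x) x"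
    using k_sum by (intro D_cong[OF x])
  then show ?thesis
    by (simp add: D_rules smooth_rules x Dk_table L_def)
qed

lemma D3_k3:
  assumes x: "x \<in> V"
  shows "D 3 (k 3) x = - (a x * (k 2 x - k 3 x))"
proof -
  have "D 3 (\<lambda>x. k 2 x + k 3 x) x = D 3 (\<lambda>x. -3 * k 1 x) x"
    using k_sum by (intro D_cong[OF x])
  then show ?thesis
    by (simp add: D_rules smooth_rules x Dk_table Dk1)
qed

text \<open>The structure equations give \<open>D 2 q\<close> but not \<open>D 3 q\<close>;
  differentiating the trace relation supplies it, up to the nonzero factor
  \<open>k 1 - k 3\<close>.\<close>

lemma D3_q:
  assumes x: "x \<in> V"
  shows "D 3 q x * (k 1 x - k 3 x) = a x * (p x - q x) * ((k 2 x - k 3 x) - (k 1 x - k 2 x))"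
proof -
  have "D 3 (\<lambda>x. p x * (k 1 x - k 2 x) + q x * (k 1 x - k 3 x)) x = D 3 (\<lambda>x. -3 * L x) x"
    using trace_derivative by (intro D_cong[OF x])
  then show ?thesis
    by (simp add: D_rules smooth_rules smooth_coeffs smooth_L x Dk_table Dk1 Dp_table D3_k3 L_transversal)
      (simp add: algebra_simps)
qed

lemma second_trace_derivative:
  assumes x: "x \<in> V"
  shows "(1 - (p x)\<^sup>2 - k 1 x * k 2 x) * (k 1 x - k 2 x) + p x * (L x - p x * (k 1 x - k 2 x))
    + (1 - (q x)\<^sup>2 - k 1 x * k 3 x) * (k 1 x - k 3 x) + q x * (L x - q x * (k 1 x - k 3 x)) = -3 * D 1 L x"
proof -
  have "D 1 (\<lambda>x. p x * (k 1 x - k 2 x) + q x * (k 1 x - k 3 x)) x = D 1 (\<lambda>x. -3 * L x) x"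
    using trace_derivative by (intro D_cong[OF x])
  then show ?thesis
    by (simp add: D_rules smooth_rules smooth_coeffs smooth_L x Dk_table Dp_table L_def[symmetric])
qed

text \<open>Up to a factor 2, the cofactor of \<open>a\<close> in the \<open>e 3\<close>-derivative
  of \<open>second_trace_derivative\<close>, multiplied by \<open>k 1 - k 3\<close> and cleared of
  \<open>D 3 q\<close>.\<close>

definition "K x = k 1 x * (k 2 x - k 3 x)\<^sup>2 * (k 1 x - k 3 x)
  + (p x - q x)\<^sup>2 * (k 1 x + 4 * k 2 x) * (k 1 x - k 3 x) + L x * (p x - q x) * (k 2 x - k 3 x)"

lemma a_times_K:
  assumes x: "x \<in> V"
  shows "a x * K x = 0"
proof -
  have "D 3 (\<lambda>x. (1 - (p x)\<^sup>2 - k 1 x * k 2 x) * (k 1 x - k 2 x) + p x * (L x - p x * (k 1 x - k 2 x))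
    + (1 - (q x)\<^sup>2 - k 1 x * k 3 x) * (k 1 x - k 3 x) + q x * (L x - q x * (k 1 x - k 3 x))) x = D 3 (\<lambda>x. -3 * D 1 L x) x"
    using second_trace_derivative by (intro D_cong[OF x])
  then show ?thesis
    unfolding K_def
    by (intro elimination_first[OF k_sum[OF x] trace_derivative[OF x] D3_q[OF x]])
      (simp add: D_rules smooth_rules smooth_coeffs smooth_L x Dk_table Dk1 Dp_table D3_k3 L_transversal
        transversal_D1[OF smooth_L L_transversal] algebra_simps)
qed

lemma a_eq_0:
  assumes "x \<in> V"
  shows "a x = 0"
proof (rule ccontr)
  assume "a x \<noteq> 0"
  define A where "A = {y \<in> V. a y \<noteq> 0}"
  have "open A"
    unfolding A_def using smooth_on_continuous[OF smooth_coeffs(3)] open_V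
      continuous_open_preimage[of V a "- {0}"] by (simp add: open_Compl vimage_def Int_def)
  have A: "y \<in> V" "a y \<noteq> 0" if "y \<in> A" for y using that by (auto simp: A_def)
  have K: "K y = 0" if "y \<in> A" for y
    using a_times_K[OF A(1)[OF that]] A(2)[OF that] by simp
  have "k 1 y = 0" if "y \<in> A" for y
  proof -
    note y = A(1)[OF that]
    have "D 3 K y = D 3 (\<lambda>_. 0) y"
      using K by (intro D_cong_open[OF \<open>open A\<close> that])
    then have "D 3 K y = 0" by (simp add: D_const)
    then have "a y * (k 1 y - k 3 y) * (k 2 y - k 3 y) * k 1 y * ((k 2 y - k 3 y)\<^sup>2 + 5 * (p y - q y)\<^sup>2) = 0"
      unfolding K_def[abs_def]
      apply (intro elimination_second[OF k_sum[OF y] D3_q[OF y] K[OF that, unfolded K_def]])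
      apply (simp add: D_rules smooth_rules smooth_coeffs smooth_L y Dk_table Dk1 Dp_table D3_k3 L_transversal)
      apply (simp add: algebra_simps power2_eq_square)
      done
    moreover have "(k 2 y - k 3 y)\<^sup>2 + 5 * (p y - q y)\<^sup>2 > 0"
      using k_neq[OF y] by (intro add_pos_nonneg) auto
    ultimately show ?thesis
      using A[OF that] k_neq[OF y] by auto
  qed
  then have "D 1 (k 1) x = D 1 (\<lambda>_. 0) x"
    using assms \<open>a x \<noteq> 0\<close> by (intro D_cong_open[OF \<open>open A\<close>]) (auto simp: A_def)
  with Dk1(3)[OF assms] show False by (simp add: D_const)
qed

end

section \<open>The two families of curvature circles\<close>

text \<open>A pair with \<open>h1' = h2\<close> and \<open>h2' = c * h1\<close> is closed under
  differentiation, so one simultaneous induction covers \<open>exp\<close>, the trigonometric and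
  hyperbolic functions and the pair of identity and 1.\<close>

lemma Ck_on_chain_pair:
  fixes f :: "'a::euclidean_space \<Rightarrow> real" and h1 h2 :: "real \<Rightarrow> real"
  assumes "open U" "\<And>y. (h1 has_real_derivative h2 y) (at y)" "\<And>y. (h2 has_real_derivative c * h1 y) (at y)"
    and "Ck_on n U f"
  shows "Ck_on n U (\<lambda>x. h1 (f x)) \<and> Ck_on n U (\<lambda>x. h2 (f x))"
  using assms(4)
proof (induction n)
  case 0
  have "continuous_on UNIV h1" "continuous_on UNIV h2"
    using assms(2,3) DERIV_isCont by (blast intro: continuous_at_imp_continuous_on)+
  with 0 show ?case
    by (auto intro: continuous_on_compose2)
next
  case (Suc n)
  have IH: "Ck_on n U (\<lambda>x. h1 (f x))" "Ck_on n U (\<lambda>x. h2 (f x))"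
    using Suc.IH Ck_on_SucD[OF Suc.prems] by auto
  have f': "(f has_derivative fd f x) (at x)" if "x \<in> U" for x
    using Suc.prems that by (auto intro: has_fd)
  have Df: "Ck_on n U (\<lambda>x. fd f x v)" for v
    using Suc.prems by simp
  have "Ck_on (Suc n) U (\<lambda>x. h1 (f x))"
    by (rule Ck_on_SucI[OF assms(1) has_derivative_compose[OF f' assms(2)[unfolded has_field_derivative_def]]])
      (assumption, intro Ck_on_bilinear[OF bounded_bilinear_mult] assms(1) IH Df)
  moreover have "Ck_on (Suc n) U (\<lambda>x. h2 (f x))"
    by (rule Ck_on_SucI[OF assms(1) has_derivative_compose[OF f' assms(3)[unfolded has_field_derivative_def]]])
      (assumption, intro Ck_on_bilinear[OF bounded_bilinear_mult] assms(1) Ck_on_const IH Df)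
  ultimately show ?case ..
qed

lemma smooth_on_chain_pair:
  fixes f :: "'a::euclidean_space \<Rightarrow> real" and h1 h2 :: "real \<Rightarrow> real"
  assumes "open U" "\<And>y. (h1 has_real_derivative h2 y) (at y)" "\<And>y. (h2 has_real_derivative c * h1 y) (at y)"
    and "smooth_on U f"
  shows "smooth_on U (\<lambda>x. h1 (f x))" "smooth_on U (\<lambda>x. h2 (f x))"
  using Ck_on_chain_pair[OF assms(1,2,3)] assms(4) unfolding smooth_on_def by blast+

text \<open>The derivative of \<open>\<theta>\<close> is a smooth field evaluated at
  \<open>\<theta>\<close>, so differentiating \<open>g (\<theta> y)\<close> yields a function of the
  same shape. Smoothness of inverse charts and of their coordinate curves follows without knowing it
  beforehand.\<close>

lemma smooth_on_compose_field:
  fixes \<theta> :: "'c::euclidean_space \<Rightarrow> 'a::euclidean_space" and g :: "'a \<Rightarrow> 'b::real_normed_vector"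
  assumes "open B" "open V" "\<theta> ` B \<subseteq> V"
    and \<theta>': "\<And>y. y \<in> B \<Longrightarrow> (\<theta> has_derivative (\<lambda>v. W v (\<theta> y))) (at y)"
    and W: "\<And>v. smooth_on V (W v)" and g: "smooth_on V g"
  shows "smooth_on B (\<lambda>y. g (\<theta> y))"
proof -
  have g': "((\<lambda>y. g (\<theta> y)) has_derivative (\<lambda>v. fd g (\<theta> y) (W v (\<theta> y)))) (at y)"
    if "smooth_on V g" "y \<in> B" for g :: "'a \<Rightarrow> 'b" and y
    using that assms(3) by (intro has_derivative_compose[OF \<theta>'] smooth_on_has_fd) auto
  have "Ck_on n B (\<lambda>y. g (\<theta> y))" for n
    using g
  proof (induction n arbitrary: g)
    case 0
    then show ?case
      using has_derivative_continuous[OF g'[OF 0]] by (auto intro: continuous_at_imp_continuous_on)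
  next
    case (Suc n)
    show ?case
      by (rule Ck_on_SucI[OF assms(1) g'[OF Suc.prems]])
        (assumption, rule Suc.IH[OF smooth_on_fd[OF assms(2) Suc.prems W]])
  qed
  then show ?thesis by (simp add: smooth_on_def)
qed

context principal_frame
begin

text \<open>The hypotheses are symmetric in the indices 2 and 3. This transfers \<open>a = 0\<close>
  to \<open>b = 0\<close> and later exchanges the roles of \<open>c 2\<close> and
  \<open>c 3\<close>.\<close>

lemma swapped: "principal_frame V F N (\<lambda>i. e (Transposition.transpose 2 3 i)) (\<lambda>i. k (Transposition.transpose 2 3 i))"
proof
  have inj: "Transposition.transpose 2 3 i = Transposition.transpose 2 3 j \<longleftrightarrow> i = j" for i j :: 3
    by (metis transpose_involutory)
  show "lorentz (fd F x (e (Transposition.transpose 2 3 i) x)) (fd F x (e (Transposition.transpose 2 3 j) x)) = (if i = j then 1 else 0)"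
    if "x \<in> V" for x i j
    by (simp add: frame_orthonormal[OF that] inj)
  show "k (Transposition.transpose 2 3 i) x \<noteq> k (Transposition.transpose 2 3 j) x" if "x \<in> V" "i \<noteq> j" for x i j
    using k_distinct[OF that(1)] that(2) inj by blast
qed (use open_V convex_V smooth_F smooth_N smooth_e smooth_k FF NN FN frame_normal frame_principal
    k_sum k1_1 k1_2 k1_3 in \<open>simp_all add: add.commute\<close>)

lemma b_eq_0:
  assumes "x \<in> V"
  shows "b x = 0"
proof -
  interpret swap: principal_frame V F N "\<lambda>i. e (Transposition.transpose 2 3 i)" "\<lambda>i. k (Transposition.transpose 2 3 i)"
    by (rule swapped)
  have "swap.a x = b x"
    by (simp add: swap.a_def b_def swap.\<omega>_def \<omega>_def swap.D_def[abs_def] D_def[abs_def])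
  with swap.a_eq_0[OF assms] show ?thesis by simp
qed

section \<open>The constant planes of the curvature circles\<close>

definition "r i = \<omega> i 1 i"
text \<open>For \<open>i = 2, 3\<close>, once \<open>a\<close> and \<open>b\<close> vanish, the
  curvature vector in R^5 of the integral curves of \<open>e i\<close>; see
  \<open>DE_final\<close>.\<close>

definition "\<xi> i x = - r i x *\<^sub>R E 1 x + k i x *\<^sub>R N x + F x"
definition "c i x = (r i x)\<^sup>2 + (k i x)\<^sup>2 - 1"

lemma r_eq: "r 2 = p" "r 3 = q"
  by (simp_all add: r_def p_def q_def)

lemma smooth_r: "smooth_on V (r i)"
  unfolding r_def by (rule smooth_\<omega>)

lemma smooth_\<xi>: "smooth_on V (\<xi> i)"
  unfolding \<xi>_def[abs_def] by (intro smooth_rules smooth_r)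

lemma smooth_c: "smooth_on V (c i)"
  unfolding c_def[abs_def] by (intro smooth_rules smooth_r)

lemma \<omega>_final:
  assumes "x \<in> V"
  shows "\<omega> 2 2 3 x = 0" "\<omega> 2 3 2 x = 0" "\<omega> 3 3 2 x = 0" "\<omega> 3 2 3 x = 0"
    "\<omega> 2 1 2 x = r 2 x" "\<omega> 2 2 1 x = - r 2 x" "\<omega> 3 1 3 x = r 3 x" "\<omega> 3 3 1 x = - r 3 x"
  using \<omega>_values[OF assms] a_eq_0[OF assms] b_eq_0[OF assms] by (simp_all add: r_eq)

lemmas \<omega>_all = \<omega>_diag \<omega>_mixed \<omega>_geodesic \<omega>_final

text \<open>Codazzi does not supply the derivative of \<open>k 2\<close> along \<open>e 2\<close> or
  of \<open>k 3\<close> along \<open>e 3\<close>; they come from the trace relation. Here and in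
  \<open>Dr_final\<close> only the derivative along \<open>e 1\<close> survives.\<close>

lemma Dk_final:
  assumes x: "x \<in> V" and i: "i = 2 \<or> i = 3"
  shows "D j (k i) x = (if j = 1 then r i x * (k 1 x - k i x) else 0)"
proof -
  have "D 2 (\<lambda>x. k 2 x + k 3 x) x = D 2 (\<lambda>x. -3 * k 1 x) x"
    using k_sum by (intro D_cong[OF x])
  then have "D 2 (k 2) x = 0"
    by (simp add: D_rules smooth_rules x Dk_table Dk1 b_eq_0)
  moreover have "D 3 (k 3) x = 0"
    using D3_k3[OF x] a_eq_0[OF x] by simp
  ultimately have "\<forall>j. D j (k i) x = (if j = 1 then r i x * (k 1 x - k i x) else 0)"
    using i Dk_table[OF x] a_eq_0[OF x] b_eq_0[OF x] unfolding forall_3 by (auto simp: r_eq)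
  then show ?thesis ..
qed

lemma Dr_final:
  assumes x: "x \<in> V" and i: "i = 2 \<or> i = 3"
  shows "D j (r i) x = (if j = 1 then 1 - (r i x)\<^sup>2 - k 1 x * k i x else 0)"
proof -
  have q: "D 3 q x = 0"
    using D3_q[OF x] a_eq_0[OF x] k_neq[OF x] by simp
  have "D 2 (\<lambda>x. p x * (k 1 x - k 2 x) + q x * (k 1 x - k 3 x)) x = D 2 (\<lambda>x. -3 * L x) x"
    using trace_derivative by (intro D_cong[OF x])
  then have "D 2 p x = 0"
    using k_neq[OF x]
    by (simp add: D_rules smooth_rules smooth_coeffs smooth_L x Dk_final Dk1 Dp_table b_eq_0 L_transversal)
  with q have "\<forall>j. D j (r i) x = (if j = 1 then 1 - (r i x)\<^sup>2 - k 1 x * k i x else 0)"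
    using i Dp_table[OF x] a_eq_0[OF x] b_eq_0[OF x] unfolding forall_3 by (auto simp: r_eq)
  then show ?thesis ..
qed

lemma DE1_final:
  assumes "x \<in> V"
  shows "D j (E 1) x = (if j = 1 then k 1 x *\<^sub>R N x + F x else r j x *\<^sub>R E j x)"
proof -
  have "\<forall>j. D j (E 1) x = (if j = 1 then k 1 x *\<^sub>R N x + F x else r j x *\<^sub>R E j x)"
    unfolding forall_3 by (simp add: DE_table[OF assms] r_eq)
  then show ?thesis ..
qed

lemma DE_final:
  assumes x: "x \<in> V" and i: "i = 2 \<or> i = 3"
  shows "D j (E i) x = (if j = i then \<xi> i x else 0)"
proof -
  have "\<forall>j. D j (E i) x = (if j = i then \<xi> i x else 0)"
    using i unfolding forall_3
    by (auto simp: DE_table[OF x] a_eq_0[OF x] b_eq_0[OF x] r_eq \<xi>_def)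
  then show ?thesis ..
qed

text \<open>\<open>E 2\<close> is constant along \<open>e 3\<close>, and \<open>e 2\<close>,
  \<open>e 3\<close> now commute, so \<open>\<xi> 2\<close> is constant along \<open>e 3\<close>;
  the \<open>E 3\<close>-component of this is the Gauss equation of the plane of \<open>e 2\<close>
  and \<open>e 3\<close>.\<close>

lemma gauss:
  assumes x: "x \<in> V"
  shows "r 2 x * r 3 x + k 2 x * k 3 x = 1"
proof -
  note rules = D_rules smooth_rules smooth_coeffs smooth_r x DE1_final[OF x] DN[OF x] Dk_final[OF x]
    Dr_final[OF x] lorentz_simps EE[OF x] EN[OF x] EF[OF x]
  have "D 2 (D 3 (E 2)) x = 0"
    using DE_final by (intro D_eq_0[OF x]) auto
  moreover have "D 3 (D 2 (E 2)) x = D 3 (\<lambda>x. - r 2 x *\<^sub>R E 1 x + k 2 x *\<^sub>R N x + F x) x"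
    using DE_final by (intro D_cong[OF x]) (auto simp: \<xi>_def)
  ultimately have "D 3 (\<lambda>x. - r 2 x *\<^sub>R E 1 x + k 2 x *\<^sub>R N x + F x) x = 0"
    using commutator_table(3)[OF x smooth_D[OF smooth_F], of 2] a_eq_0[OF x] b_eq_0[OF x] by simp
  then have "lorentz (D 3 (\<lambda>x. - r 2 x *\<^sub>R E 1 x + k 2 x *\<^sub>R N x + F x) x) (E 3 x) = 0"
    by (simp add: lorentz_simps)
  then show ?thesis
    by (simp add: rules)
qed

text \<open>Together with \<open>DE_final\<close> this is a closed linear system for
  \<open>E i\<close> and \<open>\<xi> i\<close>, so the plane they span is parallel. The mixed
  directions vanish by the Gauss equation.\<close>

lemma D\<xi>:
  assumes x: "x \<in> V" and i: "i = 2 \<or> i = 3"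
  shows "D j (\<xi> i) x = (if j = 1 then - r i x *\<^sub>R \<xi> i x else if j = i then - c i x *\<^sub>R E i x else 0)"
proof -
  have "D j (\<xi> i) x = D j (\<lambda>x. - r i x *\<^sub>R E 1 x + k i x *\<^sub>R N x + F x) x"
    by (intro D_cong[OF x]) (simp add: \<xi>_def)
  also have "\<dots> = - r i x *\<^sub>R D j (E 1) x - D j (r i) x *\<^sub>R E 1 x + k i x *\<^sub>R (- k j x *\<^sub>R E j x) + D j (k i) x *\<^sub>R N x + E j x"
    by (simp add: D_rules smooth_rules smooth_r x DN)
  finally have *: "D j (\<xi> i) x =
    - r i x *\<^sub>R D j (E 1) x - D j (r i) x *\<^sub>R E 1 x + k i x *\<^sub>R (- k j x *\<^sub>R E j x) + D j (k i) x *\<^sub>R N x + E j x" .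
  consider "j = 1" | "j = i" "j \<noteq> 1" | "j \<noteq> 1" "j \<noteq> i" by blast
  then show ?thesis
  proof cases
    case 1
    then show ?thesis
      unfolding * DE1_final[OF x] Dr_final[OF assms] Dk_final[OF assms]
      by (simp add: \<xi>_def algebra_simps power2_eq_square)
  next
    case 2
    then show ?thesis
      unfolding * DE1_final[OF x] Dr_final[OF assms] Dk_final[OF assms]
      by (simp add: c_def algebra_simps power2_eq_square)
  next
    case 3
    then have "r i x * r j x + k i x * k j x = 1"
      using i exhaust_3[of j] gauss[OF x] by (auto simp: mult.commute)
    then have "- r i x * r j x - k i x * k j x + 1 = 0" by simp
    then have "(- r i x * r j x - k i x * k j x + 1) *\<^sub>R E j x = 0" by simp
    with 3 show ?thesis
      unfolding * DE1_final[OF x] Dr_final[OF assms] Dk_final[OF assms]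
      by (simp add: algebra_simps)
  qed
qed

lemma Dc:
  assumes x: "x \<in> V" and i: "i = 2 \<or> i = 3"
  shows "D j (c i) x = (if j = 1 then - 2 * r i x * c i x else 0)"
proof -
  have "D j (c i) x = D j (\<lambda>x. (r i x)\<^sup>2 + (k i x)\<^sup>2 - 1) x"
    by (intro D_cong[OF x]) (simp add: c_def)
  then show ?thesis
    by (simp add: D_rules smooth_rules smooth_r x Dr_final[OF assms] Dk_final[OF assms] c_def)
      (simp add: algebra_simps power2_eq_square)
qed

text \<open>The sum is the squared length of \<open>\<xi> 2 - \<xi> 3\<close>, a spacelike vector in
  the span of \<open>E 1\<close> and \<open>N\<close> that is nonzero because \<open>k 2\<close> and
  \<open>k 3\<close> differ. Hence at most one of the two planes fails to be Euclidean.\<close>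

lemma c_sum_pos:
  assumes "x \<in> V"
  shows "c 2 x + c 3 x > 0"
proof -
  have "c 2 x + c 3 x = (r 2 x - r 3 x)\<^sup>2 + (k 2 x - k 3 x)\<^sup>2"
    using gauss[OF assms] by (simp add: c_def power2_eq_square algebra_simps)
  then show ?thesis
    using k_neq[OF assms] by (simp add: add_nonneg_pos)
qed

lemma \<xi>_lorentz:
  assumes x: "x \<in> V"
  shows "lorentz (F x) (\<xi> i x) = -1" "lorentz (\<xi> i x) (\<xi> i x) = c i x"
    "lorentz (\<xi> 2 x) (\<xi> 3 x) = 0" "j \<noteq> 1 \<Longrightarrow> lorentz (E j x) (\<xi> i x) = 0"
    "lorentz (\<xi> 2 x) (F x) = -1" "lorentz (\<xi> 3 x) (F x) = -1"
proof -
  note E = EE[OF x] EN[OF x] EF[OF x] FF[OF x] NN[OF x] FN[OF x]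
  have E': "lorentz (N x) (E i x) = 0" "lorentz (F x) (E i x) = 0" "lorentz (N x) (F x) = 0" for i
    using E(2)[of i] E(3)[of i] E(6) by (simp_all only: lorentz_commute)
  show "lorentz (F x) (\<xi> i x) = -1" "lorentz (\<xi> i x) (\<xi> i x) = c i x"
    "j \<noteq> 1 \<Longrightarrow> lorentz (E j x) (\<xi> i x) = 0"
    "lorentz (\<xi> 2 x) (F x) = -1" "lorentz (\<xi> 3 x) (F x) = -1"
    by (simp_all add: \<xi>_def lorentz_simps E E' c_def power2_eq_square)
  show "lorentz (\<xi> 2 x) (\<xi> 3 x) = 0"
    using gauss[OF x] by (simp add: \<xi>_def lorentz_simps E E' mult.commute add.commute)
qed

section \<open>Potentials and integration of the frame equations\<close>

lemma constant_if_D_eq_0: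
  assumes "smooth_on V g" "\<And>x j. x \<in> V \<Longrightarrow> D j g x = 0" "x \<in> V" "y \<in> V"
  shows "g x = g y"
proof (rule has_derivative_zero_unique[OF convex_V _ assms(3,4)])
  fix z assume z: "z \<in> V"
  have "fd g z = (\<lambda>_. 0)"
    using fd_frame[OF assms(1) z] assms(2)[OF z] by auto
  then show "(g has_derivative (\<lambda>h. 0)) (at z within V)"
    using has_D[OF assms(1) z] by (simp add: has_derivative_at_withinI)
qed

lemma bracket_frame:
  assumes "x \<in> V"
  shows "lorentz (fd F x (fd (e j) x (e i x) - fd (e i) x (e j x))) (E l x) = \<omega> i j l x - \<omega> j i l x"
proof -
  have "fd F x (fd (e j) x (e i x) - fd (e i) x (e j x)) = D i (E j) x - D j (E i) x"
    unfolding D_def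
    using fd_fd_field[OF open_V smooth_F smooth_e assms] fd_fd_sym[OF open_V smooth_F assms]
      linear_diff[OF fd_linear[OF smooth_on_differentiable[OF smooth_F assms]]]
    by simp
  then show ?thesis by (simp add: \<omega>_def lorentz_simps)
qed

text \<open>The Poincare lemma in frame language: \<open>closed\<close> says that the one-form with
  value \<open>h j\<close> on \<open>e j\<close> is closed, the right side being its value on the
  bracket of \<open>e i\<close> and \<open>e j\<close>.\<close>

lemma frame_potential:
  assumes smooth: "\<And>j. smooth_on V (h j)"
    and closed: "\<And>x i j. x \<in> V \<Longrightarrow>
      D i (h j) x - D j (h i) x = (\<Sum>l\<in>UNIV. (\<omega> i j l x - \<omega> j i l x) * h l x)"
    and x0: "x0 \<in> V"
  obtains \<phi> where "smooth_on V \<phi>" "\<phi> x0 = s0" "\<And>x j. x \<in> V \<Longrightarrow> D j \<phi> x = h j x"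
proof -
  \<comment> \<open>The Euclidean vector representing that one-form;
    \<open>lorentz (fd F x w) (E l x)\<close> is the dual coframe applied to
    \<open>w\<close>.\<close>
  define A :: "real^3 \<Rightarrow> real^3" where
    "A x = (\<chi> m. \<Sum>l\<in>UNIV. h l x * lorentz (fd F x (axis m 1)) (E l x))" for x
  have smooth_A: "smooth_on V A"
    unfolding A_def[abs_def]
    by (intro smooth_on_vec_lambda smooth_on_sum smooth_rules smooth smooth_on_fd_const smooth_F open_V)
  have A: "A x \<bullet> w = (\<Sum>l\<in>UNIV. h l x * lorentz (fd F x w) (E l x))" if "x \<in> V" for x w
  proof -
    have "fd F x w = (\<Sum>m\<in>UNIV. w $ m *\<^sub>R fd F x (axis m 1))"
      by (rule fd_eq_sum_axis[OF smooth_on_differentiable[OF smooth_F that]])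
    then show ?thesis
      by (simp add: A_def inner_vec_def sum_3 lorentz_simps algebra_simps)
  qed
  have Ae: "A x \<bullet> e j x = h j x" if "x \<in> V" for x j
    by (simp add: A[OF that] D_def[symmetric] EE[OF that] if_distrib cong: if_cong)
  have on_frame: "fd A x (e i x) \<bullet> e j x = fd A x (e j x) \<bullet> e i x" if x: "x \<in> V" for x i j
  proof -
    have *: "fd A x (e i x) \<bullet> e j x = D i (h j) x - A x \<bullet> fd (e j) x (e i x)" for i j
    proof -
      have "D i (h j) x = D i (\<lambda>x. A x \<bullet> e j x) x"
        using Ae by (intro D_cong[OF x]) simp
      also have "\<dots> = A x \<bullet> D i (e j) x + D i A x \<bullet> e j x"
        by (rule D_bilinear[OF bounded_bilinear_inner smooth_A smooth_e x])
      finally show ?thesis by (simp add: D_def)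
    qed
    have "A x \<bullet> (fd (e j) x (e i x) - fd (e i) x (e j x)) = (\<Sum>l\<in>UNIV. (\<omega> i j l x - \<omega> j i l x) * h l x)"
      unfolding A[OF x] bracket_frame[OF x] by (simp add: mult.commute)
    with closed[OF x, of i j] show ?thesis
      unfolding * by (simp add: inner_diff_right)
  qed
  have sym: "fd A x u \<bullet> v = fd A x v \<bullet> u" if x: "x \<in> V" for x u v
  proof -
    have linA: "linear (fd A x)"
      by (rule fd_linear[OF smooth_on_differentiable[OF smooth_A x]])
    have "fd A x (\<Sum>i\<in>UNIV. u' i *\<^sub>R e i x) \<bullet> (\<Sum>j\<in>UNIV. v' j *\<^sub>R e j x)
      = fd A x (\<Sum>j\<in>UNIV. v' j *\<^sub>R e j x) \<bullet> (\<Sum>i\<in>UNIV. u' i *\<^sub>R e i x)" for u' v'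
      using on_frame[OF x, of 1 2] on_frame[OF x, of 1 3] on_frame[OF x, of 2 3]
      by (simp add: sum_3 linear_add[OF linA] linear_scale[OF linA] inner_add_left inner_add_right algebra_simps)
    from this[of "\<lambda>i. lorentz (fd F x u) (E i x)" "\<lambda>i. lorentz (fd F x v) (E i x)"]
    show ?thesis unfolding frame_basis[OF x, symmetric] .
  qed
  obtain \<phi> where \<phi>: "\<And>x. x \<in> V \<Longrightarrow> (\<phi> has_derivative (\<lambda>v. A x \<bullet> v)) (at x)"
    using poincare_closed_field[OF open_V convex_V smooth_A sym] by blast
  show thesis
  proof
    let ?\<phi> = "\<lambda>x. \<phi> x + (s0 - \<phi> x0)"
    have d: "(?\<phi> has_derivative (\<lambda>v. A x \<bullet> v)) (at x)" if "x \<in> V" for x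
      using \<phi>[OF that] by (auto intro!: derivative_eq_intros)
    show "smooth_on V ?\<phi>"
      by (rule smooth_onI_fd[OF open_V d]) (auto intro!: smooth_on_inner open_V smooth_A smooth_on_const)
    show "D j ?\<phi> x = h j x" if "x \<in> V" for x j
      using Ae[OF that] by (simp add: D_def fd_eqI[OF d[OF that]])
  qed simp
qed

lemma D_chain:
  fixes f :: "real^3 \<Rightarrow> real"
  assumes "(h has_real_derivative h') (at (f x))" "smooth_on V f" "x \<in> V"
  shows "D j (\<lambda>x. h (f x)) x = h' * D j f x"
  unfolding D_def
  by (subst fd_eqI[OF has_derivative_compose[OF has_D[OF assms(2,3)] assms(1)[unfolded has_field_derivative_def]]]) simp

text \<open>The coframe form of \<open>e 1\<close> is closed because \<open>\<omega> i j 1\<close>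
  is symmetric in \<open>i\<close> and \<open>j\<close>.\<close>

lemma arc_length_function:
  assumes "x0 \<in> V"
  obtains s :: "real^3 \<Rightarrow> real" where "smooth_on V s" "\<And>x j. x \<in> V \<Longrightarrow> D j s x = (if j = 1 then 1 else 0)"
proof (rule frame_potential[where h="\<lambda>j x. if j = 1 then 1 else 0" and ?s0.0=0, OF _ _ assms])
  show "smooth_on V (\<lambda>x. if j = 1 then 1 else 0)" for j :: 3
    by (rule smooth_on_const)
  show "D i (\<lambda>x. if j = 1 then 1 else 0) x - D j (\<lambda>x. if i = 1 then 1 else 0) x =
      (\<Sum>l\<in>UNIV. (\<omega> i j l x - \<omega> j i l x) * (if l = 1 then 1 else 0))" if x: "x \<in> V" for x i j
  proof -
    have "\<forall>i j. \<omega> i j 1 x = \<omega> j i 1 x"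
      unfolding forall_3 by (simp add: \<omega>_all[OF x])
    then show ?thesis by (simp add: D_const sum_3)
  qed
next
  fix s :: "real^3 \<Rightarrow> real"
  assume s: "smooth_on V s" "\<And>x j. x \<in> V \<Longrightarrow> D j s x = (if j = 1 then 1 else 0)"
  show thesis by (rule that[OF s])
qed

text \<open>\<open>m\<close> will be the radius of the rotation in the plane of \<open>e i\<close>
  and \<open>t\<close> its angle. The form dual to \<open>e i\<close> is closed only after division
  by \<open>m\<close>; \<open>M\<close> is left free in order to normalise \<open>c i * m^2\<close>
  later. Taking \<open>m\<close> as an exponential keeps it positive.\<close>

lemma rotation_functions:
  assumes x0: "x0 \<in> V" and i: "i = 2 \<or> i = 3" and "M > 0"
  obtains m t where "smooth_on V m" "smooth_on V t" "\<And>x. x \<in> V \<Longrightarrow> m x > 0" "m x0 = M" "t x0 = 0"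
    "\<And>x j. x \<in> V \<Longrightarrow> D j m x = (if j = 1 then r i x * m x else 0)"
    "\<And>x j. x \<in> V \<Longrightarrow> D j t x = (if j = i then inverse (m x) else 0)"
proof -
  have i1: "i \<noteq> 1" using i by auto
  obtain \<phi> where \<phi>: "smooth_on V \<phi>" "\<phi> x0 = ln M" "\<And>x j. x \<in> V \<Longrightarrow> D j \<phi> x = (if j = 1 then r i x else 0)"
  proof (rule frame_potential[where h="\<lambda>j x. if j = 1 then r i x else 0" and ?s0.0="ln M", OF _ _ x0])
    show "smooth_on V (\<lambda>x. if j = 1 then r i x else 0)" for j :: 3
      using smooth_on_const smooth_r by (cases "j = 1") auto
    show "D i' (\<lambda>x. if j = 1 then r i x else 0) x - D j (\<lambda>x. if i' = 1 then r i x else 0) x =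
        (\<Sum>l\<in>UNIV. (\<omega> i' j l x - \<omega> j i' l x) * (if l = 1 then r i x else 0))" if x: "x \<in> V" for x i' j
    proof -
      have "\<forall>i j. \<omega> i j 1 x = \<omega> j i 1 x"
        unfolding forall_3 by (simp add: \<omega>_all[OF x])
      then show ?thesis
        by (cases "i' = 1"; cases "j = 1") (simp_all add: D_const sum_3 Dr_final[OF x i])
    qed
  next
    fix \<phi> assume "smooth_on V \<phi>" "\<phi> x0 = ln M" "\<And>x j. x \<in> V \<Longrightarrow> D j \<phi> x = (if j = 1 then r i x else 0)"
    then show thesis by (rule that)
  qed
  define m n where "m x = exp (\<phi> x)" and "n x = exp (- \<phi> x)" for x
  have sm: "smooth_on V m" "smooth_on V n"
    unfolding m_def[abs_def] n_def[abs_def]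
    by (rule smooth_on_chain_pair(1)[where ?h2.0=exp and c=1, OF open_V _ _ \<phi>(1)]
        smooth_on_chain_pair(1)[where ?h2.0=exp and c=1, OF open_V _ _ smooth_on_minus[OF open_V \<phi>(1)]]; simp)+
  have Dm: "D j m x = (if j = 1 then r i x * m x else 0)" if "x \<in> V" for x j
    using D_chain[OF DERIV_exp \<phi>(1) that, of j] by (simp add: m_def[abs_def] \<phi>(3)[OF that])
  have Dn: "D j n x = (if j = 1 then - r i x * n x else 0)" if "x \<in> V" for x j
    using D_chain[OF DERIV_exp smooth_on_minus[OF open_V \<phi>(1)] that, of j]
    by (simp add: n_def[abs_def] \<phi>(3)[OF that] D_minus[OF \<phi>(1) that])
  obtain t where t: "smooth_on V t" "t x0 = 0" "\<And>x j. x \<in> V \<Longrightarrow> D j t x = (if j = i then n x else 0)"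
  proof (rule frame_potential[where h="\<lambda>j x. if j = i then n x else 0" and ?s0.0=0, OF _ _ x0])
    show "smooth_on V (\<lambda>x. if j = i then n x else 0)" for j :: 3
      using smooth_on_const sm by (cases "j = i") auto
    show "D i' (\<lambda>x. if j = i then n x else 0) x - D j (\<lambda>x. if i' = i then n x else 0) x =
        (\<Sum>l\<in>UNIV. (\<omega> i' j l x - \<omega> j i' l x) * (if l = i then n x else 0))" if x: "x \<in> V" for x i' j
    proof -
      have "\<forall>i' j. D i' (\<lambda>x. if j = i then n x else 0) x - D j (\<lambda>x. if i' = i then n x else 0) x =
        (\<omega> i' j i x - \<omega> j i' i x) * n x"
        using i unfolding forall_3
        by (elim disjE) (simp_all add: \<omega>_all[OF x] D_const Dn[OF x])
      then show ?thesis by (simp add: if_distrib cong: if_cong)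
    qed
  next
    fix t assume "smooth_on V t" "t x0 = 0" "\<And>x j. x \<in> V \<Longrightarrow> D j t x = (if j = i then n x else 0)"
    then show thesis by (rule that)
  qed
  show thesis
  proof
    show "D j t x = (if j = i then inverse (m x) else 0)" if "x \<in> V" for x j
      using t(3)[OF that] by (simp add: m_def n_def exp_minus)
    show "m x > 0" "m x0 = M" for x
      using \<phi>(2) \<open>M > 0\<close> by (simp_all add: m_def)
  qed (fact sm t(1,2) Dm)+
qed

text \<open>For \<open>C = 1, -1, 0\<close> the pair \<open>(Sn, Cn)\<close> is \<open>(sin, cos)\<close>, \<open>(sinh, cosh)\<close>, \<open>(id, 1)\<close>.\<close>

lemma rotation_plane:
  assumes x0: "x0 \<in> V" and i: "i = 2 \<or> i = 3"
    and m: "smooth_on V m" "\<And>x. x \<in> V \<Longrightarrow> m x > 0"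
      "\<And>x j. x \<in> V \<Longrightarrow> D j m x = (if j = 1 then r i x * m x else 0)"
    and t: "smooth_on V t" "t x0 = 0"
      "\<And>x j. x \<in> V \<Longrightarrow> D j t x = (if j = i then inverse (m x) else 0)"
    and Sn: "\<And>y. (Sn has_real_derivative Cn y) (at y)" "Sn 0 = 0"
    and Cn: "\<And>y. (Cn has_real_derivative - C * Sn y) (at y)" "Cn 0 = 1"
    and pyth: "\<And>y. Cn y * Cn y + C * (Sn y * Sn y) = 1"
    and C: "c i x0 * (m x0)\<^sup>2 = C" and x: "x \<in> V"
  shows "c i x * (m x)\<^sup>2 = C"
    "lorentz (F x) (E i x0) = m x * Sn (t x)"
    "lorentz (F x) (m x0 *\<^sub>R \<xi> i x0) = - m x * Cn (t x)"
    "E i x = Cn (t x) *\<^sub>R E i x0 + (Sn (t x) * m x0) *\<^sub>R \<xi> i x0"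
proof -
  have i1: "i \<noteq> 1" using i by auto
  note smooths = smooth_on_chain_pair[OF open_V Sn(1) Cn(1) t(1)]
  have Cx: "c i x * (m x)\<^sup>2 = C" if "x \<in> V" for x
  proof -
    have "c i x * (m x)\<^sup>2 = c i x0 * (m x0)\<^sup>2"
    proof (rule constant_if_D_eq_0[OF _ _ that x0])
      show "smooth_on V (\<lambda>x. c i x * (m x)\<^sup>2)" by (intro smooth_rules smooth_c m)
      show "D j (\<lambda>x. c i x * (m x)\<^sup>2) x = 0" if "x \<in> V" for x j
        using that by (simp add: D_rules smooth_rules smooth_c m(1) m(3) Dc[OF that i] power2_eq_square)
    qed
    with C show ?thesis by simp
  qed
  then show "c i x * (m x)\<^sup>2 = C" using x .
  \<comment> \<open>The factor \<open>m\<close> cancels the shrinking of \<open>\<xi> i\<close>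
    along \<open>e 1\<close>, so \<open>E i\<close> and \<open>\<eta>\<close> change along
    \<open>e i\<close> only, where they rotate into each other.\<close>
  define \<eta> where "\<eta> x = m x *\<^sub>R \<xi> i x" for x
  have smooth_\<eta>: "smooth_on V \<eta>"
    unfolding \<eta>_def[abs_def] by (intro smooth_rules smooth_\<xi> m)
  have D\<eta>: "D j \<eta> x = (if j = i then - (C * inverse (m x)) *\<^sub>R E i x else 0)" if x: "x \<in> V" for x j
  proof -
    have "D j \<eta> x = m x *\<^sub>R D j (\<xi> i) x + D j m x *\<^sub>R \<xi> i x"
      unfolding \<eta>_def[abs_def] by (rule D_scaleR[OF m(1) smooth_\<xi> x])
    moreover have "m x * c i x = C * inverse (m x)"
      using Cx[OF x] m(2)[OF x] by (simp add: field_simps power2_eq_square)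
    ultimately show ?thesis
      using i1 by (simp add: D\<xi>[OF x i] m(3)[OF x])
  qed
  have DE: "D j (E i) x = (if j = i then inverse (m x) *\<^sub>R \<eta> x else 0)" if "x \<in> V" for x j
    using m(2)[OF that] by (simp add: DE_final[OF that i] \<eta>_def)
  have DSn: "D j (\<lambda>x. Sn (t x)) x = (if j = i then Cn (t x) * inverse (m x) else 0)" if "x \<in> V" for x j
    using D_chain[OF Sn(1) t(1) that, of j] t(3)[OF that] by simp
  have DCn: "D j (\<lambda>x. Cn (t x)) x = (if j = i then - (C * Sn (t x) * inverse (m x)) else 0)" if "x \<in> V" for x j
    using D_chain[OF Cn(1) t(1) that, of j] t(3)[OF that] by simp
  note rules = D_rules smooth_rules smooths smooth_\<eta> D\<eta> DE DSn DCn
  \<comment> \<open>Turning the pair back by the angle \<open>t\<close> makes it constant, hence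
    equal to its value at \<open>x0\<close>, where \<open>t = 0\<close>.\<close>
  have X1: "Cn (t x) *\<^sub>R E i x - Sn (t x) *\<^sub>R \<eta> x = E i x0"
  proof -
    have "Cn (t x) *\<^sub>R E i x - Sn (t x) *\<^sub>R \<eta> x = Cn (t x0) *\<^sub>R E i x0 - Sn (t x0) *\<^sub>R \<eta> x0"
    proof (rule constant_if_D_eq_0[OF _ _ x x0])
      show "smooth_on V (\<lambda>x. Cn (t x) *\<^sub>R E i x - Sn (t x) *\<^sub>R \<eta> x)" by (intro smooth_rules smooths smooth_\<eta>)
      show "D j (\<lambda>x. Cn (t x) *\<^sub>R E i x - Sn (t x) *\<^sub>R \<eta> x) x = 0" if "x \<in> V" for x j
        using that by (simp add: rules)
    qed
    then show ?thesis by (simp add: t Sn(2) Cn(2))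
  qed
  have X2: "(C * Sn (t x)) *\<^sub>R E i x + Cn (t x) *\<^sub>R \<eta> x = \<eta> x0"
  proof -
    have "(C * Sn (t x)) *\<^sub>R E i x + Cn (t x) *\<^sub>R \<eta> x = (C * Sn (t x0)) *\<^sub>R E i x0 + Cn (t x0) *\<^sub>R \<eta> x0"
    proof (rule constant_if_D_eq_0[OF _ _ x x0])
      show "smooth_on V (\<lambda>x. (C * Sn (t x)) *\<^sub>R E i x + Cn (t x) *\<^sub>R \<eta> x)" by (intro smooth_rules smooths smooth_\<eta>)
      show "D j (\<lambda>x. (C * Sn (t x)) *\<^sub>R E i x + Cn (t x) *\<^sub>R \<eta> x) x = 0" if "x \<in> V" for x j
        using that by (simp add: rules algebra_simps)
    qed
    then show ?thesis by (simp add: t Sn(2) Cn(2))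
  qed
  have F: "lorentz (F x) (E i x) = 0" "lorentz (F x) (\<eta> x) = - m x"
    using EF[OF x, of i] \<xi>_lorentz(1)[OF x, of i] by (simp_all add: \<eta>_def lorentz_simps lorentz_commute)
  show "lorentz (F x) (E i x0) = m x * Sn (t x)"
    unfolding X1[symmetric] by (simp add: lorentz_simps F)
  have "lorentz (F x) (\<eta> x0) = - m x * Cn (t x)"
    unfolding X2[symmetric] by (simp add: lorentz_simps F)
  then show "lorentz (F x) (m x0 *\<^sub>R \<xi> i x0) = - m x * Cn (t x)"
    by (simp add: \<eta>_def)
  have "Cn (t x) *\<^sub>R E i x0 + Sn (t x) *\<^sub>R \<eta> x0
      = (Cn (t x) * Cn (t x) + C * (Sn (t x) * Sn (t x))) *\<^sub>R E i x"
    unfolding X1[symmetric] X2[symmetric] by (simp add: algebra_simps)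
  then show "E i x = Cn (t x) *\<^sub>R E i x0 + (Sn (t x) * m x0) *\<^sub>R \<xi> i x0"
    unfolding pyth by (simp add: \<eta>_def)
qed

end

section \<open>Adapted coordinates\<close>

text \<open>The form of \<open>locally_congruent_at\<close> that speaks of the parameter domain
  only; \<open>locally_congruent_atI\<close> composes \<open>\<psi>\<close> with the chart.\<close>

definition congruent_piece ::
  "(real^3) set \<Rightarrow> (real^3 \<Rightarrow> real^5) \<Rightarrow> real^3 \<Rightarrow> (real \<Rightarrow> real \<Rightarrow> real \<Rightarrow> real^5) \<Rightarrow> real set \<Rightarrow> bool" where
  "congruent_piece V F x0 fam I \<longleftrightarrow> (\<exists>(B :: (real^3) set) \<psi> \<Psi> T. open B \<and> \<psi> ` B \<subseteq> V \<and> open (\<psi> ` B) \<and>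
     homeomorphism (\<psi> ` B) B \<Psi> \<psi> \<and> x0 \<in> \<psi> ` B \<and> smooth_on B (\<lambda>y. F (\<psi> y)) \<and>
     (\<forall>y\<in>B. inj (fd (\<lambda>y. F (\<psi> y)) y) \<and> y $ 1 \<in> I) \<and> lorentz_isometry T \<and>
     (\<forall>y\<in>B. F (\<psi> y) = T (fam (y $ 1) (y $ 2) (y $ 3))))"

lemma lorentz_orthonormal_parseval:
  assumes "lorentz_orthonormal b"
  shows "lorentz v v = - (lorentz v (b 1))\<^sup>2 + (lorentz v (b 2))\<^sup>2 + (lorentz v (b 3))\<^sup>2
    + (lorentz v (b 4))\<^sup>2 + (lorentz v (b 5))\<^sup>2"
proof -
  have "lorentz v v = lorentz v (\<Sum>i\<in>UNIV. ((if i = 1 then -1 else 1) * lorentz v (b i)) *\<^sub>R b i)"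
    using lorentz_orthonormal_expansion[OF assms, of v] by (rule arg_cong)
  then show ?thesis
    by (simp add: sum_5 lorentz_simps power2_eq_square)
qed

lemma fd_vec_lambda:
  fixes g :: "'n::finite \<Rightarrow> 'a::euclidean_space \<Rightarrow> real"
  assumes "\<And>i. g i differentiable (at x)"
  shows "((\<lambda>x. \<chi> i. g i x) has_derivative (\<lambda>v. \<chi> i. fd (g i) x v)) (at x)"
proof -
  have eq: "(\<chi> i. h i) = (\<Sum>i\<in>UNIV. h i *\<^sub>R axis i 1)" for h :: "'n \<Rightarrow> real"
    by (auto simp: vec_eq_iff axis_def if_distrib cong: if_cong)
  show ?thesis
    unfolding eq by (intro has_derivative_sum has_derivative_scaleR_left has_fd assms)
qed

context principal_frame
begin

text \<open>The differentials of \<open>\<sigma>\<close>, \<open>t2\<close>, \<open>t3\<close> are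
  diagonal in the frame, so these functions are local coordinates, and whatever is constant along
  \<open>e 2\<close> and \<open>e 3\<close> is a function of \<open>\<sigma>\<close> alone, read off
  on the curve \<open>\<theta>\<close>. The speed \<open>\<delta>\<close> is general because the
  third family uses a radius instead of arc length as parameter.\<close>

lemma rotation_coordinates:
  assumes x0: "x0 \<in> V"
    and \<sigma>: "smooth_on V \<sigma>" "smooth_on V \<delta>" "\<And>x. x \<in> V \<Longrightarrow> \<delta> x \<noteq> 0"
      "\<And>x j. x \<in> V \<Longrightarrow> D j \<sigma> x = (if j = 1 then \<delta> x else 0)"
    and m2: "smooth_on V m2" "\<And>x. x \<in> V \<Longrightarrow> m2 x > 0"
    and t2: "smooth_on V t2" "\<And>x j. x \<in> V \<Longrightarrow> D j t2 x = (if j = 2 then inverse (m2 x) else 0)"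
    and m3: "smooth_on V m3" "\<And>x. x \<in> V \<Longrightarrow> m3 x > 0"
    and t3: "smooth_on V t3" "\<And>x j. x \<in> V \<Longrightarrow> D j t3 x = (if j = 3 then inverse (m3 x) else 0)"
  obtains P \<theta> c0 c1 where "\<And>x. x \<in> P \<Longrightarrow> x \<in> V"
    "\<And>s. s \<in> {c0<..<c1} \<Longrightarrow> \<theta> s \<in> V" "\<And>s. s \<in> {c0<..<c1} \<Longrightarrow> \<sigma> (\<theta> s) = s"
    "\<And>h::real^3 \<Rightarrow> real. smooth_on V h \<Longrightarrow> smooth_on {c0<..<c1} (\<lambda>s. h (\<theta> s))"
    "\<And>(h::real^3 \<Rightarrow> real) s. smooth_on V h \<Longrightarrow> s \<in> {c0<..<c1} \<Longrightarrow>
       ((\<lambda>s. h (\<theta> s)) has_real_derivative D 1 h (\<theta> s) / \<delta> (\<theta> s)) (at s)"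
    "\<And>(h::real^3 \<Rightarrow> real) x. smooth_on V h \<Longrightarrow> (\<And>x. x \<in> V \<Longrightarrow> D 2 h x = 0) \<Longrightarrow>
       (\<And>x. x \<in> V \<Longrightarrow> D 3 h x = 0) \<Longrightarrow> x \<in> P \<Longrightarrow> h (\<theta> (\<sigma> x)) = h x"
    "\<And>T fam. lorentz_isometry T \<Longrightarrow> (\<And>x. x \<in> P \<Longrightarrow> F x = T (fam (\<sigma> x) (t2 x) (t3 x))) \<Longrightarrow>
       congruent_piece V F x0 fam {c0<..<c1}"
proof -
  define g where "g i = (if i = 1 then \<sigma> else if i = 2 then t2 else t3)" for i :: 3
  define d where "d i = (if i = 1 then \<delta> else if i = 2 then \<lambda>x. inverse (m2 x) else (\<lambda>x. inverse (m3 x)))" for i :: 3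
  have mn: "m2 x \<noteq> 0" "m3 x \<noteq> 0" if "x \<in> V" for x
    using m2(2)[OF that] m3(2)[OF that] by auto
  have g: "smooth_on V (g i)" for i
    using \<sigma>(1) t2(1) t3(1) by (simp add: g_def)
  have d: "smooth_on V (d i)" for i
    using \<sigma>(2) smooth_on_inverse[OF open_V m2(1) mn(1)] smooth_on_inverse[OF open_V m3(1) mn(2)]
    by (simp add: d_def)
  have d0: "d i x \<noteq> 0" if "x \<in> V" for i x
    using \<sigma>(3)[OF that] mn[OF that] by (simp add: d_def)
  have Dg: "D j (g i) x = (if i = j then d i x else 0)" if "x \<in> V" for i j x
  proof -
    have "\<forall>i j. D j (g i) x = (if i = j then d i x else 0)"
      unfolding forall_3 by (simp add: g_def d_def \<sigma>(4)[OF that] t2(2)[OF that] t3(2)[OF that])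
    then show ?thesis by blast
  qed
  define \<Psi> :: "real^3 \<Rightarrow> real^3" where "\<Psi> x = (\<chi> i. g i x)" for x
  \<comment> \<open>The derivative of the inverse chart in direction \<open>v\<close>, written as a
    field on \<open>V\<close> in the shape that \<open>smooth_on_compose_field\<close> asks
    for.\<close>
  define W where "W v x = (\<Sum>i\<in>UNIV. (v $ i / d i x) *\<^sub>R e i x)" for v :: "real^3" and x
  have smooth_\<Psi>: "smooth_on V \<Psi>"
    unfolding \<Psi>_def[abs_def] by (rule smooth_on_vec_lambda[OF open_V g])
  have smooth_W: "smooth_on V (W v)" for v
    unfolding W_def[abs_def]
    by (intro smooth_on_sum smooth_on_scaleR smooth_on_divide smooth_on_const smooth_e open_V d d0)
  have fd_\<Psi>: "fd \<Psi> x w $ i = lorentz (fd F x w) (E i x) * d i x" if x: "x \<in> V" for x w i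
  proof -
    have "fd \<Psi> x w = (\<chi> i. fd (g i) x w)"
      unfolding \<Psi>_def[abs_def] by (simp add: fd_eqI[OF fd_vec_lambda[OF smooth_on_differentiable[OF g x]]])
    then show ?thesis
      by (simp add: fd_frame[OF g x, of i w] Dg[OF x] if_distrib cong: if_cong)
  qed
  have lin_\<Psi>: "linear (fd \<Psi> x)" if "x \<in> V" for x
    by (rule fd_linear[OF smooth_on_differentiable[OF smooth_\<Psi> that]])
  have inj_\<Psi>: "inj (fd \<Psi> x)" if x: "x \<in> V" for x
  proof -
    have "w = 0" if "fd \<Psi> x w = 0" for w
    proof -
      have "lorentz (fd F x w) (E i x) = 0" for i
        using fd_\<Psi>[OF x, of w i] that d0[OF x, of i] by simp
      then show "w = 0" by (subst frame_basis[OF x, of w]) simp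
    qed
    then show ?thesis using linear_injective_0[OF lin_\<Psi>[OF x]] by blast
  qed
  have inv_\<Psi>: "inv (fd \<Psi> x) = (\<lambda>v. W v x)" if x: "x \<in> V" for x
  proof
    fix v
    have linF: "linear (fd F x)"
      by (rule fd_linear[OF smooth_on_differentiable[OF smooth_F x]])
    have "fd F x (W v x) = (\<Sum>i\<in>UNIV. (v $ i / d i x) *\<^sub>R E i x)"
      by (simp add: W_def linear_sum[OF linF] linear_scale[OF linF] D_def)
    then have "fd \<Psi> x (W v x) $ i = v $ i" for i
      unfolding fd_\<Psi>[OF x]
      by (simp add: EE[OF x] d0[OF x] lorentz.sum_left lorentz_simps if_distrib cong: if_cong)
    then have "fd \<Psi> x (W v x) = v" by (simp add: vec_eq_iff)
    then show "inv (fd \<Psi> x) v = W v x" by (rule inv_f_eq[OF inj_\<Psi>[OF x]])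
  qed
  obtain l u \<psi> where box: "\<Psi> x0 \<in> box l u" "\<psi> ` box l u \<subseteq> V" "open (\<psi> ` box l u)"
    "homeomorphism (\<psi> ` box l u) (box l u) \<Psi> \<psi>" "\<psi> (\<Psi> x0) = x0"
    "\<And>y. y \<in> box l u \<Longrightarrow> (\<psi> has_derivative inv (fd \<Psi> (\<psi> y))) (at y)"
    using local_coordinates_box[OF open_V smooth_\<Psi> x0 inj_\<Psi>] by blast
  have \<psi>V: "\<psi> y \<in> V" if "y \<in> box l u" for y using box(2) that by blast
  have \<psi>': "(\<psi> has_derivative (\<lambda>v. W v (\<psi> y))) (at y)" if "y \<in> box l u" for y
    using box(6)[OF that] unfolding inv_\<Psi>[OF \<psi>V[OF that]] .
  have \<Psi>\<psi>: "\<Psi> (\<psi> y) = y" if "y \<in> box l u" for y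
    using box(4) that by (simp add: homeomorphism_def)
  \<comment> \<open>The coordinate line through \<open>\<Psi> x0\<close> in the first
    direction.\<close>
  define z where "z s = (\<chi> i. if i = 1 then s else \<Psi> x0 $ i)" for s :: real
  have z_box: "z s \<in> box l u" if "s \<in> {l $ 1<..<u $ 1}" for s
    using box(1) that by (auto simp: z_def mem_box_cart)
  have z': "(z has_derivative (\<lambda>v. v *\<^sub>R axis 1 1)) (at s)" for s
  proof -
    have "z = (\<lambda>s. \<Psi> x0 + (s - \<Psi> x0 $ 1) *\<^sub>R axis 1 1)"
      by (auto simp: z_def vec_eq_iff axis_def fun_eq_iff)
    then show ?thesis by (auto intro!: derivative_eq_intros)
  qed
  define \<theta> where "\<theta> s = \<psi> (z s)" for s
  have \<theta>V: "\<theta> s \<in> V" if "s \<in> {l $ 1<..<u $ 1}" for s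
    unfolding \<theta>_def by (rule \<psi>V[OF z_box[OF that]])
  have \<theta>': "(\<theta> has_derivative (\<lambda>v. W (v *\<^sub>R axis 1 1) (\<theta> s))) (at s)" if "s \<in> {l $ 1<..<u $ 1}" for s
    unfolding \<theta>_def by (rule has_derivative_compose[OF z' \<psi>'[OF z_box[OF that]]])
  have fd_W: "fd h x (W v x) = (\<Sum>i\<in>UNIV. (v $ i / d i x) * D i h x)" if "smooth_on V h" "x \<in> V"
    for h :: "real^3 \<Rightarrow> real" and v x
  proof -
    have lin: "linear (fd h x)" by (rule fd_linear[OF smooth_on_differentiable[OF that]])
    show ?thesis by (simp add: W_def linear_sum[OF lin] linear_scale[OF lin] D_def)
  qed
  have h\<psi>': "((\<lambda>y. h (\<psi> y)) has_derivative (\<lambda>v. \<Sum>i\<in>UNIV. (v $ i / d i (\<psi> y)) * D i h (\<psi> y))) (at y)"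
    if "smooth_on V h" "y \<in> box l u" for h :: "real^3 \<Rightarrow> real" and y
    using has_derivative_compose[OF \<psi>'[OF that(2)] smooth_on_has_fd[OF that(1) \<psi>V[OF that(2)]]]
    unfolding fd_W[OF that(1) \<psi>V[OF that(2)]] .
  have g\<psi>: "\<sigma> (\<psi> y) = y $ 1" "t2 (\<psi> y) = y $ 2" "t3 (\<psi> y) = y $ 3" if "y \<in> box l u" for y
    using \<Psi>\<psi>[OF that] by (auto simp: \<Psi>_def vec_eq_iff forall_3 g_def)
  show thesis
  proof (rule that[of "\<psi> ` box l u" "l $ 1" "u $ 1" \<theta>])
    show "x \<in> V" if "x \<in> \<psi> ` box l u" for x using that box(2) by blast
    show "\<theta> s \<in> V" if "s \<in> {l $ 1<..<u $ 1}" for s by (rule \<theta>V[OF that])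
    show "\<sigma> (\<theta> s) = s" if "s \<in> {l $ 1<..<u $ 1}" for s
      using g\<psi>(1)[OF z_box[OF that]] by (simp add: \<theta>_def z_def)
    show "smooth_on {l $ 1<..<u $ 1} (\<lambda>s. h (\<theta> s))" if "smooth_on V h" for h :: "real^3 \<Rightarrow> real"
      by (rule smooth_on_compose_field[OF _ open_V _ \<theta>' smooth_W that]) (use \<theta>V in auto)
    show "((\<lambda>s. h (\<theta> s)) has_real_derivative D 1 h (\<theta> s) / \<delta> (\<theta> s)) (at s)"
      if "smooth_on V h" "s \<in> {l $ 1<..<u $ 1}" for h :: "real^3 \<Rightarrow> real" and s
      unfolding has_field_derivative_def
      by (rule has_derivative_eq_rhs[OF has_derivative_compose[OF \<theta>'[OF that(2)] smooth_on_has_fd[OF that(1) \<theta>V[OF that(2)]]]])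
        (simp add: fd_W[OF that(1) \<theta>V[OF that(2)]] sum_3 axis_def fun_eq_iff d_def)
    show "h (\<theta> (\<sigma> x)) = h x"
      if h: "smooth_on V h" "\<And>x. x \<in> V \<Longrightarrow> D 2 h x = 0" "\<And>x. x \<in> V \<Longrightarrow> D 3 h x = 0" and x: "x \<in> \<psi> ` box l u"
      for h :: "real^3 \<Rightarrow> real" and x
    proof -
      obtain y where y: "y \<in> box l u" "x = \<psi> y" using x by blast
      \<comment> \<open>A segment in the slice with fixed first coordinate, from the coordinate line
        to \<open>y\<close>; along it \<open>h\<close> could change only through its
        \<open>e 2\<close>- and \<open>e 3\<close>-derivatives.\<close>
      define w where "w \<tau> = z (y $ 1) + \<tau> *\<^sub>R (y - z (y $ 1))" for \<tau> :: real
      have zy: "z (y $ 1) \<in> box l u" using z_box y(1) by (simp add: mem_box_cart)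
      have w: "w \<tau> \<in> box l u" if "\<tau> \<in> {0..1}" for \<tau>
        using convexD_alt[OF convex_box(2) zy y(1), of \<tau>] that by (simp add: w_def algebra_simps)
      have "((\<lambda>\<tau>. h (\<psi> (w \<tau>))) has_derivative (\<lambda>_. 0)) (at \<tau> within {0..1})" if "\<tau> \<in> {0..1}" for \<tau>
      proof -
        have "(w has_derivative (\<lambda>r. r *\<^sub>R (y - z (y $ 1)))) (at \<tau>)"
          unfolding w_def by (auto intro!: derivative_eq_intros)
        from has_derivative_compose[OF this h\<psi>'[OF h(1) w[OF that]]]
        have "((\<lambda>\<tau>. h (\<psi> (w \<tau>))) has_derivative (\<lambda>_. 0)) (at \<tau>)"
          using h(2,3)[OF \<psi>V[OF w[OF that]]] by (simp add: sum_3 z_def)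
        then show ?thesis by (rule has_derivative_at_withinI)
      qed
      then have "h (\<psi> (w 1)) = h (\<psi> (w 0))"
        by (intro has_derivative_zero_unique[of "{0..1::real}" "\<lambda>\<tau>. h (\<psi> (w \<tau>))"]) auto
      then show ?thesis by (simp add: w_def \<theta>_def y(2) g\<psi>(1)[OF y(1)])
    qed
    show "congruent_piece V F x0 fam {l $ 1<..<u $ 1}"
      if T: "lorentz_isometry T" "\<And>x. x \<in> \<psi> ` box l u \<Longrightarrow> F x = T (fam (\<sigma> x) (t2 x) (t3 x))" for T fam
      unfolding congruent_piece_def
    proof (rule exI[of _ "box l u"], rule exI[of _ \<psi>], rule exI[of _ \<Psi>], rule exI[of _ T], intro conjI ballI)
      show "F (\<psi> y) = T (fam (y $ 1) (y $ 2) (y $ 3))" if "y \<in> box l u" for y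
        using T(2)[of "\<psi> y"] that g\<psi>[OF that] by simp
      show "smooth_on (box l u) (\<lambda>y. F (\<psi> y))"
        by (rule smooth_on_compose_field[OF _ open_V box(2) \<psi>' smooth_W smooth_F]) (rule open_box)
      show "x0 \<in> \<psi> ` box l u" using box(1,5) by (metis imageI)
      show "y $ 1 \<in> {l $ 1<..<u $ 1}" if "y \<in> box l u" for y
        using that by (simp add: mem_box_cart)
      show "inj (fd (\<lambda>y. F (\<psi> y)) y)" if y: "y \<in> box l u" for y
      proof -
        have "fd (\<lambda>y. F (\<psi> y)) y = (\<lambda>v. fd F (\<psi> y) (inv (fd \<Psi> (\<psi> y)) v))"
          by (rule fd_eqI[OF has_derivative_compose[OF box(6)[OF y] smooth_on_has_fd[OF smooth_F \<psi>V[OF y]]]])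
        moreover have "inj (fd F (\<psi> y))"
        proof -
          have "w = 0" if "fd F (\<psi> y) w = 0" for w
            by (subst frame_basis[OF \<psi>V[OF y], of w]) (simp add: that lorentz_simps)
          then show ?thesis
            using linear_injective_0[OF fd_linear[OF smooth_on_differentiable[OF smooth_F \<psi>V[OF y]]]] by blast
        qed
        moreover have "inj (inv (fd \<Psi> (\<psi> y)))"
          using linear_injective_imp_surjective[OF lin_\<Psi>[OF \<psi>V[OF y]] inj_\<Psi>[OF \<psi>V[OF y]]]
          by (simp add: surj_imp_inj_inv)
        ultimately show ?thesis
          using inj_compose[of "fd F (\<psi> y)" "inv (fd \<Psi> (\<psi> y))"] by (simp add: comp_def)
      qed
    qed (fact open_box box T)+
  qed
qed

text \<open>Supplies the fifth direction, orthogonal to both constant planes. It is timelike,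
  spacelike or null according to the sign of \<open>c 2 * c 3\<close>, which is why
  \<open>c 3 = 0\<close> needs another basis.\<close>

lemma axis_vector:
  assumes x: "x \<in> V"
  obtains z where "lorentz z (E 2 x) = 0" "lorentz z (E 3 x) = 0" "lorentz z (\<xi> 2 x) = 0" "lorentz z (\<xi> 3 x) = 0"
    "lorentz z z = - (c 2 x * c 3 x)"
proof -
  note E = EE[OF x] EN[OF x] EF[OF x] FF[OF x] NN[OF x] FN[OF x]
  have E': "lorentz (N x) (E i x) = 0" "lorentz (F x) (E i x) = 0" "lorentz (N x) (F x) = 0" for i
    using E(2)[of i] E(3)[of i] E(6) by (simp_all only: lorentz_commute)
  \<comment> \<open>The coefficients of the Lorentzian cross product of \<open>\<xi> 2\<close> and
    \<open>\<xi> 3\<close> in the span of \<open>F\<close>, \<open>N\<close>, \<open>E 1\<close>.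
    Its squared length is minus their Gram determinant, whose off-diagonal entry vanishes by the
    Gauss equation.\<close>
  let ?f = "r 3 x * k 2 x - r 2 x * k 3 x" and ?n = "r 3 x - r 2 x" and ?e = "k 3 x - k 2 x"
  let ?z = "?f *\<^sub>R F x + ?n *\<^sub>R N x + ?e *\<^sub>R E 1 x"
  have "lorentz ?z ?z = - (?f * ?f) + ?n * ?n + ?e * ?e"
    by (simp add: lorentz_simps E E') (simp add: algebra_simps)
  also have "\<dots> = - (c 2 x * c 3 x) + (r 2 x * r 3 x + k 2 x * k 3 x - 1) * (r 2 x * r 3 x + k 2 x * k 3 x - 1)"
    by (simp add: c_def power2_eq_square algebra_simps)
  also have "\<dots> = - (c 2 x * c 3 x)"
    using gauss[OF x] by simp
  finally show thesis
    by (intro that[of ?z]) (simp_all add: \<xi>_def lorentz_simps E E' algebra_simps)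
qed

lemma base_frame_lorentz:
  assumes x: "x \<in> V"
  shows "lorentz (E 2 x) (E 2 x) = 1" "lorentz (E 3 x) (E 3 x) = 1" "lorentz (E 2 x) (E 3 x) = 0"
    "lorentz (E 3 x) (E 2 x) = 0" "lorentz (\<xi> i x) (\<xi> i x) = c i x" "lorentz (\<xi> 2 x) (\<xi> 3 x) = 0"
    "lorentz (\<xi> 3 x) (\<xi> 2 x) = 0" "lorentz (E 2 x) (\<xi> i x) = 0" "lorentz (E 3 x) (\<xi> i x) = 0"
    "lorentz (\<xi> i x) (E 2 x) = 0" "lorentz (\<xi> i x) (E 3 x) = 0"
  using \<xi>_lorentz(4)[OF x, of 2 i] \<xi>_lorentz(4)[OF x, of 3 i] \<xi>_lorentz(3)[OF x]
  by (simp_all add: EE[OF x] \<xi>_lorentz[OF x] lorentz_commute)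

end

section \<open>Identification of the families\<close>

lemma arc_length_curve_H2I:
  fixes f1 f2 f3 :: "real \<Rightarrow> real"
  assumes "open I" "smooth_on I f1" "smooth_on I f2" "smooth_on I f3"
    and f': "\<And>s. s \<in> I \<Longrightarrow> (f1 has_real_derivative g1 s) (at s)"
      "\<And>s. s \<in> I \<Longrightarrow> (f2 has_real_derivative g2 s) (at s)"
      "\<And>s. s \<in> I \<Longrightarrow> (f3 has_real_derivative g3 s) (at s)"
    and f: "\<And>s. s \<in> I \<Longrightarrow> - (f1 s)\<^sup>2 + (f2 s)\<^sup>2 + (f3 s)\<^sup>2 = -1"
    and g: "\<And>s. s \<in> I \<Longrightarrow> - (g1 s)\<^sup>2 + (g2 s)\<^sup>2 + (g3 s)\<^sup>2 = 1"
  shows "arc_length_curve_H2 I (\<lambda>s. vector [f1 s, f2 s, f3 s])"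
proof -
  let ?\<alpha> = "\<lambda>s. vector [f1 s, f2 s, f3 s] :: real^3"
  have eq: "vector [a, b, c] = (a *\<^sub>R axis 1 1 + b *\<^sub>R axis 2 1 + c *\<^sub>R axis 3 1 :: real^3)" for a b c :: real
    by (simp add: vec_eq_iff forall_3 axis_def)
  have "smooth_on I ?\<alpha>"
    unfolding eq by (intro smooth_on_add smooth_on_scaleR smooth_on_const assms(1-4))
  moreover have "vector_derivative ?\<alpha> (at s) = vector [g1 s, g2 s, g3 s]" if "s \<in> I" for s
    unfolding eq
    by (rule vector_derivative_at)
      (auto intro!: derivative_eq_intros f'[OF that])
  ultimately show ?thesis
    unfolding arc_length_curve_H2_def hyp_space_def
    using f g by (simp add: lorentz_3 power2_eq_square)
qed

text \<open>The factor 1 is written out to match the hypotheses of \<open>rotation_plane\<close>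
  with \<open>C = 1\<close>; \<open>hyperbolic\<close> does the same for
  \<open>C = -1\<close>.\<close>

lemma trig:
  fixes y :: real
  shows "(sin has_real_derivative cos y) (at y)" "(cos has_real_derivative - 1 * sin y) (at y)"
    "cos y * cos y + 1 * (sin y * sin y) = 1"
  using sin_cos_squared_add3[of y] by (auto intro!: derivative_eq_intros)

lemma hyperbolic:
  fixes y :: real
  shows "(sinh has_real_derivative cosh y) (at y)" "(cosh has_real_derivative - (- 1) * sinh y) (at y)"
    "cosh y * cosh y + - 1 * (sinh y * sinh y) = 1"
  using cosh_square_eq[of y] by (auto intro!: derivative_eq_intros simp: power2_eq_square)

lemma scaled_pythagoras:
  fixes A Cy Sy C :: real
  assumes "Cy * Cy + C * (Sy * Sy) = 1"
  shows "A * Cy * (A * Cy) + C * (A * Sy * (A * Sy)) = A * A"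
proof -
  have "A * Cy * (A * Cy) + C * (A * Sy * (A * Sy)) = (A * A) * (Cy * Cy + C * (Sy * Sy))"
    by (simp only: distrib_left mult_ac)
  then show ?thesis by (simp only: assms mult_1_right)
qed

lemmas circle_norm = scaled_pythagoras[OF trig(3), simplified]

context principal_frame
begin

lemma D_height: "x \<in> V \<Longrightarrow> D j (\<lambda>x. lorentz (F x) w) x = lorentz (E j x) w"
  by (simp add: D_lorentz smooth_rules D_const lorentz_simps)

lemma E_height:
  assumes "\<And>y. y \<in> V \<Longrightarrow> lorentz (F y) w = f y" "x \<in> V"
  shows "lorentz (E j x) w = D j f x"
proof -
  have "D j (\<lambda>x. lorentz (F x) w) x = D j f x"
    using assms by (intro D_cong)
  then show ?thesis by (simp add: D_height[OF assms(2)])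
qed

text \<open>Treats the first two families at once: the plane of \<open>e 2\<close> carries circles,
  that of \<open>e 3\<close> circles for \<open>C = 1\<close> and hyperbolas for
  \<open>C = -1\<close>. \<open>f2\<close> and \<open>f3\<close> are the radii, \<open>f1\<close> is
  the coordinate along the axis orthogonal to both planes.\<close>

lemma two_rotations:
  assumes x0: "x0 \<in> V" and c2: "c 2 x0 > 0" and C: "C = 1 \<or> C = -1" "C * c 3 x0 > 0"
    and Sn: "\<And>y. (Sn has_real_derivative Cn y) (at y)" "Sn 0 = 0"
    and Cn: "\<And>y. (Cn has_real_derivative - C * Sn y) (at y)" "Cn 0 = 1"
    and pyth: "\<And>y. Cn y * Cn y + C * (Sn y * Sn y) = 1"
  obtains f1 f2 f3 g1 g2 g3 c0 c1 where
    "smooth_on {c0<..<c1} f1" "smooth_on {c0<..<c1} f2" "smooth_on {c0<..<c1} f3"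
    "\<And>s. s \<in> {c0<..<c1} \<Longrightarrow> (f1 has_real_derivative g1 s) (at s)"
    "\<And>s. s \<in> {c0<..<c1} \<Longrightarrow> (f2 has_real_derivative g2 s) (at s)"
    "\<And>s. s \<in> {c0<..<c1} \<Longrightarrow> (f3 has_real_derivative g3 s) (at s)"
    "\<And>s. s \<in> {c0<..<c1} \<Longrightarrow> (f2 s)\<^sup>2 + C * (f3 s)\<^sup>2 - C * (f1 s)\<^sup>2 = -1"
    "\<And>s. s \<in> {c0<..<c1} \<Longrightarrow> (g2 s)\<^sup>2 + C * (g3 s)\<^sup>2 - C * (g1 s)\<^sup>2 = 1"
    "\<And>fam. (\<And>s t u. fam s t u = (if C = 1
        then vector [f1 s, f2 s * cos t, f2 s * sin t, f3 s * Cn u, f3 s * Sn u]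
        else vector [f3 s * Cn u, f3 s * Sn u, f2 s * cos t, f2 s * sin t, f1 s])) \<Longrightarrow>
      congruent_piece V F x0 fam {c0<..<c1}"
proof -
  have CC: "C * C = 1" "C \<noteq> 0" using C(1) by auto
  \<comment> \<open>These initial radii turn the conserved quantities \<open>c i * m^2\<close> into
    1 and \<open>C\<close>.\<close>
  have M: "inverse (sqrt (c 2 x0)) > 0" "inverse (sqrt (C * c 3 x0)) > 0" using c2 C by simp_all
  obtain m2 t2 where m2: "smooth_on V m2" "smooth_on V t2" "\<And>x. x \<in> V \<Longrightarrow> m2 x > 0"
    "m2 x0 = inverse (sqrt (c 2 x0))" "t2 x0 = 0"
    "\<And>x j. x \<in> V \<Longrightarrow> D j m2 x = (if j = 1 then r 2 x * m2 x else 0)"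
    "\<And>x j. x \<in> V \<Longrightarrow> D j t2 x = (if j = 2 then inverse (m2 x) else 0)"
    using rotation_functions[of x0 2, OF x0 _ M(1)] by blast
  obtain m3 t3 where m3: "smooth_on V m3" "smooth_on V t3" "\<And>x. x \<in> V \<Longrightarrow> m3 x > 0"
    "m3 x0 = inverse (sqrt (C * c 3 x0))" "t3 x0 = 0"
    "\<And>x j. x \<in> V \<Longrightarrow> D j m3 x = (if j = 1 then r 3 x * m3 x else 0)"
    "\<And>x j. x \<in> V \<Longrightarrow> D j t3 x = (if j = 3 then inverse (m3 x) else 0)"
    using rotation_functions[of x0 3, OF x0 _ M(2)] by blast
  have C2: "c 2 x0 * (m2 x0)\<^sup>2 = 1" and C3: "c 3 x0 * (m3 x0)\<^sup>2 = C"
    using c2 C by (auto simp: m2(4) m3(4) power_inverse)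
  note rot2 = rotation_plane[of x0 2, OF x0 _ m2(1,3,6,2,5,7) trig(1) _ trig(2) _ trig(3) C2, simplified]
  note rot3 = rotation_plane[of x0 3, OF x0 _ m3(1,3,6,2,5,7) Sn Cn pyth C3, simplified]
  obtain s :: "real^3 \<Rightarrow> real" where s: "smooth_on V s" "\<And>x j. x \<in> V \<Longrightarrow> D j s x = (if j = 1 then 1 else 0)"
  proof (rule arc_length_function[OF x0], goal_cases)
    case (1 s)
    show ?case by (rule 1(1)[OF 1(2-)])
  qed
  obtain z where z: "lorentz z (E 2 x0) = 0" "lorentz z (E 3 x0) = 0" "lorentz z (\<xi> 2 x0) = 0"
    "lorentz z (\<xi> 3 x0) = 0" "lorentz z z = - (c 2 x0 * c 3 x0)"
    using axis_vector[OF x0] by blast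
  define \<zeta> where "\<zeta> = inverse (sqrt (c 2 x0 * (C * c 3 x0))) *\<^sub>R z"
  have \<zeta>: "lorentz \<zeta> (E 2 x0) = 0" "lorentz \<zeta> (E 3 x0) = 0" "lorentz \<zeta> (\<xi> 2 x0) = 0"
    "lorentz \<zeta> (\<xi> 3 x0) = 0"
    by (simp_all add: \<zeta>_def lorentz_simps z)
  have \<zeta>\<zeta>: "lorentz \<zeta> \<zeta> = - C"
  proof -
    let ?d = "c 2 x0 * (C * c 3 x0)"
    have eq: "c 2 x0 * c 3 x0 = C * ?d" using C(1) by auto
    have "lorentz \<zeta> \<zeta> = - (inverse (sqrt ?d) * (inverse (sqrt ?d) * (c 2 x0 * c 3 x0)))"
      by (simp add: \<zeta>_def lorentz_simps z(5))
    also have "\<dots> = - (C * (inverse (sqrt ?d) * (inverse (sqrt ?d) * ?d)))"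
      unfolding eq by (simp only: mult_ac)
    also have "inverse (sqrt ?d) * (inverse (sqrt ?d) * ?d) = 1"
      using mult_pos_pos[OF c2 C(2)] by (auto simp: mult.assoc[symmetric] inverse_eq_divide)
    finally show ?thesis by simp
  qed
  note \<zeta>' = \<zeta>[unfolded lorentz_commute[of \<zeta>]]
  \<comment> \<open>The first vector has to be the timelike one: the axis if \<open>C = 1\<close>,
    the direction of \<open>\<xi> 3\<close> if \<open>C = -1\<close>. The minus signs in the other
    places compensate the negative products of \<open>F\<close> with \<open>\<xi> i\<close>.\<close>
  define b :: "5 \<Rightarrow> real^5" where "b i = (if C = 1
    then (if i = 1 then \<zeta> else if i = 2 then - (m2 x0 *\<^sub>R \<xi> 2 x0) else if i = 3 then E 2 x0 else
      if i = 4 then - (m3 x0 *\<^sub>R \<xi> 3 x0) else E 3 x0)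
    else (if i = 1 then m3 x0 *\<^sub>R \<xi> 3 x0 else if i = 2 then E 3 x0 else
      if i = 3 then - (m2 x0 *\<^sub>R \<xi> 2 x0) else if i = 4 then E 2 x0 else \<zeta>))" for i
  have b: "lorentz_orthonormal b"
  proof -
    have "m2 x0 * (m2 x0 * c 2 x0) = 1" "m3 x0 * (m3 x0 * c 3 x0) = C"
      using C2 C3 by (simp_all add: power2_eq_square mult_ac)
    with C(1) show ?thesis
      unfolding lorentz_orthonormal_def forall_5
      by (elim disjE) (simp_all add: b_def lorentz_simps base_frame_lorentz[OF x0] \<zeta> \<zeta>' \<zeta>\<zeta>)
  qed
  define T where "T v = (\<Sum>i\<in>UNIV. v $ i *\<^sub>R b i)" for v
  have T: "lorentz_isometry T"
    using lorentz_orthonormal_isometry[OF b] by (simp add: T_def[abs_def])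
  \<comment> \<open>The coordinate of \<open>F\<close> along \<open>\<zeta>\<close>, which has
    squared length \<open>- C\<close>. It is constant along \<open>e 2\<close> and
    \<open>e 3\<close>, as \<open>E 2\<close> and \<open>E 3\<close> stay in planes orthogonal to
    \<open>\<zeta>\<close>.\<close>
  define h where "h x = - C * lorentz (F x) \<zeta>" for x
  have smooth_h: "smooth_on V h"
    unfolding h_def[abs_def] by (intro smooth_rules)
  have Dh: "D j h x = - C * lorentz (E j x) \<zeta>" if "x \<in> V" for j x
    using that unfolding h_def[abs_def] by (simp add: D_mult D_minus D_const smooth_rules D_height)
  have h0: "D 2 h x = 0" "D 3 h x = 0" if "x \<in> V" for x
    by (simp_all add: Dh[OF that] rot2(4)[OF that] rot3(4)[OF that] lorentz_simps \<zeta>')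
  have smooth_chains: "smooth_on V (\<lambda>x. sin (t2 x))" "smooth_on V (\<lambda>x. cos (t2 x))"
    "smooth_on V (\<lambda>x. Sn (t3 x))" "smooth_on V (\<lambda>x. Cn (t3 x))"
    using smooth_on_chain_pair[OF open_V trig(1,2) m2(2)] smooth_on_chain_pair[OF open_V Sn(1) Cn(1) m3(2)]
    by simp_all
  have F\<zeta>: "lorentz (F x) \<zeta> = - C * h x" "lorentz (E 1 x) \<zeta> = - C * D 1 h x" if "x \<in> V" for x
    using CC by (simp_all add: h_def Dh[OF that] mult.assoc[symmetric])
  have F2: "lorentz (F x) (m2 x0 *\<^sub>R \<xi> 2 x0) = - (m2 x * cos (t2 x))" "lorentz (F x) (E 2 x0) = m2 x * sin (t2 x)"
    and F3: "lorentz (F x) (m3 x0 *\<^sub>R \<xi> 3 x0) = - (m3 x * Cn (t3 x))" "lorentz (F x) (E 3 x0) = m3 x * Sn (t3 x)"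
    if "x \<in> V" for x
    using rot2(2,3)[OF that] rot3(2,3)[OF that] by (simp_all add: lorentz_simps)
  have DD: "D 1 (\<lambda>x. - (m2 x * cos (t2 x))) x = - (D 1 m2 x * cos (t2 x))" "D 1 (\<lambda>x. m2 x * sin (t2 x)) x = D 1 m2 x * sin (t2 x)"
    "D 1 (\<lambda>x. - (m3 x * Cn (t3 x))) x = - (D 1 m3 x * Cn (t3 x))" "D 1 (\<lambda>x. m3 x * Sn (t3 x)) x = D 1 m3 x * Sn (t3 x)"
    if "x \<in> V" for x
    using that
    by (simp_all add: D_mult D_minus smooth_rules smooth_chains m2(1) m3(1) D_chain[OF trig(1) m2(2) that] D_chain[OF trig(2) m2(2) that]
        D_chain[OF Sn(1) m3(2) that] D_chain[OF Cn(1) m3(2) that] m2(7)[OF that] m3(7)[OF that])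
  have E2: "lorentz (E 1 x) (m2 x0 *\<^sub>R \<xi> 2 x0) = - (D 1 m2 x * cos (t2 x))" "lorentz (E 1 x) (E 2 x0) = D 1 m2 x * sin (t2 x)"
    and E3: "lorentz (E 1 x) (m3 x0 *\<^sub>R \<xi> 3 x0) = - (D 1 m3 x * Cn (t3 x))" "lorentz (E 1 x) (E 3 x0) = D 1 m3 x * Sn (t3 x)"
    if x: "x \<in> V" for x
    unfolding DD[OF x, symmetric] by (rule E_height[OF _ x], rule F2 F3, assumption)+
  \<comment> \<open>Parseval in the fixed basis, used twice: for \<open>F\<close> it puts the
    profile curve on the hyperboloid, for \<open>E 1\<close> it gives unit speed.\<close>
  have norm: "lorentz v v = u * u + C * (w * w) - C * (y * y)"
    if "lorentz v \<zeta> = - C * y" "lorentz v (m2 x0 *\<^sub>R \<xi> 2 x0) = - (u * cos t)" "lorentz v (E 2 x0) = u * sin t"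
      "lorentz v (m3 x0 *\<^sub>R \<xi> 3 x0) = - (w * Cn t')" "lorentz v (E 3 x0) = w * Sn t'" for v u w y t t'
    using lorentz_orthonormal_parseval[OF b, of v] C(1) circle_norm[of u t] scaled_pythagoras[OF pyth, of w t']
      that(1,3,5) that(2,4)[unfolded lorentz.scaleR_right]
    by (elim disjE) (simp_all add: b_def power2_eq_square lorentz_simps)
  have hyp: "(m2 x)\<^sup>2 + C * (m3 x)\<^sup>2 - C * (h x)\<^sup>2 = -1" if "x \<in> V" for x
    using norm[OF F\<zeta>(1) F2 F3, OF that that that that that] by (simp add: FF[OF that] power2_eq_square)
  have unit: "(D 1 m2 x)\<^sup>2 + C * (D 1 m3 x)\<^sup>2 - C * (D 1 h x)\<^sup>2 = 1" if "x \<in> V" for x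
    using norm[OF F\<zeta>(2) E2 E3, OF that that that that that] by (simp add: EE[OF that] power2_eq_square)
  show thesis
  proof (rule rotation_coordinates[OF x0 s(1) smooth_on_const[of V 1] _ s(2) m2(1,3,2,7) m3(1,3,2,7)])
    fix P \<theta> c0 c1
    assume P: "\<And>x. x \<in> P \<Longrightarrow> x \<in> V"
      "\<And>s. s \<in> {c0<..<c1} \<Longrightarrow> \<theta> s \<in> V"
      "\<And>s'. s' \<in> {c0<..<c1} \<Longrightarrow> s (\<theta> s') = s'"
      "\<And>h::real^3 \<Rightarrow> real. smooth_on V h \<Longrightarrow> smooth_on {c0<..<c1} (\<lambda>s. h (\<theta> s))"
      "\<And>(h::real^3 \<Rightarrow> real) s. smooth_on V h \<Longrightarrow> s \<in> {c0<..<c1} \<Longrightarrow>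
         ((\<lambda>s. h (\<theta> s)) has_real_derivative D 1 h (\<theta> s) / 1) (at s)"
      "\<And>(h::real^3 \<Rightarrow> real) x. smooth_on V h \<Longrightarrow> (\<And>x. x \<in> V \<Longrightarrow> D 2 h x = 0) \<Longrightarrow>
         (\<And>x. x \<in> V \<Longrightarrow> D 3 h x = 0) \<Longrightarrow> x \<in> P \<Longrightarrow> h (\<theta> (s x)) = h x"
      "\<And>T fam. lorentz_isometry T \<Longrightarrow> (\<And>x. x \<in> P \<Longrightarrow> F x = T (fam (s x) (t2 x) (t3 x))) \<Longrightarrow>
         congruent_piece V F x0 fam {c0<..<c1}"
    show thesis
    proof (rule that[of c0 c1 "\<lambda>s. h (\<theta> s)" "\<lambda>s. m2 (\<theta> s)" "\<lambda>s. m3 (\<theta> s)"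
          "\<lambda>s. D 1 h (\<theta> s)" "\<lambda>s. D 1 m2 (\<theta> s)" "\<lambda>s. D 1 m3 (\<theta> s)"])
      show "smooth_on {c0<..<c1} (\<lambda>s. h (\<theta> s))" "smooth_on {c0<..<c1} (\<lambda>s. m2 (\<theta> s))"
        "smooth_on {c0<..<c1} (\<lambda>s. m3 (\<theta> s))"
        using P(4) smooth_h m2(1) m3(1) by blast+
      fix u assume u: "u \<in> {c0<..<c1}"
      show "((\<lambda>u. h (\<theta> u)) has_real_derivative D 1 h (\<theta> u)) (at u)"
        "((\<lambda>u. m2 (\<theta> u)) has_real_derivative D 1 m2 (\<theta> u)) (at u)"
        "((\<lambda>u. m3 (\<theta> u)) has_real_derivative D 1 m3 (\<theta> u)) (at u)"
        using P(5)[OF smooth_h u] P(5)[OF m2(1) u] P(5)[OF m3(1) u] by simp_all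
      show "(m2 (\<theta> u))\<^sup>2 + C * (m3 (\<theta> u))\<^sup>2 - C * (h (\<theta> u))\<^sup>2 = -1"
        "(D 1 m2 (\<theta> u))\<^sup>2 + C * (D 1 m3 (\<theta> u))\<^sup>2 - C * (D 1 h (\<theta> u))\<^sup>2 = 1"
        by (rule hyp[OF P(2)[OF u]] unit[OF P(2)[OF u]])+
    next
      fix fam :: "real \<Rightarrow> real \<Rightarrow> real \<Rightarrow> real^5"
      assume fam: "\<And>s t u. fam s t u = (if C = 1
        then vector [h (\<theta> s), m2 (\<theta> s) * cos t, m2 (\<theta> s) * sin t, m3 (\<theta> s) * Cn u, m3 (\<theta> s) * Sn u]
        else vector [m3 (\<theta> s) * Cn u, m3 (\<theta> s) * Sn u, m2 (\<theta> s) * cos t, m2 (\<theta> s) * sin t, h (\<theta> s)])"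
      show "congruent_piece V F x0 fam {c0<..<c1}"
      proof (rule P(7)[OF T])
        fix x assume x: "x \<in> P"
        note xV = P(1)[OF x]
        have \<theta>: "h (\<theta> (s x)) = h x" "m2 (\<theta> (s x)) = m2 x" "m3 (\<theta> (s x)) = m3 x"
          using P(6)[OF smooth_h h0 x] P(6)[OF m2(1) _ _ x] P(6)[OF m3(1) _ _ x] m2(6) m3(6) by auto
        show "F x = T (fam (s x) (t2 x) (t3 x))"
        proof (rule lorentz_orthonormal_eqI[OF b])
          have "\<forall>i. lorentz (F x) (b i) = lorentz (T (fam (s x) (t2 x) (t3 x))) (b i)"
            unfolding T_def lorentz_orthonormal_combination(2)[OF b] fam \<theta> forall_5
            using C(1) F\<zeta>(1)[OF xV] F2(2)[OF xV] F3(2)[OF xV] F2(1)[OF xV, unfolded lorentz.scaleR_right]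
              F3(1)[OF xV, unfolded lorentz.scaleR_right]
            by (elim disjE) (simp_all add: b_def lorentz_simps)
          then show "lorentz (F x) (b i) = lorentz (T (fam (s x) (t2 x) (t3 x))) (b i)" for i ..
        qed
      qed
    qed
  qed simp_all
qed

lemma family1_piece:
  assumes x0: "x0 \<in> V" and c: "c 2 x0 > 0" "c 3 x0 > 0"
  shows "\<exists>c0 c1 \<alpha>. arc_length_curve_H2 {c0<..<c1} \<alpha> \<and> congruent_piece V F x0 (family1 \<alpha>) {c0<..<c1}"
proof (rule two_rotations[of x0 1 sin cos, OF x0 c(1) _ _ trig(1) _ trig(2) _ trig(3)], goal_cases)
  case (5 f1 f2 f3 g1 g2 g3 c0 c1)
  have "arc_length_curve_H2 {c0<..<c1} (\<lambda>s. vector [f1 s, f2 s, f3 s])"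
    by (rule arc_length_curve_H2I[OF _ 5(1-3) 5(4-6)]) (use 5(7,8) in \<open>auto simp: algebra_simps\<close>)
  moreover have "congruent_piece V F x0 (family1 (\<lambda>s. vector [f1 s, f2 s, f3 s])) {c0<..<c1}"
    by (rule 5(9)) (simp add: family1_def)
  ultimately show ?case by blast
qed (use c in auto)

lemma family2_piece:
  assumes x0: "x0 \<in> V" and c3: "c 3 x0 < 0"
  shows "\<exists>c0 c1 \<alpha>. arc_length_curve_H2 {c0<..<c1} \<alpha> \<and> congruent_piece V F x0 (family2 \<alpha>) {c0<..<c1}"
proof (rule two_rotations[of x0 "-1" sinh cosh, OF x0 _ _ _ hyperbolic(1) _ hyperbolic(2) _ hyperbolic(3)], goal_cases)
  case (6 f1 f2 f3 g1 g2 g3 c0 c1)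
  have "arc_length_curve_H2 {c0<..<c1} (\<lambda>s. vector [f3 s, f2 s, f1 s])"
    by (rule arc_length_curve_H2I[OF _ 6(3,2,1) 6(6,5,4)]) (use 6(7,8) in \<open>auto simp: algebra_simps\<close>)
  moreover have "congruent_piece V F x0 (family2 (\<lambda>s. vector [f3 s, f2 s, f1 s])) {c0<..<c1}"
    by (rule 6(9)) (simp add: family2_def)
  ultimately show ?case by blast
qed (use c3 c_sum_pos[OF x0] in auto)

text \<open>Here \<open>\<xi> 3\<close> is null and the curves of \<open>e 3\<close> are parabolas.
  The constant of the family is normalised to 1/2: with \<open>s' = s / (2 * a)\<close> and
  \<open>u' = 2 * a * u\<close> any other nonzero value takes this form. The parameter
  \<open>s\<close> is then the product of \<open>- F\<close> with the constant null vector
  \<open>m3 x0 *\<^sub>R \<xi> 3 x0\<close>.\<close>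

lemma family3_piece:
  assumes x0: "x0 \<in> V" and c3: "c 3 x0 = 0"
  shows "\<exists>c0 c1 A. 0 \<notin> {c0<..<c1} \<and> smooth_on {c0<..<c1} A \<and>
    congruent_piece V F x0 (family3 (1/2) A) {c0<..<c1}"
proof -
  have c2: "c 2 x0 > 0" using c_sum_pos[OF x0] c3 by simp
  \<comment> \<open>Minus the squared length of
    \<open>F x0 + inverse (c 2 x0) *\<^sub>R \<xi> 2 x0\<close> is \<open>\<rho> * \<rho>\<close>,
    so division by \<open>\<rho>\<close> yields a unit timelike \<open>\<zeta>\<close>; its
    \<open>\<xi> 2\<close>-summand makes it orthogonal to \<open>\<xi> 2\<close>.\<close>
  define \<rho> where "\<rho> = sqrt (1 + inverse (c 2 x0))"
  have \<rho>: "\<rho> > 0" "\<rho> * \<rho> = 1 + inverse (c 2 x0)"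
    using c2 by (simp_all add: \<rho>_def add_pos_pos)
  have M: "inverse (sqrt (c 2 x0)) > 0" using c2 by simp
  obtain m2 t2 where m2: "smooth_on V m2" "smooth_on V t2" "\<And>x. x \<in> V \<Longrightarrow> m2 x > 0"
    "m2 x0 = inverse (sqrt (c 2 x0))" "t2 x0 = 0"
    "\<And>x j. x \<in> V \<Longrightarrow> D j m2 x = (if j = 1 then r 2 x * m2 x else 0)"
    "\<And>x j. x \<in> V \<Longrightarrow> D j t2 x = (if j = 2 then inverse (m2 x) else 0)"
    using rotation_functions[of x0 2, OF x0 _ M] by blast
  obtain m3 t3 where m3: "smooth_on V m3" "smooth_on V t3" "\<And>x. x \<in> V \<Longrightarrow> m3 x > 0"
    "m3 x0 = \<rho>" "t3 x0 = 0"
    "\<And>x j. x \<in> V \<Longrightarrow> D j m3 x = (if j = 1 then r 3 x * m3 x else 0)"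
    "\<And>x j. x \<in> V \<Longrightarrow> D j t3 x = (if j = 3 then inverse (m3 x) else 0)"
    using rotation_functions[of x0 3, OF x0 _ \<rho>(1)] by blast
  have C: "c 2 x0 * (m2 x0)\<^sup>2 = 1" "c 3 x0 * (m3 x0)\<^sup>2 = 0"
    using c2 c3 by (simp_all add: m2(4) m3(4) power_inverse)
  have par: "((\<lambda>y. y) has_real_derivative (\<lambda>_. 1) y) (at y)" "((\<lambda>_. 1) has_real_derivative - 0 * (\<lambda>y. y) y) (at y)"
    "(\<lambda>_. 1) y * (\<lambda>_. 1) y + 0 * ((\<lambda>y. y) y * (\<lambda>y. y) y) = (1::real)" for y :: real
    by (auto intro!: derivative_eq_intros)
  note rot2 = rotation_plane[of x0 2, OF x0 _ m2(1,3,6,2,5,7) trig(1) _ trig(2) _ trig(3) C(1), simplified]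
  note rot3 = rotation_plane[of x0 3 m3 t3 "\<lambda>y. y" "\<lambda>_. 1" 0, OF x0 _ m3(1,3,6,2,5,7) par(1) _ par(2) _ par(3) C(2), simplified]
  define \<zeta> where "\<zeta> = inverse \<rho> *\<^sub>R (F x0 + inverse (c 2 x0) *\<^sub>R \<xi> 2 x0)"
  have z: "lorentz \<zeta> (E 2 x0) = 0" "lorentz \<zeta> (E 3 x0) = 0" "lorentz \<zeta> (\<xi> 2 x0) = 0"
    "\<rho> * lorentz \<zeta> (\<xi> 3 x0) = - 1" "lorentz \<zeta> \<zeta> = - 1"
  proof -
    have FE: "lorentz (F x0) (E i x0) = 0" for i
      using EF[OF x0, of i] by (simp only: lorentz_commute)
    have "lorentz \<zeta> \<zeta> = - (inverse \<rho> * inverse \<rho> * (\<rho> * \<rho>))"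
      unfolding \<rho>(2) using c2 \<rho>(1)
      by (simp add: \<zeta>_def lorentz_simps base_frame_lorentz[OF x0] \<xi>_lorentz[OF x0] FF[OF x0] field_simps)
    also have "inverse \<rho> * inverse \<rho> * (\<rho> * \<rho>) = 1" using \<rho>(1) by (simp add: field_simps)
    finally show "lorentz \<zeta> \<zeta> = - 1" .
  qed (use c2 \<rho>(1) EF[OF x0] in \<open>simp_all add: \<zeta>_def lorentz_simps base_frame_lorentz[OF x0]
      \<xi>_lorentz[OF x0] lorentz_commute[of "F x0" "E 2 x0"] lorentz_commute[of "F x0" "E 3 x0"]\<close>)
  note z' = z(1-4)[unfolded lorentz_commute[of \<zeta>]]
  \<comment> \<open>The first and last vectors add up to the null vector
    \<open>\<rho> *\<^sub>R \<xi> 3 x0\<close>. The product of \<open>\<zeta>\<close> with it is -1,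
    which makes the last vector a unit vector orthogonal to \<open>\<zeta>\<close>.\<close>
  define b :: "5 \<Rightarrow> real^5" where "b i = (if i = 1 then \<zeta> else if i = 2 then E 3 x0 else
    if i = 3 then - (m2 x0 *\<^sub>R \<xi> 2 x0) else if i = 4 then E 2 x0 else \<rho> *\<^sub>R \<xi> 3 x0 - \<zeta>)" for i
  have b: "lorentz_orthonormal b"
  proof -
    have "m2 x0 * (m2 x0 * c 2 x0) = 1"
      using C by (simp_all add: power2_eq_square mult_ac)
    then show ?thesis
      unfolding lorentz_orthonormal_def forall_5
      by (simp add: b_def lorentz_simps base_frame_lorentz[OF x0] z z' c3 right_diff_distrib)
  qed
  define T where "T v = (\<Sum>i\<in>UNIV. v $ i *\<^sub>R b i)" for v
  have T: "lorentz_isometry T"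
    using lorentz_orthonormal_isometry[OF b] by (simp add: T_def[abs_def])
  have Fb: "lorentz (F x) (b 2) = m3 x * t3 x" "lorentz (F x) (b 3) = m2 x * cos (t2 x)"
    "lorentz (F x) (b 4) = m2 x * sin (t2 x)" "lorentz (F x) (b 1) + lorentz (F x) (b 5) = - m3 x" if "x \<in> V" for x
    using rot2(2,3)[OF that] rot3(2,3)[OF that] by (simp_all add: b_def lorentz_simps m3(4))
  have Fb': "- lorentz (F x) (b 1) = ((m2 x)\<^sup>2 + 1) / (2 * m3 x) + m3 x * (t3 x)\<^sup>2 / 2 + m3 x / 2"
    "lorentz (F x) (b 5) = ((m2 x)\<^sup>2 + 1) / (2 * m3 x) + m3 x * (t3 x)\<^sup>2 / 2 - m3 x / 2" if x: "x \<in> V" for x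
  proof -
    define y where "y = - lorentz (F x) (b 1)"
    have y5: "lorentz (F x) (b 5) = y - m3 x" using Fb(4)[OF x] by (simp add: y_def)
    \<comment> \<open>As the difference of the first and last coordinates is known to be
      \<open>m3\<close>, the squares of \<open>y\<close> cancel and the hyperboloid equation is
      linear in \<open>y\<close>.\<close>
    have "-1 = - y\<^sup>2 + (m3 x * t3 x)\<^sup>2 + (m2 x)\<^sup>2 + (y - m3 x)\<^sup>2"
      using lorentz_orthonormal_parseval[OF b, of "F x"] circle_norm[of "m2 x" "t2 x"] y5
      by (simp add: FF[OF x] Fb(1-3)[OF x] y_def power2_eq_square)
    then have "2 * m3 x * y = (m2 x)\<^sup>2 + 1 + m3 x * m3 x * (t3 x)\<^sup>2 + m3 x * m3 x"
      by (simp add: power2_eq_square algebra_simps)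
    then have y: "y = ((m2 x)\<^sup>2 + 1) / (2 * m3 x) + m3 x * (t3 x)\<^sup>2 / 2 + m3 x / 2"
      using m3(3)[OF x] by (simp add: field_simps)
    show "- lorentz (F x) (b 1) = ((m2 x)\<^sup>2 + 1) / (2 * m3 x) + m3 x * (t3 x)\<^sup>2 / 2 + m3 x / 2"
      using y by (simp add: y_def)
    show "lorentz (F x) (b 5) = ((m2 x)\<^sup>2 + 1) / (2 * m3 x) + m3 x * (t3 x)\<^sup>2 / 2 - m3 x / 2"
      unfolding y5 y by (simp add: field_simps)
  qed
  \<comment> \<open>Needed for \<open>m3\<close> to serve as first coordinate:
    \<open>r 3 = 0\<close> together with \<open>c 3 = 0\<close> and the Gauss equation would force
    \<open>k 2 = k 3\<close>.\<close>
  have r3: "r 3 x \<noteq> 0" if x: "x \<in> V" for x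
  proof
    assume "r 3 x = 0"
    moreover have "c 3 x = 0" using rot3(1)[OF x] m3(3)[OF x] by simp
    ultimately have "k 3 x * k 3 x = 1" "k 2 x * k 3 x = 1"
      using gauss[OF x] by (simp_all add: c_def power2_eq_square)
    then have "(k 2 x - k 3 x) * k 3 x = 0" "k 3 x \<noteq> 0" by (auto simp: left_diff_distrib)
    with k_neq[OF x] show False by simp
  qed
  have \<delta>: "smooth_on V (\<lambda>x. r 3 x * m3 x)" "\<And>x. x \<in> V \<Longrightarrow> r 3 x * m3 x \<noteq> 0"
    using r3 m3(3) by (auto intro!: smooth_rules smooth_r m3(1) simp: less_le)
  show ?thesis
  proof (rule rotation_coordinates[OF x0 m3(1) \<delta>(1) \<delta>(2) m3(6) m2(1,3,2,7) m3(1,3,2,7)])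
    fix P \<theta> c0 c1
    assume P: "\<And>x. x \<in> P \<Longrightarrow> x \<in> V"
    "\<And>s. s \<in> {c0<..<c1} \<Longrightarrow> \<theta> s \<in> V"
    "\<And>s. s \<in> {c0<..<c1} \<Longrightarrow> m3 (\<theta> s) = s"
    "\<And>h::real^3 \<Rightarrow> real. smooth_on V h \<Longrightarrow> smooth_on {c0<..<c1} (\<lambda>s. h (\<theta> s))"
    "\<And>(h::real^3 \<Rightarrow> real) x. smooth_on V h \<Longrightarrow> (\<And>x. x \<in> V \<Longrightarrow> D 2 h x = 0) \<Longrightarrow>
       (\<And>x. x \<in> V \<Longrightarrow> D 3 h x = 0) \<Longrightarrow> x \<in> P \<Longrightarrow> h (\<theta> (m3 x)) = h x"
    "\<And>T fam. lorentz_isometry T \<Longrightarrow> (\<And>x. x \<in> P \<Longrightarrow> F x = T (fam (m3 x) (t2 x) (t3 x))) \<Longrightarrow>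
       congruent_piece V F x0 fam {c0<..<c1}"
    have "0 \<notin> {c0<..<c1}"
    proof
      assume "0 \<in> {c0<..<c1}"
      then have "m3 (\<theta> 0) = 0" "m3 (\<theta> 0) > 0" using P(3) m3(3)[OF P(2)] by blast+
      then show False by simp
    qed
    moreover have "congruent_piece V F x0 (family3 (1/2) (\<lambda>s. m2 (\<theta> s))) {c0<..<c1}"
    proof (rule P(6)[OF T])
      fix x assume x: "x \<in> P"
      note xV = P(1)[OF x]
      have "m2 (\<theta> (m3 x)) = m2 x"
        using P(5)[OF m2(1) _ _ x] m2(6) by auto
      then have fam: "family3 (1/2) (\<lambda>s. m2 (\<theta> s)) (m3 x) (t2 x) (t3 x) =
          vector [- lorentz (F x) (b 1), m3 x * t3 x, m2 x * cos (t2 x), m2 x * sin (t2 x), lorentz (F x) (b 5)]"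
        using m3(3)[OF xV] by (simp add: family3_def Fb'[OF xV] field_simps)
      show "F x = T (family3 (1/2) (\<lambda>s. m2 (\<theta> s)) (m3 x) (t2 x) (t3 x))"
      proof (rule lorentz_orthonormal_eqI[OF b])
        have "\<forall>i. lorentz (F x) (b i) = lorentz (T (family3 (1/2) (\<lambda>s. m2 (\<theta> s)) (m3 x) (t2 x) (t3 x))) (b i)"
          unfolding T_def lorentz_orthonormal_combination(2)[OF b] fam forall_5 by (simp add: Fb(1-3)[OF xV])
        then show "lorentz (F x) (b i) = lorentz (T (family3 (1/2) (\<lambda>s. m2 (\<theta> s)) (m3 x) (t2 x) (t3 x))) (b i)" for i ..
      qed
    qed
    ultimately show ?thesis using P(4)[OF m2(1)] by blast
  qed simp_all
qed

end

section \<open>The biconservative equation in local coordinates\<close>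

lemma matrix_inv_inverse:
  fixes A :: "real^'n^'n"
  assumes "invertible A"
  shows "A ** matrix_inv A = mat 1" "matrix_inv A ** A = mat 1"
proof -
  have "\<exists>B. A ** B = mat 1 \<and> B ** A = mat 1" using assms by (simp add: invertible_def)
  from someI_ex[OF this] show "A ** matrix_inv A = mat 1" "matrix_inv A ** A = mat 1"
    by (simp_all add: matrix_inv_def)
qed

lemma smooth_on_det:
  fixes A :: "'a::euclidean_space \<Rightarrow> real^'n^'n"
  assumes "open U" "\<And>i j. smooth_on U (\<lambda>x. A x $ i $ j)"
  shows "smooth_on U (\<lambda>x. det (A x))"
  unfolding det_def by (intro smooth_on_sum smooth_on_mult smooth_on_prod smooth_on_const assms)

text \<open>By Cramer's rule the entries are quotients of determinants.\<close>

lemma smooth_on_matrix_inv: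
  fixes A :: "'a::euclidean_space \<Rightarrow> real^'n^'n"
  assumes U: "open U" and A: "\<And>i j. smooth_on U (\<lambda>x. A x $ i $ j)"
    and inv: "\<And>x. x \<in> U \<Longrightarrow> invertible (A x)"
  shows "smooth_on U (\<lambda>x. matrix_inv (A x) $ k $ l)"
proof -
  have det: "det (A x) \<noteq> 0" if "x \<in> U" for x
    using inv[OF that] by (simp add: invertible_det_nz)
  have eq: "matrix_inv (A x) $ k $ l = det (\<chi> i j. if j = k then axis l 1 $ i else A x $ i $ j) / det (A x)"
    if x: "x \<in> U" for x
  proof -
    have "A x *v column l (matrix_inv (A x)) = axis l 1"
    proof -
      have "A x *v column l (matrix_inv (A x)) = (A x ** matrix_inv (A x)) *v axis l 1"
        by (metis matrix_vector_mul_assoc matrix_vector_mult_basis)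
      then show ?thesis by (simp add: matrix_inv_inverse[OF inv[OF x]])
    qed
    then have "column l (matrix_inv (A x)) =
        (\<chi> k. det (\<chi> i j. if j = k then axis l 1 $ i else A x $ i $ j) / det (A x))"
      using cramer[OF det[OF x]] by blast
    then have "column l (matrix_inv (A x)) $ k = det (\<chi> i j. if j = k then axis l 1 $ i else A x $ i $ j) / det (A x)"
      by simp
    then show ?thesis by (simp add: column_def)
  qed
  have "smooth_on U (\<lambda>x. (\<chi> i j. if j = k then axis l 1 $ i else A x $ i $ j) $ i $ j)" for i j
    using A smooth_on_const by (cases "j = k") simp_all
  then have "smooth_on U (\<lambda>x. det (\<chi> i j. if j = k then axis l 1 $ i else A x $ i $ j) / det (A x))"
    by (intro smooth_on_divide smooth_on_det U A det) auto
  then show ?thesis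
    by (subst smooth_on_cong[OF U eq]) auto
qed

locale hypersurface_patch =
  fixes U :: "(real^3) set" and F N :: "real^3 \<Rightarrow> real^5"
  assumes open_U: "open U" and smooth_F: "smooth_on U F" and smooth_N: "smooth_on U N"
    and FF: "\<And>q. q \<in> U \<Longrightarrow> lorentz (F q) (F q) = -1"
    and normal: "\<And>q. q \<in> U \<Longrightarrow> unit_normal_at F q (N q)"
    and immersion: "\<And>q. q \<in> U \<Longrightarrow> inj (fd F q)"
begin

lemma NN: "q \<in> U \<Longrightarrow> lorentz (N q) (N q) = 1"
  and NF: "q \<in> U \<Longrightarrow> lorentz (N q) (F q) = 0"
  and N_tangent: "q \<in> U \<Longrightarrow> lorentz (N q) (fd F q w) = 0"
  using normal by (simp_all add: unit_normal_at_def)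

lemma linear_fd: "smooth_on U g \<Longrightarrow> q \<in> U \<Longrightarrow> linear (fd g q)"
  by (rule fd_linear[OF smooth_on_differentiable])

lemma fd_const_on:
  assumes "q \<in> U" "\<And>r. r \<in> U \<Longrightarrow> g r = c"
  shows "fd g q w = 0"
  using fd_cong(2)[OF open_U assms(1), of g "\<lambda>_. c"] assms(2) by simp

lemma fd_bilinear:
  "bounded_bilinear B \<Longrightarrow> smooth_on U f \<Longrightarrow> smooth_on U g \<Longrightarrow> q \<in> U \<Longrightarrow>
    fd (\<lambda>x. B (f x) (g x)) q w = B (f q) (fd g q w) + B (fd f q w) (g q)"
  by (subst fd_eqI[OF bounded_bilinear.FDERIV[OF _ smooth_on_has_fd smooth_on_has_fd]]) auto

lemmas fd_lorentz = fd_bilinear[OF lorentz.bounded_bilinear_axioms]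
lemmas fd_scaleR = fd_bilinear[OF bounded_bilinear_scaleR]

lemmas smooth_rules = smooth_on_add[OF open_U] smooth_on_diff[OF open_U] smooth_on_minus[OF open_U]
  smooth_on_mult[OF open_U] smooth_on_scaleR[OF open_U] smooth_on_lorentz[OF open_U]
  smooth_on_const smooth_on_fd_const smooth_F smooth_N smooth_on_sum[OF open_U]

lemma F_tangent:
  assumes "q \<in> U"
  shows "lorentz (fd F q w) (F q) = 0" "lorentz (F q) (fd F q w) = 0"
proof -
  have "fd (\<lambda>q. lorentz (F q) (F q)) q w = 0"
    using FF by (rule fd_const_on[OF assms])
  then show "lorentz (fd F q w) (F q) = 0" "lorentz (F q) (fd F q w) = 0"
    using assms by (simp_all add: fd_lorentz smooth_rules lorentz_commute)
qed

lemma dN_normal: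
  assumes "q \<in> U"
  shows "lorentz (fd N q w) (N q) = 0" "lorentz (N q) (fd N q w) = 0"
proof -
  have "fd (\<lambda>q. lorentz (N q) (N q)) q w = 0"
    using NN by (rule fd_const_on[OF assms])
  then show "lorentz (fd N q w) (N q) = 0" "lorentz (N q) (fd N q w) = 0"
    using assms by (simp_all add: fd_lorentz smooth_rules lorentz_commute)
qed

lemma dN_F:
  assumes "q \<in> U"
  shows "lorentz (fd N q w) (F q) = 0"
proof -
  have "fd (\<lambda>q. lorentz (N q) (F q)) q w = 0"
    using NF by (rule fd_const_on[OF assms])
  then show ?thesis
    using assms by (simp add: fd_lorentz smooth_rules N_tangent)
qed

lemma dN_dF:
  assumes "q \<in> U"
  shows "lorentz (fd N q v) (fd F q w) = - lorentz (fd (\<lambda>r. fd F r w) q v) (N q)"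
proof -
  have "fd (\<lambda>q. lorentz (N q) (fd F q w)) q v = 0"
    using N_tangent by (rule fd_const_on[OF assms])
  then show ?thesis
    using assms by (simp add: fd_lorentz smooth_rules lorentz_commute add_eq_0_iff)
qed

lemma dN_dF_sym: "q \<in> U \<Longrightarrow> lorentz (fd N q v) (fd F q w) = lorentz (fd N q w) (fd F q v)"
  by (simp add: dN_dF fd_fd_sym[OF open_U smooth_F])

lemma fd_axis: "smooth_on U g \<Longrightarrow> q \<in> U \<Longrightarrow> fd g q w = (\<Sum>k\<in>UNIV. w $ k *\<^sub>R partial k g q)"
  by (rule fd_eq_sum_axis[OF smooth_on_differentiable])

lemma metric_form:
  assumes "q \<in> U"
  shows "lorentz (fd F q v) (fd F q w) = (metric F q *v w) \<bullet> v"
  unfolding fd_axis[OF smooth_F assms, of v] fd_axis[OF smooth_F assms, of w]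
  by (simp add: lorentz.sum_left lorentz.sum_right lorentz_simps metric_def matrix_vector_mult_def
      inner_vec_def sum_distrib_left mult_ac) (rule sum.swap)

lemma metric_pos:
  assumes "q \<in> U" "w \<noteq> 0"
  shows "lorentz (fd F q w) (fd F q w) > 0"
proof (rule lorentz_spacelike)
  show "fd F q w \<noteq> 0"
    using immersion[OF assms(1)] linear_injective_0[OF linear_fd[OF smooth_F assms(1)]] assms(2) by blast
qed (use assms FF F_tangent in auto)

lemma invertible_metric:
  assumes "q \<in> U"
  shows "invertible (metric F q)"
proof -
  have "w = 0" if "metric F q *v w = 0" for w
    using metric_pos[OF assms, of w] metric_form[OF assms, of w w] that by force
  then have "\<exists>B. B ** metric F q = mat 1"
    by (subst matrix_left_invertible_ker) blast
  then show ?thesis by (simp add: invertible_left_inverse)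
qed

lemma smooth_metric: "smooth_on U (\<lambda>q. metric F q $ i $ j)"
  unfolding metric_def by (simp add: smooth_rules)

lemma smooth_metric_inv: "smooth_on U (\<lambda>q. metric_inv F q $ i $ j)"
  unfolding metric_inv_def by (rule smooth_on_matrix_inv[OF open_U smooth_metric invertible_metric])

lemma metric_inv_metric:
  assumes "q \<in> U"
  shows "(\<Sum>j\<in>UNIV. metric_inv F q $ i $ j * metric F q $ j $ l) = (if i = l then 1 else 0)"
proof -
  have "(metric_inv F q ** metric F q) $ i $ l = (mat 1 :: real^3^3) $ i $ l"
    by (simp add: metric_inv_def matrix_inv_inverse(2)[OF invertible_metric[OF assms]])
  then show ?thesis by (simp add: matrix_matrix_mult_def mat_def)
qed

lemma metric_sym: "metric F q $ i $ j = metric F q $ j $ i"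
  by (simp add: metric_def lorentz_commute)

lemma metric_inv_sym:
  assumes "q \<in> U"
  shows "metric_inv F q $ i $ j = metric_inv F q $ j $ i"
proof -
  have "transpose (metric F q) = metric F q"
    by (simp add: transpose_def vec_eq_iff metric_sym)
  then have "transpose (metric_inv F q) ** metric F q = mat 1"
    using matrix_inv_inverse(1)[OF invertible_metric[OF assms]] matrix_transpose_mul[of "metric F q" "metric_inv F q"]
    by (simp add: metric_inv_def transpose_mat)
  then have "transpose (metric_inv F q) = metric_inv F q"
    using matrix_inv_inverse(1)[OF invertible_metric[OF assms]]
    by (metis matrix_mul_assoc matrix_mul_lid matrix_mul_rid metric_inv_def)
  then have "transpose (metric_inv F q) $ i $ j = metric_inv F q $ i $ j" by simp
  then show ?thesis by (simp add: transpose_def)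
qed

section \<open>Tangential projection and second fundamental form\<close>

definition tan_coords :: "real^3 \<Rightarrow> real^5 \<Rightarrow> real^3" where
  "tan_coords q v = (\<chi> k. \<Sum>l\<in>UNIV. metric_inv F q $ k $ l * lorentz v (partial l F q))"

lemma tan_coords_fd:
  assumes "q \<in> U"
  shows "tan_coords q (fd F q w) = w"
proof -
  have "lorentz (fd F q w) (partial l F q) = (\<Sum>m\<in>UNIV. metric F q $ l $ m * w $ m)" for l
  proof -
    have "lorentz (fd F q w) (partial l F q) = (\<Sum>m\<in>UNIV. metric F q $ m $ l * w $ m)"
      unfolding fd_axis[OF smooth_F assms, of w]
      by (simp add: lorentz.sum_left lorentz_simps metric_def mult.commute)
    then show ?thesis by (simp only: metric_sym[of q _ l])
  qed
  then have "tan_coords q (fd F q w) $ k = (\<Sum>m\<in>UNIV. (\<Sum>l\<in>UNIV. metric_inv F q $ k $ l * metric F q $ l $ m) * w $ m)" for k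
    by (simp add: tan_coords_def sum_3 algebra_simps)
  then show ?thesis
    by (simp add: vec_eq_iff metric_inv_metric[OF assms] if_distrib[of "\<lambda>x. x * _"] cong: if_cong)
qed

text \<open>\<open>F q\<close>, \<open>N q\<close> and the tangent vectors are independent, hence
  span R^5 by dimension, so nondegeneracy applies.\<close>

lemma ambient_eq_0:
  assumes q: "q \<in> U" and "lorentz v (F q) = 0" "lorentz v (N q) = 0" "\<And>w. lorentz v (fd F q w) = 0"
  shows "v = 0"
proof -
  let ?w = "\<lambda>x::real^5. x $ 3 *\<^sub>R axis 1 1 + x $ 4 *\<^sub>R axis 2 1 + x $ 5 *\<^sub>R axis 3 (1::real) :: real^3"
  let ?B = "\<lambda>x. x $ 1 *\<^sub>R F q + x $ 2 *\<^sub>R N q + fd F q (?w x)"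
  have linF: "linear (fd F q)" by (rule linear_fd[OF smooth_F q])
  have lin: "linear ?B"
    by (intro linearI) (simp_all add: linear_add[OF linF] linear_scale[OF linF] algebra_simps)
  have "x = 0" if "?B x = 0" for x
  proof -
    have "lorentz (?B x) (F q) = 0" "lorentz (?B x) (N q) = 0" by (simp_all add: that lorentz_simps)
    then have x12: "x $ 1 = 0" "x $ 2 = 0"
      using FF[OF q] NN[OF q] NF[OF q] F_tangent[OF q, of "?w x"] N_tangent[OF q, of "?w x"]
      by (simp_all add: lorentz_simps lorentz_commute[of "F q" "N q"] lorentz_commute[of "fd F q (?w x)" "N q"])
    then have "fd F q (?w x) = 0" using that by simp
    then have "?w x = 0"
      using immersion[OF q] linear_injective_0[OF linF] by blast
    then have "?w x $ 1 = 0" "?w x $ 2 = 0" "?w x $ 3 = 0" by simp_all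
    then have "x $ 3 = 0" "x $ 4 = 0" "x $ 5 = 0" by (simp_all add: axis_def)
    with x12 show "x = 0" by (simp add: vec_eq_iff forall_5)
  qed
  then have "inj ?B" using linear_injective_0[OF lin] by blast
  then have "surj ?B" using linear_injective_imp_surjective[OF lin] by simp
  then have "lorentz v y = 0" for y
  proof -
    obtain x where "y = ?B x" using \<open>surj ?B\<close> by (rule surjE)
    then show ?thesis using assms(2-4) by (simp add: lorentz_simps)
  qed
  then show ?thesis by (rule lorentz_nondegenerate)
qed

lemma decomposition:
  assumes q: "q \<in> U"
  shows "v = - lorentz v (F q) *\<^sub>R F q + lorentz v (N q) *\<^sub>R N q + fd F q (tan_coords q v)"
proof -
  let ?t = "fd F q (tan_coords q v)"
  have t: "lorentz ?t (partial l F q) = lorentz v (partial l F q)" for l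
  proof -
    have "lorentz ?t (partial l F q) = (\<Sum>k\<in>UNIV. tan_coords q v $ k * metric F q $ k $ l)"
      unfolding fd_axis[OF smooth_F q, of "tan_coords q v"]
      by (simp add: lorentz.sum_left lorentz_simps metric_def)
    also have "\<dots> = (\<Sum>m\<in>UNIV. (\<Sum>k\<in>UNIV. metric_inv F q $ m $ k * metric F q $ k $ l) * lorentz v (partial m F q))"
      by (simp add: tan_coords_def sum_3 metric_inv_sym[OF q, of 2 1] metric_inv_sym[OF q, of 3 1]
          metric_inv_sym[OF q, of 3 2] algebra_simps)
    finally show ?thesis
      by (simp add: metric_inv_metric[OF q] if_distrib[of "\<lambda>x. x * _"] cong: if_cong)
  qed
  have t': "lorentz ?t (fd F q w) = lorentz v (fd F q w)" for w
    unfolding fd_axis[OF smooth_F q, of w] by (simp add: lorentz.sum_right lorentz_simps t)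
  have FN: "lorentz (F q) (N q) = 0" "lorentz ?t (N q) = 0"
    using NF[OF q] N_tangent[OF q] by (simp_all add: lorentz_commute)
  have "v - (- lorentz v (F q) *\<^sub>R F q + lorentz v (N q) *\<^sub>R N q + ?t) = 0"
    by (rule ambient_eq_0[OF q])
      (simp_all add: lorentz_simps FF[OF q] NN[OF q] NF[OF q] FN F_tangent[OF q] N_tangent[OF q] t')
  then show ?thesis by simp
qed

definition h :: "3 \<Rightarrow> 3 \<Rightarrow> real^3 \<Rightarrow> real" where
  "h i j q = lorentz (partial i (partial j F) q) (N q)"

text \<open>The trace of the shape operator, that is \<open>3H\<close>.\<close>

definition \<mu> :: "real^3 \<Rightarrow> real" where
  "\<mu> q = (\<Sum>i\<in>UNIV. \<Sum>j\<in>UNIV. metric_inv F q $ i $ j * h i j q)"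

lemma smooth_h: "smooth_on U (h i j)"
  unfolding h_def[abs_def] by (intro smooth_rules)

lemma smooth_\<mu>: "smooth_on U \<mu>"
  unfolding \<mu>_def[abs_def] by (intro smooth_rules smooth_h smooth_metric_inv)

lemma h_sym: "q \<in> U \<Longrightarrow> h i j q = h j i q"
  unfolding h_def using fd_fd_sym[OF open_U smooth_F] by metis

lemma partial_N: "q \<in> U \<Longrightarrow> lorentz (partial i N q) (partial j F q) = - h i j q"
  by (simp add: dN_dF h_def)

text \<open>The Koszul formula: in the metric derivatives all terms but one second derivative of
  \<open>F\<close> cancel by symmetry.\<close>

lemma christoffel_eq:
  assumes q: "q \<in> U"
  shows "christoffel F k i j q = tan_coords q (partial i (partial j F) q) $ k"
proof -
  have d: "partial i (\<lambda>r. metric F r $ j $ l) q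
      = lorentz (partial j F q) (partial i (partial l F) q) + lorentz (partial i (partial j F) q) (partial l F q)" for i j l
    by (simp add: metric_def fd_lorentz smooth_rules q)
  have s: "partial i (partial j F) q = partial j (partial i F) q" for i j
    by (rule fd_fd_sym[OF open_U smooth_F q])
  have "partial i (\<lambda>r. metric F r $ j $ l) q + partial j (\<lambda>r. metric F r $ i $ l) q
      - partial l (\<lambda>r. metric F r $ i $ j) q = 2 * lorentz (partial i (partial j F) q) (partial l F q)" for l
    unfolding d s[of l i] s[of l j] s[of j i] by (simp add: lorentz_commute)
  then show ?thesis
    by (simp add: christoffel_def tan_coords_def sum_distrib_left)
qed

lemma hessian_F:
  assumes q: "q \<in> U"
  shows "hcov F (axis i 1) (partial j F) q - (\<Sum>k\<in>UNIV. christoffel F k i j q *\<^sub>R partial k F q) = h i j q *\<^sub>R N q"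
proof -
  let ?v = "partial i (partial j F) q"
  have "(\<Sum>k\<in>UNIV. christoffel F k i j q *\<^sub>R partial k F q) = fd F q (tan_coords q ?v)"
    unfolding christoffel_eq[OF q] fd_axis[OF smooth_F q, of "tan_coords q ?v"] ..
  then show ?thesis
    using decomposition[OF q, of ?v] by (simp add: hcov_def h_def algebra_simps)
qed

lemma tension_eq:
  assumes q: "q \<in> U"
  shows "tension F q = \<mu> q *\<^sub>R N q"
  unfolding tension_def \<mu>_def hessian_F[OF q] by (simp add: scaleR_sum_left)

lemma hcov_N: "q \<in> U \<Longrightarrow> hcov F w N q = fd N q w"
  by (simp add: hcov_def dN_F)

lemma dN_tangent:
  assumes q: "q \<in> U"
  shows "fd N q w = fd F q (tan_coords q (fd N q w))"
  using decomposition[OF q, of "fd N q w"] by (simp add: dN_F[OF q] dN_normal[OF q])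

lemma shape_op_eq:
  assumes q: "q \<in> U"
  shows "shape_op F N q w = - tan_coords q (fd N q w)"
  unfolding shape_op_def
proof (rule the_equality)
  show z: "fd F q (- tan_coords q (fd N q w)) = - hcov F w N q"
    using dN_tangent[OF q, of w] by (simp add: linear_neg[OF linear_fd[OF smooth_F q]] hcov_N[OF q])
  fix z assume "fd F q z = - hcov F w N q"
  with z show "z = - tan_coords q (fd N q w)"
    using immersion[OF q] by (metis injD)
qed

lemma fd_shape_op:
  assumes q: "q \<in> U"
  shows "fd F q (shape_op F N q w) = - fd N q w"
  using dN_tangent[OF q, of w] by (simp add: shape_op_eq[OF q] linear_neg[OF linear_fd[OF smooth_F q]])

lemma shape_op_component:
  assumes q: "q \<in> U"
  shows "shape_op F N q (axis i 1) $ k = (\<Sum>l\<in>UNIV. metric_inv F q $ k $ l * h i l q)"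
  by (simp add: shape_op_eq[OF q] tan_coords_def partial_N[OF q] sum_negf)

lemma linear_shape_op:
  assumes q: "q \<in> U"
  shows "linear (shape_op F N q)"
  unfolding shape_op_eq[OF q, abs_def]
  by (intro linearI)
    (simp_all add: tan_coords_def vec_eq_iff linear_add[OF linear_fd[OF smooth_N q]]
      linear_scale[OF linear_fd[OF smooth_N q]] lorentz_simps distrib_left sum.distrib sum_distrib_left mult_ac)

lemma mean_curvature_eq:
  assumes q: "q \<in> U"
  shows "mean_curvature F N q = \<mu> q / 3"
proof -
  have "trace (matrix (shape_op F N q)) = (\<Sum>i\<in>UNIV. \<Sum>l\<in>UNIV. metric_inv F q $ i $ l * h i l q)"
    by (simp add: trace_def matrix_def shape_op_component[OF q])
  then show ?thesis by (simp add: mean_curvature_def \<mu>_def)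
qed

lemma smooth_shape_op: "smooth_on U w \<Longrightarrow> smooth_on U (\<lambda>q. shape_op F N q (w q))"
proof -
  assume w: "smooth_on U w"
  have "smooth_on U (\<lambda>q. - tan_coords q (fd N q (w q)))"
    unfolding tan_coords_def
    by (intro smooth_rules smooth_on_vec_lambda smooth_metric_inv smooth_on_fd open_U w)
  then show ?thesis
    by (subst smooth_on_cong[OF open_U shape_op_eq]) auto
qed

text \<open>\<open>Cz i j l\<close> is \<open>- (\<nabla>\<^sub>i h)\<^sub>j\<^sub>l\<close>; its total symmetry is the Codazzi equation.\<close>

definition Cz :: "3 \<Rightarrow> 3 \<Rightarrow> 3 \<Rightarrow> real^3 \<Rightarrow> real" where
  "Cz i j l q = lorentz (partial i (partial j N) q) (partial l F q) + (\<Sum>k\<in>UNIV. christoffel F k i j q * h k l q)"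

lemma Cz_sym12:
  assumes q: "q \<in> U"
  shows "Cz i j l q = Cz j i l q"
proof -
  have "partial i (partial j N) q = partial j (partial i N) q" "partial i (partial j F) q = partial j (partial i F) q"
    by (rule fd_fd_sym[OF open_U smooth_N q] fd_fd_sym[OF open_U smooth_F q])+
  then show ?thesis by (simp add: Cz_def christoffel_eq[OF q])
qed

text \<open>Differentiating \<open>partial_N\<close> replaces second derivatives of \<open>N\<close>
  by derivatives of \<open>h\<close>, and \<open>h\<close> is symmetric.\<close>

lemma Cz_sym23:
  assumes q: "q \<in> U"
  shows "Cz i j l q = Cz i l j q"
proof -
  have "lorentz (partial i (partial j N) q) (partial l F q)
      = - partial i (h j l) q + (\<Sum>k\<in>UNIV. christoffel F k i l q * h j k q)" for j l
  proof -
    have "partial i (\<lambda>r. lorentz (partial j N r) (partial l F r)) q = partial i (\<lambda>r. - h j l r) q"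
      using partial_N by (intro fun_cong[OF fd_cong(2)[OF open_U q]])
    also have "\<dots> = - partial i (h j l) q"
      by (subst fd_eqI[OF has_derivative_minus[OF smooth_on_has_fd[OF smooth_h q]]]) simp
    finally have 1: "lorentz (partial j N q) (partial i (partial l F) q) + lorentz (partial i (partial j N) q) (partial l F q)
        = - partial i (h j l) q"
      by (simp add: fd_lorentz smooth_rules q)
    let ?v = "partial i (partial l F) q"
    have "lorentz (partial j N q) ?v = lorentz (partial j N q) (fd F q (tan_coords q ?v))"
      by (subst decomposition[OF q, of ?v]) (simp add: lorentz_simps dN_F[OF q] dN_normal[OF q])
    also have "\<dots> = - (\<Sum>k\<in>UNIV. christoffel F k i l q * h j k q)"
      unfolding fd_axis[OF smooth_F q, of "tan_coords q ?v"]
      by (simp add: lorentz.sum_right lorentz_simps partial_N[OF q] christoffel_eq[OF q] sum_negf)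
    finally show ?thesis using 1 by simp
  qed
  note eq = this
  have "partial i (h j l) q = partial i (h l j) q"
    using h_sym by (intro fun_cong[OF fd_cong(2)[OF open_U q]])
  then show ?thesis
    unfolding Cz_def eq by (simp add: h_sym[OF q, of l] h_sym[OF q, of j] algebra_simps)
qed

text \<open>Contraction with the metric commutes with covariant differentiation. In the mixed
  components \<open>S i m\<close> of the shape operator the two Christoffel sums coincide after
  renaming and cancel.\<close>

lemma Cz_trace:
  assumes q: "q \<in> U"
  shows "(\<Sum>i\<in>UNIV. \<Sum>j\<in>UNIV. metric_inv F q $ i $ j * Cz l i j q) = - partial l \<mu> q"
proof -
  define S where "S i m r = shape_op F N r (axis i 1) $ m" for i m :: 3 and r
  have smooth_S: "smooth_on U (S i m)" for i m
    unfolding S_def[abs_def] by (intro smooth_on_vec_nth open_U smooth_shape_op smooth_on_const)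
  have N1: "partial i N r = - (\<Sum>m\<in>UNIV. S i m r *\<^sub>R partial m F r)" if "r \<in> U" for i r
    using fd_shape_op[OF that, of "axis i 1"] fd_axis[OF smooth_F that, of "shape_op F N r (axis i 1)"]
    by (simp add: S_def minus_equation_iff)
  have N2: "partial l (partial i N) q =
      - (\<Sum>m\<in>UNIV. partial l (S i m) q *\<^sub>R partial m F q + S i m q *\<^sub>R partial l (partial m F) q)" for i
  proof -
    have "partial l (partial i N) q = partial l (\<lambda>r. - (\<Sum>m\<in>UNIV. S i m r *\<^sub>R partial m F r)) q"
      using N1 by (intro fun_cong[OF fd_cong(2)[OF open_U q]])
    also have "\<dots> = - (\<Sum>m\<in>UNIV. S i m q *\<^sub>R partial l (partial m F) q + partial l (S i m) q *\<^sub>R partial m F q)"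
      by (subst fd_eqI[OF has_derivative_minus[OF has_derivative_sum[OF has_derivative_scaleR[OF
            smooth_on_has_fd[OF smooth_S q] smooth_on_has_fd[OF smooth_on_fd_const[OF smooth_F] q]]]]]) simp
    finally show ?thesis by (simp add: add.commute)
  qed
  have tan_lin: "tan_coords q (\<Sum>m\<in>UNIV. f m) = (\<Sum>m\<in>UNIV. tan_coords q (f m))"
    "tan_coords q (a + b) = tan_coords q a + tan_coords q b" "tan_coords q (t *\<^sub>R a) = t *\<^sub>R tan_coords q a"
    "tan_coords q (- a) = - tan_coords q a" for f :: "3 \<Rightarrow> real^5" and a b t
    by (simp_all add: tan_coords_def vec_eq_iff lorentz.sum_left lorentz_simps distrib_left sum.distrib sum_negf
        sum_distrib_left mult_ac) (intro allI, rule sum.swap)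
  have "(\<Sum>j\<in>UNIV. metric_inv F q $ i $ j * lorentz (partial l (partial i N) q) (partial j F q))
      = - partial l (S i i) q - (\<Sum>m\<in>UNIV. S i m q * christoffel F i l m q)" for i
  proof -
    have "(\<Sum>j\<in>UNIV. metric_inv F q $ i $ j * lorentz (partial l (partial i N) q) (partial j F q))
        = tan_coords q (partial l (partial i N) q) $ i"
      by (simp add: tan_coords_def)
    also have "\<dots> = - (\<Sum>m\<in>UNIV. partial l (S i m) q * axis m 1 $ i + S i m q * christoffel F i l m q)"
      unfolding N2 by (simp add: tan_lin tan_coords_fd[OF q] christoffel_eq[OF q])
    also have "\<dots> = - partial l (S i i) q - (\<Sum>m\<in>UNIV. S i m q * christoffel F i l m q)"
    proof -
      have "axis m (1::real) $ i = (if m = i then 1 else 0)" for m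
        by (simp add: axis_def)
      then show ?thesis by (simp add: sum.distrib if_distrib[of "\<lambda>x. _ * x"] cong: if_cong)
    qed
    finally show ?thesis .
  qed
  moreover have "(\<Sum>j\<in>UNIV. metric_inv F q $ i $ j * (\<Sum>k\<in>UNIV. christoffel F k l i q * h k j q))
      = (\<Sum>k\<in>UNIV. christoffel F k l i q * S k i q)" for i
    by (simp add: S_def shape_op_component[OF q] sum_distrib_left mult_ac) (rule sum.swap)
  ultimately have "(\<Sum>i\<in>UNIV. \<Sum>j\<in>UNIV. metric_inv F q $ i $ j * Cz l i j q)
      = (\<Sum>i\<in>UNIV. - partial l (S i i) q - (\<Sum>m\<in>UNIV. S i m q * christoffel F i l m q)
          + (\<Sum>k\<in>UNIV. christoffel F k l i q * S k i q))"
    by (simp add: Cz_def distrib_left sum.distrib)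
  also have "\<dots> = - (\<Sum>i\<in>UNIV. partial l (S i i) q)"
    by (simp add: sum.distrib sum_subtractf sum_negf sum_3)
  also have "(\<Sum>i\<in>UNIV. partial l (S i i) q) = partial l \<mu> q"
  proof -
    have "partial l (\<lambda>r. \<Sum>i\<in>UNIV. S i i r) q = (\<Sum>i\<in>UNIV. partial l (S i i) q)"
      by (subst fd_eqI[OF has_derivative_sum[OF smooth_on_has_fd[OF smooth_S q]]]) simp
    moreover have "partial l \<mu> q = partial l (\<lambda>r. \<Sum>i\<in>UNIV. S i i r) q"
      by (intro fun_cong[OF fd_cong(2)[OF open_U q]]) (simp add: \<mu>_def S_def shape_op_component)
    ultimately show ?thesis by simp
  qed
  finally show ?thesis .
qed

section \<open>The tangential part of the bitension field\<close>

lemma gradient_property: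
  assumes q: "q \<in> U" and f: "smooth_on U f"
  shows "lorentz (fd F q (gradient F f q)) (fd F q w) = fd f q w"
proof -
  have "lorentz (fd F q (gradient F f q)) (partial l F q) = partial l f q" for l
  proof -
    have "lorentz (fd F q (gradient F f q)) (partial l F q)
        = (\<Sum>i\<in>UNIV. gradient F f q $ i * metric F q $ i $ l)"
      unfolding fd_axis[OF smooth_F q, of "gradient F f q"]
      by (simp add: lorentz.sum_left lorentz_simps metric_def)
    also have "\<dots> = (\<Sum>m\<in>UNIV. (\<Sum>k\<in>UNIV. metric_inv F q $ m $ k * metric F q $ k $ l) * partial m f q)"
      by (simp add: gradient_def sum_3 metric_inv_sym[OF q, of 2 1] metric_inv_sym[OF q, of 3 1]
          metric_inv_sym[OF q, of 3 2] algebra_simps)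
    finally show ?thesis
      by (simp add: metric_inv_metric[OF q] if_distrib[of "\<lambda>x. x * _"] cong: if_cong)
  qed
  then show ?thesis
    unfolding fd_axis[OF smooth_F q, of w] fd_axis[OF f q, of w]
    by (simp add: lorentz.sum_right lorentz_simps)
qed

lemma hcov_tension:
  assumes q: "q \<in> U"
  shows "hcov F w (tension F) q = fd \<mu> q w *\<^sub>R N q + \<mu> q *\<^sub>R fd N q w"
proof -
  have "fd (tension F) q w = fd (\<lambda>r. \<mu> r *\<^sub>R N r) q w"
    by (intro fun_cong[OF fd_cong(2)[OF open_U q]] tension_eq)
  also have "\<dots> = fd \<mu> q w *\<^sub>R N q + \<mu> q *\<^sub>R fd N q w"
    by (simp add: fd_scaleR smooth_\<mu> smooth_N q add.commute)
  finally show ?thesis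
    by (simp add: hcov_def lorentz_simps NF[OF q] dN_F[OF q])
qed

lemma second_hcov_tension:
  assumes q: "q \<in> U"
  shows "lorentz (hcov F (axis i 1) (hcov F (axis j 1) (tension F)) q) (partial l F q)
    = - partial j \<mu> q * h i l q - partial i \<mu> q * h j l q + \<mu> q * lorentz (partial i (partial j N) q) (partial l F q)"
proof -
  have "partial i (hcov F (axis j 1) (tension F)) q = partial i (\<lambda>r. partial j \<mu> r *\<^sub>R N r + \<mu> r *\<^sub>R partial j N r) q"
    by (intro fun_cong[OF fd_cong(2)[OF open_U q]] hcov_tension)
  also have "\<dots> = partial i (\<lambda>r. partial j \<mu> r *\<^sub>R N r) q + partial i (\<lambda>r. \<mu> r *\<^sub>R partial j N r) q"
    by (subst fd_eqI[OF has_derivative_add[OF smooth_on_has_fd[OF _ q] smooth_on_has_fd[OF _ q]]])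
      (auto intro!: smooth_rules smooth_\<mu>)
  finally show ?thesis
    unfolding hcov_def
    by (simp add: fd_scaleR smooth_rules smooth_\<mu> q lorentz_simps F_tangent[OF q] N_tangent[OF q] partial_N[OF q]
        algebra_simps)
qed

text \<open>The curvature term is normal, since the tension is. The Laplacian of
  \<open>\<mu> *\<^sub>R N\<close> contributes two equal gradient terms and \<open>\<mu>\<close>
  times a divergence of \<open>h\<close>, which Codazzi turns into the derivative of the
  trace.\<close>

lemma bitension_tangential:
  assumes q: "q \<in> U"
  shows "lorentz (bitension F q) (partial l F q) =
    - 2 * (\<Sum>i\<in>UNIV. gradient F \<mu> q $ i * h i l q) - \<mu> q * partial l \<mu> q"
proof -
  let ?g = "\<lambda>i j. metric_inv F q $ i $ j"
  have curv: "lorentz (hcurv (partial i F q) (tension F q) (partial j F q)) (partial l F q) = 0" for i j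
    by (simp add: hcurv_def tension_eq[OF q] lorentz_simps N_tangent[OF q])
  have hc: "lorentz (hcov F (axis k 1) (tension F) q) (partial l F q) = - \<mu> q * h k l q" for k
    by (simp add: hcov_tension[OF q] lorentz_simps N_tangent[OF q] partial_N[OF q])
  have "lorentz (bitension F q) (partial l F q) = (\<Sum>i\<in>UNIV. \<Sum>j\<in>UNIV. ?g i j *
      (- partial j \<mu> q * h i l q - partial i \<mu> q * h j l q + \<mu> q * Cz i j l q))"
    unfolding bitension_def rough_laplacian_def
    by (simp add: lorentz.sum_left lorentz_simps curv hc second_hcov_tension[OF q] Cz_def sum_negf
        sum_distrib_left algebra_simps)
  also have "\<dots> = - (\<Sum>i\<in>UNIV. (\<Sum>j\<in>UNIV. ?g i j * partial j \<mu> q) * h i l q)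
      - (\<Sum>i\<in>UNIV. \<Sum>j\<in>UNIV. ?g i j * partial i \<mu> q * h j l q) + \<mu> q * (\<Sum>i\<in>UNIV. \<Sum>j\<in>UNIV. ?g i j * Cz i j l q)"
    by (simp add: sum_3 algebra_simps)
  also have "(\<Sum>i\<in>UNIV. \<Sum>j\<in>UNIV. ?g i j * partial i \<mu> q * h j l q)
      = (\<Sum>i\<in>UNIV. (\<Sum>j\<in>UNIV. ?g i j * partial j \<mu> q) * h i l q)"
    by (simp add: sum_3 metric_inv_sym[OF q, of 2 1] metric_inv_sym[OF q, of 3 1]
        metric_inv_sym[OF q, of 3 2] algebra_simps)
  also have "(\<Sum>i\<in>UNIV. \<Sum>j\<in>UNIV. ?g i j * Cz i j l q) = (\<Sum>i\<in>UNIV. \<Sum>j\<in>UNIV. ?g i j * Cz l i j q)"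
    using Cz_sym12[OF q] Cz_sym23[OF q] by (intro sum.cong refl arg_cong2[of _ _ _ _ "(*)"]) metis
  also have "\<dots> = - partial l \<mu> q" by (rule Cz_trace[OF q])
  finally show ?thesis
    by (simp add: gradient_def)
qed

lemma tangential_part_lorentz:
  assumes q: "q \<in> U"
  shows "lorentz (tangential_part F q v) (partial l F q) = lorentz v (partial l F q)"
proof -
  have "lorentz (tangential_part F q v) (partial l F q)
      = (\<Sum>i\<in>UNIV. lorentz v (partial i F q) * (\<Sum>j\<in>UNIV. metric_inv F q $ i $ j * metric F q $ j $ l))"
    by (simp add: tangential_part_def lorentz.sum_left lorentz_simps metric_def sum_distrib_left mult_ac)
  then show ?thesis
    by (simp add: metric_inv_metric[OF q] if_distrib[of "\<lambda>x. _ * x"] cong: if_cong)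
qed

lemma biconservative_principal:
  assumes q: "q \<in> U" and "tangential_part F q (bitension F q) = 0"
  shows "shape_op F N q (gradient F \<mu> q) = (- \<mu> q / 2) *\<^sub>R gradient F \<mu> q"
proof -
  let ?G = "gradient F \<mu> q"
  have z: "lorentz (fd N q ?G - (\<mu> q / 2) *\<^sub>R fd F q ?G) (partial l F q) = 0" for l
  proof -
    have "- 2 * (\<Sum>i\<in>UNIV. ?G $ i * h i l q) - \<mu> q * partial l \<mu> q = 0"
      using tangential_part_lorentz[OF q, of "bitension F q" l] bitension_tangential[OF q, of l] assms(2)
      by (simp add: lorentz_simps)
    moreover have "lorentz (fd N q ?G) (partial l F q) = - (\<Sum>i\<in>UNIV. ?G $ i * h i l q)"
      unfolding fd_axis[OF smooth_N q, of ?G]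
      by (simp add: lorentz.sum_left lorentz_simps partial_N[OF q] sum_negf)
    ultimately show ?thesis
      by (simp add: lorentz_simps gradient_property[OF q smooth_\<mu>])
  qed
  have "lorentz (fd N q ?G - (\<mu> q / 2) *\<^sub>R fd F q ?G) (fd F q w) = 0" for w
    unfolding fd_axis[OF smooth_F q, of w] by (simp only: lorentz.sum_right lorentz.scaleR_right z) simp
  then have "fd N q ?G - (\<mu> q / 2) *\<^sub>R fd F q ?G = 0"
    by (intro ambient_eq_0[OF q])
      (simp_all add: lorentz_simps dN_F[OF q] F_tangent[OF q] dN_normal[OF q] lorentz_commute[of "fd F q _" "N q"] N_tangent[OF q])
  then have "fd N q ?G = (\<mu> q / 2) *\<^sub>R fd F q ?G" by simp
  also have "\<dots> = fd F q ((\<mu> q / 2) *\<^sub>R ?G)"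
    using linear_scale[OF linear_fd[OF smooth_F q]] by metis
  finally show ?thesis
    unfolding shape_op_eq[OF q] by (simp add: tan_coords_fd[OF q])
qed

lemma gradient_mean_curvature:
  assumes q: "q \<in> U"
  shows "gradient F (mean_curvature F N) q = (1/3) *\<^sub>R gradient F \<mu> q"
proof -
  have *: "partial j (mean_curvature F N) q = partial j \<mu> q / 3" for j
  proof -
    have "partial j (mean_curvature F N) q = partial j (\<lambda>r. \<mu> r / 3) q"
      by (intro fun_cong[OF fd_cong(2)[OF open_U q]] mean_curvature_eq)
    also have "\<dots> = partial j \<mu> q / 3"
      by (subst fd_eqI[OF bounded_linear.has_derivative[OF bounded_linear_divide smooth_on_has_fd[OF smooth_\<mu> q]]]) simp
    finally show ?thesis .
  qed
  show ?thesis
    by (simp add: gradient_def * vec_eq_iff sum_divide_distrib)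
qed

end

section \<open>Local principal frames and the classification\<close>

text \<open>Independence: \<open>(S - a) (S - b)\<close> with two of the eigenvalues leaves only the
  third term of a vanishing combination. The traces follow by diagonalising. The trace of the square
  is wanted because it recovers the two remaining curvatures smoothly.\<close>

lemma distinct_eigenvalues:
  fixes S :: "real^3 \<Rightarrow> real^3" and w :: "3 \<Rightarrow> real^3" and l :: "3 \<Rightarrow> real"
  assumes lin: "linear S" and w: "\<And>i. S (w i) = l i *\<^sub>R w i" "\<And>i. w i \<noteq> 0"
    and l: "\<And>i j. i \<noteq> j \<Longrightarrow> l i \<noteq> l j"
  shows "\<exists>c. v = (\<Sum>i\<in>UNIV. c i *\<^sub>R w i)"
    and "trace (matrix S) = (\<Sum>i\<in>UNIV. l i)"
    and "trace (matrix S ** matrix S) = (\<Sum>i\<in>UNIV. l i * l i)"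
proof -
  let ?B = "\<lambda>c::real^3. \<Sum>i\<in>UNIV. c $ i *\<^sub>R w i"
  have linB: "linear ?B"
    by (intro linearI) (simp_all add: sum.distrib scaleR_add_left scaleR_sum_right)
  have S_sum: "S (\<Sum>i\<in>UNIV. c i *\<^sub>R w i) = (\<Sum>i\<in>UNIV. (l i * c i) *\<^sub>R w i)" for c
    by (simp add: linear_sum[OF lin] linear_scale[OF lin] w mult.commute)
  have "c = 0" if "?B c = 0" for c
  proof -
    have 0: "?B c = 0" "(\<Sum>i\<in>UNIV. (l i * c $ i) *\<^sub>R w i) = 0" "(\<Sum>i\<in>UNIV. (l i * (l i * c $ i)) *\<^sub>R w i) = 0"
      using that S_sum[of "\<lambda>i. c $ i"] S_sum[of "\<lambda>i. l i * c $ i"] linear_0[OF lin] by simp_all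
    have "(\<Sum>i\<in>UNIV. (l i * (l i * c $ i)) *\<^sub>R w i) - (a + b) *\<^sub>R (\<Sum>i\<in>UNIV. (l i * c $ i) *\<^sub>R w i) + (a * b) *\<^sub>R ?B c
        = (\<Sum>i\<in>UNIV. ((l i - a) * (l i - b) * c $ i) *\<^sub>R w i)" for a b
      by (simp add: sum_3 algebra_simps)
    then have *: "(\<Sum>i\<in>UNIV. ((l i - a) * (l i - b) * c $ i) *\<^sub>R w i) = 0" for a b
      unfolding 0 by simp
    have "\<forall>i. c $ i = 0"
      using *[of "l 2" "l 3"] *[of "l 1" "l 3"] *[of "l 1" "l 2"] w(2) l[of 1 2] l[of 1 3] l[of 2 3]
      unfolding forall_3 by (simp add: sum_3)
    then show "c = 0" by (simp add: vec_eq_iff)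
  qed
  then have inj: "inj ?B" using linear_injective_0[OF linB] by blast
  then have "surj ?B" using linear_injective_imp_surjective[OF linB] by simp
  then obtain c where "v = ?B c" by (rule surjE)
  then show "\<exists>c. v = (\<Sum>i\<in>UNIV. c i *\<^sub>R w i)" by blast
  define P where "P = matrix ?B"
  define L :: "real^3^3" where "L = (\<chi> i j. if i = j then l i else 0)"
  define M where "M = matrix S"
  have Pv: "P *v c = ?B c" for c
    using matrix_works[OF linear_matrix_vector_mul_eq[THEN iffD2, OF linB]] by (simp add: P_def)
  have Mv: "M *v v = S v" for v
    using matrix_works[OF linear_matrix_vector_mul_eq[THEN iffD2, OF lin]] by (simp add: M_def)
  have "invertible P"
    using inj_matrix_vector_mult inj Pv matrix_left_invertible_injective[of P] by (simp add: invertible_left_inverse inj_def)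
  then obtain R where R: "P ** R = mat 1" "R ** P = mat 1" by (auto simp: invertible_def)
  have "M ** P = P ** L"
  proof -
    have "(M ** P) *v c = (P ** L) *v c" for c
    proof -
      have "(L *v c) $ i = l i * c $ i" for i
        by (simp add: L_def matrix_vector_mult_def if_distrib[of "\<lambda>x. x * _"] cong: if_cong)
      then show ?thesis
        by (simp add: matrix_vector_mul_assoc[symmetric] Pv Mv S_sum)
    qed
    then show ?thesis by (simp add: matrix_eq)
  qed
  then have M: "M = P ** (L ** R)"
    using R(1) by (metis matrix_mul_assoc matrix_mul_rid)
  have MM: "M ** M = P ** ((L ** L) ** R)"
    unfolding M using R(2) by (metis matrix_mul_assoc matrix_mul_lid)
  have tr: "trace (P ** (A ** R)) = trace A" for A :: "real^3^3"
    using trace_mul_sym[of P "A ** R"] R(2) by (metis matrix_mul_assoc matrix_mul_rid)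
  show "trace (matrix S) = (\<Sum>i\<in>UNIV. l i)"
    using tr[of L] M by (simp add: M_def trace_def L_def)
  have "(L ** L) $ i $ i = l i * l i" for i
    by (simp add: L_def matrix_matrix_mult_def if_distrib[of "\<lambda>x. x * _"] cong: if_cong)
  then show "trace (matrix S ** matrix S) = (\<Sum>i\<in>UNIV. l i * l i)"
    using tr[of "L ** L"] MM by (simp add: M_def trace_def)
qed

locale biconservative_patch = hypersurface_patch +
  assumes three_curvatures: "\<And>q. q \<in> U \<Longrightarrow> card (principal_curvatures F N q) = 3"
    and biconservative: "\<And>q. q \<in> U \<Longrightarrow> tangential_part F q (bitension F q) = 0"
    and gradient_nonzero: "\<And>q. q \<in> U \<Longrightarrow> gradient F (mean_curvature F N) q \<noteq> 0"
begin

abbreviation S :: "real^3 \<Rightarrow> real^3 \<Rightarrow> real^3" where "S \<equiv> shape_op F N"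

text \<open>The discriminant \<open>(k 2 - k 3)^2\<close>, written as
  \<open>2 * (k 2^2 + k 3^2) - (k 2 + k 3)^2\<close> with the traces of \<open>S\<close> and its
  square, so that it is visibly smooth.\<close>

definition \<Delta> :: "real^3 \<Rightarrow> real" where
  "\<Delta> q = 2 * (trace (matrix (S q) ** matrix (S q)) - (\<mu> q / 2)\<^sup>2) - (3 * \<mu> q / 2)\<^sup>2"

definition \<kappa> :: "3 \<Rightarrow> real^3 \<Rightarrow> real" where
  "\<kappa> i q = (if i = 1 then - \<mu> q / 2 else if i = 2 then (3 * \<mu> q / 2 + sqrt (\<Delta> q)) / 2
     else (3 * \<mu> q / 2 - sqrt (\<Delta> q)) / 2)"

lemma gradient_\<mu>: "q \<in> U \<Longrightarrow> gradient F \<mu> q \<noteq> 0"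
  using gradient_nonzero gradient_mean_curvature by auto

text \<open>Biconservativity supplies the eigenvalue \<open>- \<mu> / 2\<close>; the other two are
  determined by the traces, and calling the larger one \<open>a\<close> fits the choice of the
  positive root in \<open>\<kappa> 2\<close>.\<close>

lemma spectral:
  assumes q: "q \<in> U"
  shows "\<Delta> q > 0" and "\<And>i j. i \<noteq> j \<Longrightarrow> \<kappa> i q \<noteq> \<kappa> j q" and "\<exists>w. \<forall>i. w i \<noteq> 0 \<and> S q (w i) = \<kappa> i q *\<^sub>R w i"
proof -
  let ?k = "- \<mu> q / 2"
  have G: "S q (gradient F \<mu> q) = ?k *\<^sub>R gradient F \<mu> q"
    by (rule biconservative_principal[OF q biconservative[OF q]])
  then have k: "?k \<in> principal_curvatures F N q"
    using gradient_\<mu>[OF q] by (auto simp: principal_curvatures_def)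
  obtain x y z where xyz: "principal_curvatures F N q = {x, y, z}" "x \<noteq> y" "x \<noteq> z" "y \<noteq> z"
    using three_curvatures[OF q] by (auto simp: card_3_iff)
  obtain a b where ab: "a \<in> principal_curvatures F N q" "b \<in> principal_curvatures F N q"
    "?k \<noteq> a" "?k \<noteq> b" "a > b"
  proof -
    have "\<exists>a b. a \<in> {x, y, z} \<and> b \<in> {x, y, z} \<and> ?k \<noteq> a \<and> ?k \<noteq> b \<and> a \<noteq> b"
      using k xyz(2-4) unfolding xyz(1) by (elim insertE) (metis insertI1 insertI2 emptyE)+
    then obtain a b where "a \<in> {x, y, z}" "b \<in> {x, y, z}" "?k \<noteq> a" "?k \<noteq> b" "a \<noteq> b" by blast
    then show thesis
      using that[of a b] that[of b a] xyz(1) by (cases "a > b") auto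
  qed
  obtain wa where wa: "wa \<noteq> 0" "S q wa = a *\<^sub>R wa" using ab(1) by (auto simp: principal_curvatures_def)
  obtain wb where wb: "wb \<noteq> 0" "S q wb = b *\<^sub>R wb" using ab(2) by (auto simp: principal_curvatures_def)
  define l where "l i = (if i = 1 then ?k else if i = 2 then a else b)" for i :: 3
  define w where "w i = (if i = 1 then gradient F \<mu> q else if i = 2 then wa else wb)" for i :: 3
  have w: "S q (w i) = l i *\<^sub>R w i" "w i \<noteq> 0" for i
    using G wa wb gradient_\<mu>[OF q] by (simp_all add: l_def w_def)
  have l: "l i \<noteq> l j" if "i \<noteq> j" for i j
    using that ab(3-5) exhaust_3[of i] exhaust_3[of j] by (auto simp: l_def)
  note tr = distinct_eigenvalues(2,3)[OF linear_shape_op[OF q] w l]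
  have "\<mu> q = ?k + a + b"
    using tr(1) mean_curvature_eq[OF q] by (simp add: mean_curvature_def l_def sum_3)
  then have sum: "a + b = 3 * \<mu> q / 2" by simp
  have "trace (matrix (S q) ** matrix (S q)) = (\<mu> q / 2)\<^sup>2 + a\<^sup>2 + b\<^sup>2"
    using tr(2) by (simp add: l_def sum_3 power2_eq_square)
  then have "\<Delta> q = (a - b)\<^sup>2"
    unfolding \<Delta>_def sum[symmetric] by (simp add: power2_eq_square algebra_simps)
  with ab(5) show "\<Delta> q > 0" by simp
  have "sqrt (\<Delta> q) = a - b"
    using \<open>\<Delta> q = (a - b)\<^sup>2\<close> ab(5) by simp
  then have \<kappa>: "\<kappa> i q = l i" for i
    using sum by (simp add: \<kappa>_def l_def)
  then show "\<And>i j. i \<noteq> j \<Longrightarrow> \<kappa> i q \<noteq> \<kappa> j q" using l by simp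
  show "\<exists>w. \<forall>i. w i \<noteq> 0 \<and> S q (w i) = \<kappa> i q *\<^sub>R w i"
    using w \<kappa> by auto
qed

lemma smooth_\<kappa>: "smooth_on U (\<kappa> i)"
proof -
  have "smooth_on U (\<lambda>q. matrix (S q) $ i $ j)" for i j
    unfolding matrix_def by (simp add: smooth_on_vec_nth open_U smooth_shape_op smooth_on_const)
  then have \<Delta>: "smooth_on U \<Delta>"
    unfolding \<Delta>_def[abs_def] trace_def matrix_matrix_mult_def
    by (simp only: vec_lambda_beta) (intro smooth_rules smooth_\<mu> smooth_on_power smooth_on_divide open_U; simp)
  have "smooth_on U (\<lambda>q. sqrt (\<Delta> q))"
    by (rule smooth_on_sqrt[OF open_U \<Delta> spectral(1)])
  then have "smooth_on U (\<lambda>q. - \<mu> q / 2)" "smooth_on U (\<lambda>q. (3 * \<mu> q / 2 + sqrt (\<Delta> q)) / 2)"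
    "smooth_on U (\<lambda>q. (3 * \<mu> q / 2 - sqrt (\<Delta> q)) / 2)"
    by (intro smooth_rules smooth_\<mu> smooth_on_divide open_U; simp)+
  then show ?thesis
    unfolding \<kappa>_def[abs_def] by (cases "i = 1"; cases "i = 2") simp_all
qed

lemma principal_orthogonal:
  assumes q: "q \<in> U" and "S q v = a *\<^sub>R v" "S q w = b *\<^sub>R w" "a \<noteq> b"
  shows "lorentz (fd F q v) (fd F q w) = 0"
proof -
  have N: "fd N q v = - (a *\<^sub>R fd F q v)" if "S q v = a *\<^sub>R v" for v a
    using fd_shape_op[OF q, of v] that linear_scale[OF linear_fd[OF smooth_F q]] by (metis minus_minus)
  have "lorentz (fd N q v) (fd F q w) = lorentz (fd N q w) (fd F q v)"
    by (rule dN_dF_sym[OF q])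
  then have "(a - b) * lorentz (fd F q v) (fd F q w) = 0"
    unfolding N[OF assms(2)] N[OF assms(3)]
    by (simp add: lorentz_simps lorentz_commute[of "fd F q w"] algebra_simps)
  with assms(4) show ?thesis by simp
qed

text \<open>\<open>A j (A 1 v)\<close> kills the two other eigenvectors, so it is a nonzero multiple
  of the projection to the eigenline of \<open>\<kappa> i\<close>. Unlike a pointwise choice of
  eigenvectors it depends smoothly on \<open>q\<close>.\<close>

lemma eigenvector_projection:
  assumes q: "q \<in> U" and ij: "i \<noteq> 1" "j \<noteq> 1" "i \<noteq> j"
  defines "A \<equiv> \<lambda>l v. S q v - \<kappa> l q *\<^sub>R v"
  shows "S q (A j (A 1 v)) = \<kappa> i q *\<^sub>R A j (A 1 v)"
    and "S q v = \<kappa> i q *\<^sub>R v \<Longrightarrow> v \<noteq> 0 \<Longrightarrow> A j (A 1 v) \<noteq> 0"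
proof -
  note lin = linear_shape_op[OF q]
  obtain w where w: "\<And>i. S q (w i) = \<kappa> i q *\<^sub>R w i" "\<And>i. w i \<noteq> 0"
    using spectral(3)[OF q] by blast
  obtain c where v: "v = (\<Sum>i\<in>UNIV. c i *\<^sub>R w i)"
    using distinct_eigenvalues(1)[where l="\<lambda>i. \<kappa> i q" and w=w, OF lin w spectral(2)[OF q]] by blast
  have A: "A l (\<Sum>i\<in>UNIV. c i *\<^sub>R w i) = (\<Sum>i\<in>UNIV. ((\<kappa> i q - \<kappa> l q) * c i) *\<^sub>R w i)" for l c
    by (simp add: A_def linear_sum[OF lin] linear_scale[OF lin] w scaleR_sum_right sum_subtractf algebra_simps)
  have "A j (A 1 v) = (\<Sum>m\<in>UNIV. ((\<kappa> m q - \<kappa> j q) * ((\<kappa> m q - \<kappa> 1 q) * c m)) *\<^sub>R w m)"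
    unfolding v A ..
  also have "\<dots> = ((\<kappa> i q - \<kappa> j q) * ((\<kappa> i q - \<kappa> 1 q) * c i)) *\<^sub>R w i"
    using ij exhaust_3[of i] exhaust_3[of j] by (auto simp: sum_3)
  finally show "S q (A j (A 1 v)) = \<kappa> i q *\<^sub>R A j (A 1 v)"
    by (simp add: linear_scale[OF lin] w mult.commute)
  assume "S q v = \<kappa> i q *\<^sub>R v" "v \<noteq> 0"
  then have "A j (A 1 v) = ((\<kappa> i q - \<kappa> j q) * (\<kappa> i q - \<kappa> 1 q)) *\<^sub>R v"
    by (simp add: A_def linear_scale[OF lin] linear_diff[OF lin] algebra_simps)
  then show "A j (A 1 v) \<noteq> 0"
    using \<open>v \<noteq> 0\<close> spectral(2)[OF q ij(3)] spectral(2)[OF q ij(1)] by simp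
qed

lemma local_principal_frame:
  assumes q0: "q0 \<in> U"
  obtains V e where "q0 \<in> V" "V \<subseteq> U" "principal_frame V F N e \<kappa>"
proof -
  obtain w where w: "\<And>i. S q0 (w i) = \<kappa> i q0 *\<^sub>R w i" "\<And>i. w i \<noteq> 0"
    using spectral(3)[OF q0] by blast
  define A where "A q l v = S q v - \<kappa> l q *\<^sub>R v" for q l v
  \<comment> \<open>The vectors \<open>w 2\<close> and \<open>w 3\<close> are eigenvectors at
    \<open>q0\<close> only; their projections are eigenvectors everywhere and stay nonzero near
    \<open>q0\<close>.\<close>
  define d where "d i q = (if i = 1 then gradient F \<mu> q else if i = 2 then A q 3 (A q 1 (w 2)) else A q 2 (A q 1 (w 3)))"
    for i :: 3 and q
  have smooth_A: "smooth_on U (\<lambda>q. A q l (v q))" if "smooth_on U v" for l v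
    unfolding A_def by (intro smooth_rules smooth_shape_op smooth_\<kappa> that)
  have "smooth_on U (gradient F \<mu>)"
    unfolding gradient_def[abs_def]
    by (intro smooth_on_vec_lambda smooth_rules smooth_metric_inv smooth_\<mu> open_U)
  then have smooth_d: "smooth_on U (d i)" for i
    unfolding d_def[abs_def] using smooth_A[OF smooth_A[OF smooth_on_const]]
    by (cases "i = 1"; cases "i = 2") simp_all
  have S_d: "S q (d i q) = \<kappa> i q *\<^sub>R d i q" if q: "q \<in> U" for i q
    using exhaust_3[of i] biconservative_principal[OF q biconservative[OF q]]
      eigenvector_projection(1)[OF q, of 2 3 "w 2"] eigenvector_projection(1)[OF q, of 3 2 "w 3"]
    by (auto simp: d_def A_def \<kappa>_def[of 1])
  have d0: "d i q0 \<noteq> 0" for i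
    using exhaust_3[of i] gradient_\<mu>[OF q0] w
      eigenvector_projection(2)[OF q0, of 2 3 "w 2"] eigenvector_projection(2)[OF q0, of 3 2 "w 3"]
    by (auto simp: d_def A_def)
  have "open {q \<in> U. d i q \<noteq> 0}" for i
    using continuous_open_preimage[OF smooth_on_continuous[OF smooth_d] open_U, of "- {0}" i]
    by (simp add: open_Compl vimage_def Int_def)
  then have "open ({q \<in> U. d 2 q \<noteq> 0} \<inter> {q \<in> U. d 3 q \<noteq> 0})" by blast
  then obtain \<epsilon> where \<epsilon>: "\<epsilon> > 0" "ball q0 \<epsilon> \<subseteq> {q \<in> U. d 2 q \<noteq> 0} \<inter> {q \<in> U. d 3 q \<noteq> 0}"
    using q0 d0 by (metis (mono_tags, lifting) Int_iff mem_Collect_eq open_contains_ball)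
  define V where "V = ball q0 \<epsilon>"
  have V: "q \<in> U" if "q \<in> V" for q using \<epsilon>(2) that by (auto simp: V_def)
  have d: "d i q \<noteq> 0" if "q \<in> V" for i q
    using exhaust_3[of i] \<epsilon>(2) that gradient_\<mu>[OF V[OF that]] by (auto simp: V_def d_def[of 1])
  define n where "n i q = inverse (sqrt (lorentz (fd F q (d i q)) (fd F q (d i q))))" for i :: 3 and q
  have pos: "lorentz (fd F q (d i q)) (fd F q (d i q)) > 0" if "q \<in> V" for i q
    by (rule metric_pos[OF V[OF that] d[OF that]])
  have sqrt0: "sqrt (lorentz (fd F q (d i q)) (fd F q (d i q))) \<noteq> 0" if "q \<in> V" for i q
    using pos[OF that, of i] by simp
  have n: "n i q > 0" if "q \<in> V" for i q
    using pos[OF that] by (simp add: n_def)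
  define e where "e i q = n i q *\<^sub>R d i q" for i :: 3 and q
  have open_V: "open V" "V \<subseteq> U" using V by (auto simp: V_def)
  have smooth_n: "smooth_on V (n i)" for i
    unfolding n_def[abs_def]
    by (intro smooth_on_inverse smooth_on_sqrt smooth_on_lorentz smooth_on_fd open_V
        smooth_on_subset[OF smooth_d] smooth_on_subset[OF smooth_F] pos sqrt0)
  have S_e: "S q (e i q) = \<kappa> i q *\<^sub>R e i q" if "q \<in> V" for i q
    using S_d[OF V[OF that]] by (simp add: e_def linear_scale[OF linear_shape_op[OF V[OF that]]] mult.commute)
  have dF_e: "fd F q (e i q) = n i q *\<^sub>R fd F q (d i q)" if "q \<in> V" for i q
    by (simp add: e_def linear_scale[OF linear_fd[OF smooth_F V[OF that]]])
  have ortho: "lorentz (fd F q (e i q)) (fd F q (e j q)) = (if i = j then 1 else 0)" if q: "q \<in> V" for i j q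
  proof (cases "i = j")
    case True
    have "n i q * (n i q * lorentz (fd F q (d i q)) (fd F q (d i q))) = 1"
      using pos[OF q, of i] by (simp add: n_def mult.assoc[symmetric] inverse_eq_divide)
    with True show ?thesis by (simp add: dF_e[OF q] lorentz_simps)
  next
    case False
    then show ?thesis
      using principal_orthogonal[OF V[OF q] S_e[OF q] S_e[OF q] spectral(2)[OF V[OF q] False]] by simp
  qed
  \<comment> \<open>The differential of \<open>\<kappa> 1\<close> is a product with the direction of
    \<open>e 1\<close>, so it vanishes on \<open>e 2\<close> and \<open>e 3\<close>.\<close>
  have \<kappa>1: "fd (\<kappa> 1) q v = - (1/2) * lorentz (fd F q (d 1 q)) (fd F q v)" if "q \<in> V" for q v
  proof -
    have "\<kappa> 1 = (\<lambda>q. - (1/2) * \<mu> q)" by (auto simp: \<kappa>_def)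
    then have "fd (\<kappa> 1) q v = - (1/2) * fd \<mu> q v"
      using fd_eqI[OF bounded_linear.has_derivative[OF bounded_linear_mult_right smooth_on_has_fd[OF smooth_\<mu> V[OF that]]], of "- (1/2)"]
      by simp
    then show ?thesis
      by (simp add: gradient_property[OF V[OF that] smooth_\<mu>, symmetric] d_def)
  qed
  have d1: "fd F q (d 1 q) = inverse (n 1 q) *\<^sub>R fd F q (e 1 q)" if "q \<in> V" for q
    using n[OF that, of 1] by (simp add: dF_e[OF that])
  have "principal_frame V F N e \<kappa>"
  proof
    show "fd N q (e i q) = - \<kappa> i q *\<^sub>R fd F q (e i q)" if "q \<in> V" for q i
    proof -
      have "- fd N q (e i q) = \<kappa> i q *\<^sub>R fd F q (e i q)"
        using fd_shape_op[OF V[OF that], of "e i q"]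
        by (simp add: S_e[OF that] linear_scale[OF linear_fd[OF smooth_F V[OF that]]])
      then have "- (- fd N q (e i q)) = - (\<kappa> i q *\<^sub>R fd F q (e i q))" by (rule arg_cong)
      then show ?thesis by simp
    qed
    show "\<kappa> 2 q + \<kappa> 3 q = - 3 * \<kappa> 1 q" if "q \<in> V" for q
      by (simp add: \<kappa>_def field_simps)
    show "fd (\<kappa> 1) q (e 2 q) = 0" "fd (\<kappa> 1) q (e 3 q) = 0" "fd (\<kappa> 1) q (e 1 q) \<noteq> 0" if "q \<in> V" for q
      using n[OF that, of 1] by (simp_all add: \<kappa>1[OF that] d1[OF that] lorentz_simps ortho[OF that])
    show "smooth_on V (e i)" for i
      unfolding e_def[abs_def]
      by (intro smooth_on_scaleR open_V smooth_n smooth_on_subset[OF smooth_d])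
    show "convex V" by (simp add: V_def)
    show "lorentz (fd F q (e i q)) (N q) = 0" "lorentz (F q) (N q) = 0" if "q \<in> V" for q i
      using N_tangent[OF V[OF that]] NF[OF V[OF that]] by (simp_all only: lorentz_commute)
  qed (assumption | rule open_V smooth_on_subset[OF smooth_F open_V(2)] smooth_on_subset[OF smooth_N open_V(2)]
      smooth_on_subset[OF smooth_\<kappa> open_V(2)] FF[OF V] NN[OF V] ortho spectral(2)[OF V])+
  then show thesis
    using that[of V e] \<epsilon>(1) open_V(2) by (simp add: V_def)
qed

end

section \<open>Case distinction and return to the abstract hypersurface\<close>

context principal_frame
begin

text \<open>If \<open>c 2\<close> is not positive, \<open>e 2\<close> and \<open>e 3\<close> are
  exchanged, so that the exceptional plane is always the one of index 3.\<close>

lemma classification: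
  assumes "x0 \<in> V"
  shows "\<exists>c0 c1.
    (\<exists>\<alpha>. arc_length_curve_H2 {c0<..<c1} \<alpha> \<and> congruent_piece V F x0 (family1 \<alpha>) {c0<..<c1}) \<or>
    (\<exists>\<alpha>. arc_length_curve_H2 {c0<..<c1} \<alpha> \<and> congruent_piece V F x0 (family2 \<alpha>) {c0<..<c1}) \<or>
    (\<exists>A. 0 \<notin> {c0<..<c1} \<and> smooth_on {c0<..<c1} A \<and> congruent_piece V F x0 (family3 (1/2) A) {c0<..<c1})"
proof -
  interpret swap: principal_frame V F N "\<lambda>i. e (Transposition.transpose 2 3 i)" "\<lambda>i. k (Transposition.transpose 2 3 i)"
    by (rule swapped)
  have swap_c: "swap.c 3 x0 = c 2 x0"
    by (simp add: swap.c_def c_def swap.r_def r_def swap.\<omega>_def \<omega>_def swap.D_def[abs_def] D_def[abs_def])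
  consider "c 2 x0 > 0" "c 3 x0 > 0" | "c 3 x0 < 0" | "c 3 x0 = 0" | "c 2 x0 < 0" | "c 2 x0 = 0"
    by linarith
  then show ?thesis
  proof cases
    case 1
    then show ?thesis using family1_piece[OF assms] by blast
  next
    case 2
    then show ?thesis using family2_piece[OF assms] by blast
  next
    case 3
    then show ?thesis using family3_piece[OF assms] by blast
  next
    case 4
    then show ?thesis using swap.family2_piece[OF assms] unfolding swap_c by blast
  next
    case 5
    then show ?thesis using swap.family3_piece[OF assms] unfolding swap_c by blast
  qed
qed

end

lemma locally_congruent_atI:
  assumes param: "local_param X f U \<phi>" and V: "V \<subseteq> U" and piece: "congruent_piece V (f \<circ> \<phi>) x0 fam I"
  shows "locally_congruent_at X f (\<phi> x0) fam I"
proof -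
  obtain B :: "(real^3) set" and \<psi> \<Psi> T where B: "open B" "\<psi> ` B \<subseteq> V" "open (\<psi> ` B)" "homeomorphism (\<psi> ` B) B \<Psi> \<psi>"
    "x0 \<in> \<psi> ` B" "smooth_on B (\<lambda>y. f (\<phi> (\<psi> y)))"
    "\<And>y. y \<in> B \<Longrightarrow> inj (fd (\<lambda>y. f (\<phi> (\<psi> y))) y)" "\<And>y. y \<in> B \<Longrightarrow> y $ 1 \<in> I"
    "lorentz_isometry T" "\<And>y. y \<in> B \<Longrightarrow> f (\<phi> (\<psi> y)) = T (fam (y $ 1) (y $ 2) (y $ 3))"
    using piece unfolding congruent_piece_def comp_def by blast
  have U: "open U" "openin X (\<phi> ` U)" "embedding_map (top_of_set U) X \<phi>"
    using param by (auto simp: local_param_def)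
  have sub: "\<psi> ` B \<subseteq> U" using B(2) V by blast
  have hom: "homeomorphic_map (top_of_set U) (subtopology X (\<phi> ` U)) \<phi>"
    using U(3) by (simp add: embedding_map_def)
  have "openin (top_of_set U) (\<psi> ` B)"
    using B(3) sub by (simp add: open_openin_trans openin_open_eq U(1))
  then have "openin (subtopology X (\<phi> ` U)) (\<phi> ` (\<psi> ` B))"
    using homeomorphic_map_openness_eq[OF hom] by blast
  then have op: "openin X (\<phi> ` (\<psi> ` B))"
    using openin_trans_full U(2) by blast
  have "homeomorphic_map (top_of_set B) (top_of_set (\<psi> ` B)) \<psi>"
    unfolding homeomorphic_map_maps homeomorphic_maps_def using B(4)
    by (intro exI[of _ \<Psi>]) (auto simp: homeomorphism_def continuous_map_in_subtopology)
  then have "embedding_map (top_of_set B) (top_of_set U) \<psi>"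
    using sub by (simp add: embedding_map_def subtopology_subtopology Int_absorb1)
  then have emb: "embedding_map (top_of_set B) X (\<phi> \<circ> \<psi>)"
    by (rule embedding_map_compose) (rule U(3))
  have "local_param X f B (\<phi> \<circ> \<psi>)"
    unfolding local_param_def using B op emb by (simp add: image_comp comp_def)
  then show ?thesis
    unfolding locally_congruent_at_def using B
    by (intro exI[of _ B] exI[of _ "\<phi> \<circ> \<psi>"] exI[of _ T]) auto
qed

theorem theorem4p5:
  fixes X :: "'a topology" and f N :: "'a \<Rightarrow> real^5"
  assumes "oriented_hypersurface X f N"
    and "biconservative X f"
    and "three_distinct_principal_curvatures X f N"
    and "mean_curvature_grad_nonvanishing X f N"
  shows "\<forall>p\<in>topspace X. \<exists>c d :: real.
      (\<exists>\<alpha>. arc_length_curve_H2 {c<..<d} \<alpha> \<and>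
         locally_congruent_at X f p (family1 \<alpha>) {c<..<d}) \<or>
      (\<exists>\<alpha>. arc_length_curve_H2 {c<..<d} \<alpha> \<and>
         locally_congruent_at X f p (family2 \<alpha>) {c<..<d}) \<or>
      (\<exists>a A. a \<noteq> 0 \<and> 0 \<notin> {c<..<d} \<and> smooth_on {c<..<d} A \<and>
         locally_congruent_at X f p (family3 a A) {c<..<d}) \<or>
      (\<exists>a A. a \<noteq> 0 \<and> 0 \<notin> {c<..<d} \<and> smooth_on {c<..<d} A \<and>
         locally_congruent_at X f p (family4 a A) {c<..<d})"
proof (rule ballI, goal_cases)
  case p: (1 p)
  obtain U \<phi> where param: "local_param X f U \<phi>" and "p \<in> \<phi> ` U"
    using assms(1) p unfolding oriented_hypersurface_def by blast
  then obtain q0 where q0: "q0 \<in> U" "p = \<phi> q0" by blast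
  have "\<phi> q \<in> topspace X" if "q \<in> U" for q
    using param that openin_subset unfolding local_param_def by blast
  then have FF: "lorentz ((f \<circ> \<phi>) q) ((f \<circ> \<phi>) q) = -1" if "q \<in> U" for q
    using assms(1) that unfolding oriented_hypersurface_def hyp_space_def by force
  interpret biconservative_patch U "f \<circ> \<phi>" "N \<circ> \<phi>"
    using param assms FF
    by unfold_locales
      (auto simp: local_param_def oriented_hypersurface_def biconservative_def
        three_distinct_principal_curvatures_def mean_curvature_grad_nonvanishing_def)
  obtain V e where V: "q0 \<in> V" "V \<subseteq> U" "principal_frame V (f \<circ> \<phi>) (N \<circ> \<phi>) e \<kappa>"
    using local_principal_frame[OF q0(1)] by blast
  have congruent: "congruent_piece V (f \<circ> \<phi>) q0 fam I \<Longrightarrow> locally_congruent_at X f p fam I" for fam I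
    using locally_congruent_atI[OF param V(2)] q0(2) by simp
  have half: "(1/2 :: real) \<noteq> 0" by simp
  show ?case
    using principal_frame.classification[OF V(3,1)] congruent half by meson
qed

end
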